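(* Suppose that $M$ is RCDD, its nonzero entries have absolute values $\Omega(1)$, we can sample from $|t|/\|t\|_1$ in $O(1)$ time, $\|t\|_1$ and $f_{\mathrm{row}}(M)$ are known, and we can scan the nonzero entries of $b$ in $O(\|b\|_0)$ time. Then there exists a randomized algorithm that computes $\hat x$ with $\Pr\{|\hat x-t^{\top}x^{\ast}|\le\varepsilon\}\ge\frac34$ in time $O(\|b\|_0)$ plus $$O\!\left(\min\Big(f_{\mathrm{row}}(M)^{1/3}\|t\|_1^{2/3}\|b\|_1^{2/3}L^{7/3}\varepsilon^{-2/3},\ f_{\mathrm{row}}(M)^{1/2}\|t\|_1\|b\|_1^{1/2}\|D_M^{-1}b\|_\infty^{1/2}L^{5/2}\varepsilon^{-1}\Big)\right).$$
   Context: Setting: $M\in\mathbb{R}^{n\times n}$, $b\in\operatorname{range}(M)$, $t\in\mathbb{R}^n$, $b,t\ne0$, nonzero entries of absolute value in $[1/\mathrm{poly}(n),\mathrm{poly}(n)]$. RCDD: both $M$ and $M^{\top}$ are RDD (positive diagonal, $M(j,j)\ge\sum_{k\ne j}|M(j,k)|$). Write $M=D_M-A_M^{\top}$ ($D_M$ diagonal part, $A_M^{\top}$ zero diagonal); $x^{\ast}:=\frac12\sum_{\ell\ge0}(\frac12(I+D_M^{-1}A_M^{\top}))^{\ell}D_M^{-1}b$. Access: diagonal of $M$ in $O(1)$; nonzero entries of rows/columns of $M$ in time linear in their number; entries of $b,t$ in $O(1)$. The algorithm is given $\varepsilon>0$ and $0<\gamma\le\gamma_{\max}(M)$ with $\gamma_{\max}(M)=\max_{p\in[1,\infty]}\big(1-\|\frac12(I+D_M^{-1/q}A_M^{\top}D_M^{-1/p})|_{\operatorname{range}(I-D_M^{-1/q}A_M^{\top}D_M^{-1/p})}\|_p\big)$,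 $q$ conjugate to $p$; $L=\Theta\big(\frac1\gamma\log(\frac{1}{\gamma\varepsilon}d_{\max}(M)\|t\|_0\|D_M^{-1}t\|_\infty\|b\|_0\|D_M^{-1}b\|_\infty)\big)$, with suitable bounds on quantities inside the log known. $f_{\mathrm{row}}(M)$: maximum time to simulate one step of the (possibly terminating) random walk with transition matrix $\frac12(I+D_M^{-1}|A_M^{\top}|)$. *)

theory Defs
  imports "HOL-Probability.SPMF" "Jordan_Normal_Form.Matrix"
begin

section \<open>Matrices, norms, the target vector\<close>

text \<open>Dimensions vary inside the main statement (one algorithm serves every \<open>n\<close>), hence vectors and
  matrices with explicit carriers.\<close>

definition rdd :: "real mat \<Rightarrow> bool" where
  "rdd M \<longleftrightarrow> (\<forall>j<dim_row M. M $$ (j, j) > 0 \<and>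
     M $$ (j, j) \<ge> (\<Sum>k\<in>{..<dim_col M} - {j}. \<bar>M $$ (j, k)\<bar>))"

definition rcdd :: "real mat \<Rightarrow> bool" where
  "rcdd M \<longleftrightarrow> rdd M \<and> rdd (transpose_mat M)"

definition diag_part :: "real mat \<Rightarrow> real mat" where
  "diag_part M = mat (dim_row M) (dim_row M) (\<lambda>(i, j). if i = j then M $$ (i, i) else 0)"

text \<open>\<open>diag_powr M a\<close> is \<open>D\<^sub>M\<close> to the power \<open>a\<close> (for a positive diagonal), and \<open>adj_T M\<close> is the
  matrix written \<open>A\<^sub>M\<close> transposed, so that \<open>M = diag_part M - adj_T M\<close>.\<close>

definition diag_powr :: "real mat \<Rightarrow> real \<Rightarrow> real mat" where
  "diag_powr M a = mat (dim_row M) (dim_row M) (\<lambda>(i, j). if i = j then M $$ (i, i) powr a else 0)"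

definition adj_T :: "real mat \<Rightarrow> real mat" where
  "adj_T M = diag_part M - M"

definition mat_range :: "real mat \<Rightarrow> real vec set" where
  "mat_range A = {A *\<^sub>v x | x. x \<in> carrier_vec (dim_col A)}"

definition l0_norm :: "real vec \<Rightarrow> nat" where
  "l0_norm x = card {i. i < dim_vec x \<and> vec_index x i \<noteq> 0}"

definition lp_norm :: "ereal \<Rightarrow> real vec \<Rightarrow> real" where
  "lp_norm p x =
     (if p = \<infinity> then Max (insert 0 ((\<lambda>i. \<bar>vec_index x i\<bar>) ` {..<dim_vec x}))
      else (\<Sum>i<dim_vec x. \<bar>vec_index x i\<bar> powr real_of_ereal p) powr (1 / real_of_ereal p))"

definition restricted_opnorm :: "ereal \<Rightarrow> real mat \<Rightarrow> real vec set \<Rightarrow> real" where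
  "restricted_opnorm p K S = Sup {lp_norm p (K *\<^sub>v v) | v. v \<in> S \<and> lp_norm p v \<le> 1}"

definition d_max :: "real mat \<Rightarrow> real" where
  "d_max M = Max ((\<lambda>j. M $$ (j, j)) ` {..<dim_row M})"

definition scaled_adj :: "real mat \<Rightarrow> ereal \<Rightarrow> ereal \<Rightarrow> real mat" where
  "scaled_adj M p q =
     diag_powr M (- real_of_ereal (1 / q)) * adj_T M * diag_powr M (- real_of_ereal (1 / p))"

definition gamma_max :: "real mat \<Rightarrow> real" where
  "gamma_max M = Sup {1 - restricted_opnorm p
        ((1/2) \<cdot>\<^sub>m (1\<^sub>m (dim_row M) + scaled_adj M p q))
        (mat_range (1\<^sub>m (dim_row M) - scaled_adj M p q)) | p q.
        1 \<le> p \<and> 1 \<le> q \<and> 1 / p + 1 / q = 1}"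

definition walk_mat :: "real mat \<Rightarrow> real mat" where
  "walk_mat M = (1/2) \<cdot>\<^sub>m (1\<^sub>m (dim_row M) + diag_powr M (-1) * adj_T M)"

definition x_star :: "real mat \<Rightarrow> real vec \<Rightarrow> real vec" where
  "x_star M b = vec (dim_row M) (\<lambda>i.
     1/2 * (\<Sum>l. vec_index ((walk_mat M ^\<^sub>m l) *\<^sub>v (diag_powr M (-1) *\<^sub>v b)) i))"

text \<open>The product under the logarithm, without the factor \<open>1 / (\<gamma> \<epsilon>)\<close>. As usual under \<open>\<Theta>\<close>, the
  logarithm is read as at least 1, so that the length parameter stays meaningful for large \<open>\<epsilon>\<close>.\<close>

definition log_arg :: "real mat \<Rightarrow> real vec \<Rightarrow> real vec \<Rightarrow> real" where
  "log_arg M b t = d_max M * real (l0_norm t) * lp_norm \<infinity> (diag_powr M (-1) *\<^sub>v t)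
      * real (l0_norm b) * lp_norm \<infinity> (diag_powr M (-1) *\<^sub>v b)"

definition log1 :: "real \<Rightarrow> real" where
  "log1 x = max 1 (ln x)"

definition trunc_len :: "real \<Rightarrow> real \<Rightarrow> real mat \<Rightarrow> real vec \<Rightarrow> real vec \<Rightarrow> real" where
  "trunc_len \<epsilon> \<gamma> M b t = 1 / \<gamma> * log1 (1 / (\<gamma> * \<epsilon>) * log_arg M b t)"

definition poly_bounded :: "nat \<Rightarrow> nat \<Rightarrow> real \<Rightarrow> bool" where
  "poly_bounded k n x \<longleftrightarrow> x \<noteq> 0 \<longrightarrow> 1 / real (n + 1) ^ k \<le> \<bar>x\<bar> \<and> \<bar>x\<bar> \<le> real (n + 1) ^ k"

section \<open>Access to the input\<close>

text \<open>The lists enumerate, in an arbitrary order, the positions of the nonzero entries of the rows and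
  columns of \<open>M\<close> and of \<open>b\<close>; \<open>step_time u\<close> is the time to simulate one walk step from \<open>u\<close>.\<close>

record access =
  row_nz :: "nat \<Rightarrow> nat list"
  col_nz :: "nat \<Rightarrow> nat list"
  b_nz :: "nat list"
  step_time :: "nat \<Rightarrow> nat"

definition valid_access :: "real mat \<Rightarrow> real vec \<Rightarrow> access \<Rightarrow> bool" where
  "valid_access M b acc \<longleftrightarrow>
     (\<forall>i<dim_row M. distinct (row_nz acc i) \<and>
        set (row_nz acc i) = {j. j < dim_col M \<and> M $$ (i, j) \<noteq> 0}) \<and>
     (\<forall>j<dim_col M. distinct (col_nz acc j) \<and>
        set (col_nz acc j) = {i. i < dim_row M \<and> M $$ (i, j) \<noteq> 0}) \<and>
     distinct (b_nz acc) \<and> set (b_nz acc) = {i. i < dim_vec b \<and> vec_index b i \<noteq> 0} \<and>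
     (\<forall>u<dim_row M. step_time acc u \<ge> 1)"

definition f_row :: "real mat \<Rightarrow> access \<Rightarrow> nat" where
  "f_row M acc = Max (step_time acc ` {..<dim_row M})"

text \<open>One step of the walk with substochastic transition matrix
  \<open>(I + D\<^sub>M\<^sup>-\<^sup>1 |A\<^sub>M\<^sup>T|) / 2\<close>; \<open>None\<close> is termination.\<close>

definition walk_prob :: "real mat \<Rightarrow> nat \<Rightarrow> nat \<Rightarrow> real" where
  "walk_prob M u v = 1/2 * ((if u = v then 1 else 0) + \<bar>adj_T M $$ (u, v)\<bar> / M $$ (u, u))"

definition walk_pmf :: "real mat \<Rightarrow> nat \<Rightarrow> nat option pmf" where
  "walk_pmf M u = embed_pmf (\<lambda>w. case w of
       Some v \<Rightarrow> if v < dim_row M then walk_prob M u v else 0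
     | None \<Rightarrow> 1 - (\<Sum>v<dim_row M. walk_prob M u v))"

definition abs_pmf :: "real vec \<Rightarrow> nat pmf" where
  "abs_pmf t = embed_pmf (\<lambda>i. if i < dim_vec t then \<bar>vec_index t i\<bar> / lp_norm 1 t else 0)"

section \<open>Randomized real RAM\<close>

text \<open>A program is a piece of finite syntax that works on natural-number and real variables and arrays.
  Reals admit field operations, \<open>exp\<close>, \<open>ln\<close> and comparison. To keep unit cost from hiding large
  computations, naturals admit only addition and truncated subtraction, and reals cannot be rounded to
  naturals. Expressions occurring in a program have fixed size, hence evaluating one counts as constant
  time.\<close>

datatype nexp =
    NConst nat
  | NVar string
  | NArr string nexp
  | NPlus nexp nexp
  | NMinus nexp nexp

datatype rexp =
    OfNat nexp
  | RVar string
  | RArr string nexp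
  | RPlus rexp rexp
  | RMinus rexp rexp
  | RTimes rexp rexp
  | RDiv rexp rexp
  | RExp rexp
  | RLn rexp

datatype bexp =
    NLess nexp nexp
  | RLess rexp rexp
  | BNot bexp
  | BAnd bexp bexp

datatype com =
    NAssign string nexp
  | RAssign string rexp
  | NStore string nexp nexp
  | RStore string nexp rexp
  | Seq com com
  | Cond bexp com com
  | While bexp com
  | GetDiag string nexp
  | GetB string nexp
  | GetT string nexp
  | ScanRow string string string nexp
  | ScanCol string string string nexp
  | ScanB string string string
  | Uniform string nexp
  | SampleT string
  | WalkStep string string string nexp

record state =
  nv :: "string \<Rightarrow> nat"
  rv :: "string \<Rightarrow> real"
  na :: "string \<Rightarrow> nat \<Rightarrow> nat"
  ra :: "string \<Rightarrow> nat \<Rightarrow> real"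
  time :: nat

primrec nval :: "nexp \<Rightarrow> state \<Rightarrow> nat" where
  "nval (NConst k) s = k"
| "nval (NVar x) s = nv s x"
| "nval (NArr a e) s = na s a (nval e s)"
| "nval (NPlus e f) s = nval e s + nval f s"
| "nval (NMinus e f) s = nval e s - nval f s"

primrec rval :: "rexp \<Rightarrow> state \<Rightarrow> real" where
  "rval (OfNat e) s = real (nval e s)"
| "rval (RVar x) s = rv s x"
| "rval (RArr a e) s = ra s a (nval e s)"
| "rval (RPlus e f) s = rval e s + rval f s"
| "rval (RMinus e f) s = rval e s - rval f s"
| "rval (RTimes e f) s = rval e s * rval f s"
| "rval (RDiv e f) s = rval e s / rval f s"
| "rval (RExp e) s = exp (rval e s)"
| "rval (RLn e) s = ln (rval e s)"

primrec bval :: "bexp \<Rightarrow> state \<Rightarrow> bool" where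
  "bval (NLess e f) s \<longleftrightarrow> nval e s < nval f s"
| "bval (RLess e f) s \<longleftrightarrow> rval e s < rval f s"
| "bval (BNot c) s \<longleftrightarrow> \<not> bval c s"
| "bval (BAnd c d) s \<longleftrightarrow> bval c s \<and> bval d s"

definition set_n :: "string \<Rightarrow> nat \<Rightarrow> state \<Rightarrow> state" where
  "set_n x k s = s\<lparr>nv := (nv s)(x := k)\<rparr>"

definition set_r :: "string \<Rightarrow> real \<Rightarrow> state \<Rightarrow> state" where
  "set_r x r s = s\<lparr>rv := (rv s)(x := r)\<rparr>"

definition tick :: "nat \<Rightarrow> state \<Rightarrow> state" where
  "tick k s = s\<lparr>time := time s + k\<rparr>"

definition overwrite :: "'a list \<Rightarrow> (nat \<Rightarrow> 'a) \<Rightarrow> nat \<Rightarrow> 'a" where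
  "overwrite xs a = (\<lambda>j. if j < length xs then xs ! j else a j)"

text \<open>Copy a list of positions and the corresponding entries into the arrays \<open>ia\<close> and \<open>va\<close>, and its
  length into \<open>m\<close>, in time linear in the length.\<close>

definition load :: "string \<Rightarrow> string \<Rightarrow> string \<Rightarrow> nat list \<Rightarrow> (nat \<Rightarrow> real) \<Rightarrow> state \<Rightarrow> state" where
  "load ia va m xs g s = tick (1 + length xs) (set_n m (length xs)
     (s\<lparr>na := (na s)(ia := overwrite xs (na s ia)),
        ra := (ra s)(va := overwrite (map g xs) (ra s va))\<rparr>))"

text \<open>Queries outside the index range cost one unit and return 0, an empty list, or termination. A step of the walk from
  \<open>u\<close> sets the flag \<open>z\<close> to 0 if the walk terminates; otherwise it sets \<open>z\<close> to 1 and returns the new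
  position \<open>v\<close> in \<open>x\<close> and the traversed entry \<open>M(u, v)\<close> in \<open>y\<close>.

  The fuel \<open>d\<close> bounds the depth of loop unrolling; running out of it is the missing mass of the
  subprobability distribution. It plays no role in the cost, which is recorded in \<open>time\<close>.\<close>

fun exec :: "real mat \<Rightarrow> real vec \<Rightarrow> real vec \<Rightarrow> access \<Rightarrow> nat \<Rightarrow> com \<Rightarrow> state \<Rightarrow> state spmf" where
  "exec M b t acc d (NAssign x e) s = return_spmf (tick 1 (set_n x (nval e s) s))"
| "exec M b t acc d (RAssign x e) s = return_spmf (tick 1 (set_r x (rval e s) s))"
| "exec M b t acc d (NStore a e f) s =
     return_spmf (tick 1 (s\<lparr>na := (na s)(a := (na s a)(nval e s := nval f s))\<rparr>))"
| "exec M b t acc d (RStore a e f) s =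
     return_spmf (tick 1 (s\<lparr>ra := (ra s)(a := (ra s a)(nval e s := rval f s))\<rparr>))"
| "exec M b t acc d (Seq p q) s =
     bind_spmf (exec M b t acc d p s) (exec M b t acc d q)"
| "exec M b t acc d (Cond c p q) s =
     (if bval c s then exec M b t acc d p (tick 1 s) else exec M b t acc d q (tick 1 s))"
| "exec M b t acc 0 (While c p) s = return_pmf None"
| "exec M b t acc (Suc d) (While c p) s =
     (if bval c s
      then bind_spmf (exec M b t acc d p (tick 1 s)) (exec M b t acc d (While c p))
      else return_spmf (tick 1 s))"
| "exec M b t acc d (GetDiag x e) s =
     (let i = nval e s in
      return_spmf (tick 1 (set_r x (if i < dim_row M then M $$ (i, i) else 0) s)))"
| "exec M b t acc d (GetB x e) s =
     (let i = nval e s in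
      return_spmf (tick 1 (set_r x (if i < dim_vec b then vec_index b i else 0) s)))"
| "exec M b t acc d (GetT x e) s =
     (let i = nval e s in
      return_spmf (tick 1 (set_r x (if i < dim_vec t then vec_index t i else 0) s)))"
| "exec M b t acc d (ScanRow ia va m e) s =
     (let i = nval e s in
      return_spmf (load ia va m (if i < dim_row M then row_nz acc i else []) (\<lambda>j. M $$ (i, j)) s))"
| "exec M b t acc d (ScanCol ia va m e) s =
     (let j = nval e s in
      return_spmf (load ia va m (if j < dim_col M then col_nz acc j else []) (\<lambda>i. M $$ (i, j)) s))"
| "exec M b t acc d (ScanB ia va m) s =
     return_spmf (load ia va m (b_nz acc) (vec_index b) s)"
| "exec M b t acc d (Uniform x e) s =
     map_spmf (\<lambda>i. tick 1 (set_n x i s)) (spmf_of_pmf (pmf_of_set {..<max 1 (nval e s)}))"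
| "exec M b t acc d (SampleT x) s =
     map_spmf (\<lambda>i. tick 1 (set_n x i s)) (spmf_of_pmf (abs_pmf t))"
| "exec M b t acc d (WalkStep x y z e) s =
     (let u = nval e s in
      if u < dim_row M then
        map_spmf (\<lambda>w. tick (step_time acc u) (case w of
            None \<Rightarrow> set_n z 0 s
          | Some v \<Rightarrow> set_n z 1 (set_n x v (set_r y (M $$ (u, v)) s))))
          (spmf_of_pmf (walk_pmf M u))
      else return_spmf (tick 1 (set_n z 0 s)))"

text \<open>The numbers known to the algorithm are preloaded: \<open>n\<close>, \<open>\<epsilon>\<close>, \<open>\<gamma>\<close>, the \<open>l\<^sub>1\<close> norm of \<open>t\<close>,
  \<open>f_row\<close>, and an upper bound \<open>B\<close> on \<open>log_arg\<close>. All other memory is zero.\<close>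

definition init_state :: "real mat \<Rightarrow> real vec \<Rightarrow> access \<Rightarrow> real \<Rightarrow> real \<Rightarrow> real \<Rightarrow> state" where
  "init_state M t acc \<epsilon> \<gamma> B =
     \<lparr>nv = (\<lambda>_. 0)(''n'' := dim_row M),
      rv = (\<lambda>_. 0)(''eps'' := \<epsilon>, ''gamma'' := \<gamma>, ''t1'' := lp_norm 1 t,
                   ''frow'' := real (f_row M acc), ''B'' := B),
      na = (\<lambda>_ _. 0), ra = (\<lambda>_ _. 0), time = 0\<rparr>"

text \<open>\<open>T\<close> bounds the running time for every outcome of the random choices; the result is the final
  value of the variable \<open>out\<close>.\<close>

definition estimates_within ::
  "real mat \<Rightarrow> real vec \<Rightarrow> real vec \<Rightarrow> access \<Rightarrow> com \<Rightarrow> state \<Rightarrow> real \<Rightarrow> real \<Rightarrow> real \<Rightarrow> bool" where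
  "estimates_within M b t acc prog s0 \<epsilon> y T \<longleftrightarrow>
     (\<exists>d. lossless_spmf (exec M b t acc d prog s0) \<and>
          (\<forall>s\<in>set_spmf (exec M b t acc d prog s0). real (time s) \<le> T) \<and>
          measure (measure_spmf (exec M b t acc d prog s0)) {s. \<bar>rv s ''out'' - y\<bar> \<le> \<epsilon>} \<ge> 3/4)"

end

theory Submission
  imports Defs
begin

text \<open>With \<open>W = I - D\<^sup>-\<^sup>1 M / 2\<close>, \<open>h = D\<^sup>-\<^sup>1 b\<close> and \<open>\<Lambda>\<close> of order \<open>L\<close>, the contraction hypothesis
  reduces \<open>2 t\<^sup>T x\<^sup>*\<close> to the sum of \<open>t\<^sup>T W\<^sup>l h\<close> over \<open>l < \<Lambda>\<close>, up to error \<open>\<epsilon>\<close>. This sum is estimated from both ends.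

  From the side of \<open>b\<close>, residuals \<open>r\<^sub>j(v)\<close> at levels \<open>j \<le> \<Lambda>\<close>, initially \<open>r\<^sub>0 = h\<close>, are pushed: a residual of absolute
  value above a threshold \<open>\<rho>\<close> contributes \<open>t(v) r\<^sub>j(v)\<close> to the answer and is replaced by the column
  \<open>r\<^sub>j(v) W e\<^sub>v\<close> at level \<open>j + 1\<close>. By column dominance the potential \<open>\<Sum> (\<Lambda> - j) d(v) |r\<^sub>j(v)|\<close> drops by at least
  \<open>\<rho> d(v)\<close> with each push at \<open>v\<close>, and reading column \<open>v\<close> costs \<open>O(d(v))\<close>, so that pushing takes time
  \<open>O(\<Lambda> \<parallel>b\<parallel>\<^sub>1 / \<rho>)\<close> after the scan of \<open>b\<close>.

  From the side of \<open>t\<close>, the remaining sum of \<open>t\<^sup>T W\<^sup>i r\<^sub>j\<close> over \<open>i + j < \<Lambda>\<close> is estimated by signed random walks: for uniform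
  \<open>i, j < \<Lambda>\<close> and a walk of length \<open>i\<close> from \<open>|t| / \<parallel>t\<parallel>\<^sub>1\<close>, ending at \<open>u\<close>, the variable \<open>\<plusminus> \<parallel>t\<parallel>\<^sub>1 \<Lambda>\<^sup>2 r\<^sub>j(u)\<close>
  (0 if \<open>i + j \<ge> \<Lambda>\<close> or the walk has terminated) is unbiased with second moment at most
  \<open>\<parallel>t\<parallel>\<^sub>1\<^sup>2 \<Lambda>\<^sup>3 \<rho> min(\<beta>, \<rho> \<Lambda>)\<close>, \<open>\<beta> = \<parallel>h\<parallel>\<^sub>\<infinity>\<close>; the first bound uses that
  pushing does not increase the expected absolute residuals met by the walk. Equating the costs of both sides for the
  two bounds gives the two thresholds and the two terms of the minimum. If even a single walk is too expensive, a
  smaller threshold makes pushing alone sufficient; if \<open>\<epsilon>\<close> exceeds a trivial bound on the answer, the output is 0.\<close>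

section \<open>Expectation bounds for programs\<close>

locale ram =
  fixes M :: "real mat" and b t :: "real vec" and acc :: access
begin

text \<open>\<open>bounds c s K r\<close>: the program terminates, and its possible results \<open>s'\<close> can be labelled by reals \<open>r'\<close> of
  mean at most \<open>r\<close> such that \<open>K s' r'\<close>. Since the label \<open>r'\<close> may serve as the bound \<open>r\<close> for a subsequent program,
  this handles worst-case properties and upper bounds on expectations in one pass.\<close>

definition bounds :: "com \<Rightarrow> state \<Rightarrow> (state \<Rightarrow> real \<Rightarrow> bool) \<Rightarrow> real \<Rightarrow> bool" where
  "bounds c s K r \<longleftrightarrow> (\<exists>(D :: (state \<times> real) pmf) d0.
     (\<forall>d\<ge>d0. exec M b t acc d c s = spmf_of_pmf (map_pmf fst D)) \<and> finite (set_pmf D) \<and>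
     (\<forall>(s', r')\<in>set_pmf D. K s' r') \<and> measure_pmf.expectation D snd \<le> r)"

lemma bounds_return:
  assumes "\<And>d. exec M b t acc d c s = return_spmf s'" and "K s' r"
  shows "bounds c s K r"
  unfolding bounds_def using assms
  by (intro exI[of _ "return_pmf (s', r)"] exI[of _ 0]) simp

text \<open>The label \<open>g x\<close> is attached to the random choice \<open>x\<close>, not to
  the resulting state, so two choices that lead to the same state may carry different
  labels.\<close>

lemma bounds_sample:
  assumes "\<And>d. exec M b t acc d c s = map_spmf f (spmf_of_pmf p)"
    and "finite (set_pmf p)"
    and "\<And>x. x \<in> set_pmf p \<Longrightarrow> K (f x) (g x)"
    and "measure_pmf.expectation p g \<le> r"
  shows "bounds c s K r"
  unfolding bounds_def using assms
  by (intro exI[of _ "map_pmf (\<lambda>x. (f x, g x)) p"] exI[of _ 0])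
     (auto simp: pmf.map_comp o_def map_spmf_of_pmf)

text \<open>Each label of the first program is the budget of the second, and the tower rule bounds
  the mean of the final labels. The fuel offset \<open>k\<close> is 0 for sequencing and 1 for
  unrolling a loop.\<close>

lemma bounds_bind:
  assumes ex: "\<And>d. d \<ge> d0 \<Longrightarrow> exec M b t acc (d + k) c s
      = bind_spmf (exec M b t acc d p s1) (exec M b t acc d q)"
    and p: "bounds p s1 (\<lambda>s' r'. bounds q s' K r') r"
  shows "bounds c s K r"
proof -
  obtain D d1 where D: "\<And>d. d \<ge> d1 \<Longrightarrow> exec M b t acc d p s1 = spmf_of_pmf (map_pmf fst D)"
    "finite (set_pmf D)" "\<And>s' r'. (s', r') \<in> set_pmf D \<Longrightarrow> bounds q s' K r'"
    "measure_pmf.expectation D snd \<le> r"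
    using p unfolding bounds_def[of p] by blast
  have "\<forall>x. \<exists>Ed. x \<in> set_pmf D \<longrightarrow>
     (\<forall>d\<ge>snd Ed. exec M b t acc d q (fst x) = spmf_of_pmf (map_pmf fst (fst Ed)))
     \<and> finite (set_pmf (fst Ed)) \<and> (\<forall>(s', r')\<in>set_pmf (fst Ed). K s' r')
     \<and> measure_pmf.expectation (fst Ed) snd \<le> snd x"
  proof
    fix x
    show "\<exists>Ed. x \<in> set_pmf D \<longrightarrow>
     (\<forall>d\<ge>snd Ed. exec M b t acc d q (fst x) = spmf_of_pmf (map_pmf fst (fst Ed)))
     \<and> finite (set_pmf (fst Ed)) \<and> (\<forall>(s', r')\<in>set_pmf (fst Ed). K s' r')
     \<and> measure_pmf.expectation (fst Ed) snd \<le> snd x"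
    proof (cases "x \<in> set_pmf D")
      case True
      then have "bounds q (fst x) K (snd x)" using D(3)[of "fst x" "snd x"] by simp
      then obtain E d2 where "\<forall>d\<ge>d2. exec M b t acc d q (fst x) = spmf_of_pmf (map_pmf fst E)"
        "finite (set_pmf E)" "\<forall>(s', r')\<in>set_pmf E. K s' r'"
        "measure_pmf.expectation E snd \<le> snd x"
        unfolding bounds_def by blast
      then show ?thesis by (intro exI[of _ "(E, d2)"]) simp
    qed simp
  qed
  \<comment> \<open>Every labelled outcome receives its own continuation and its own sufficient
    fuel.\<close>
  then obtain Ed where Ed: "\<And>x. x \<in> set_pmf D \<Longrightarrow>
     (\<forall>d\<ge>snd (Ed x). exec M b t acc d q (fst x) = spmf_of_pmf (map_pmf fst (fst (Ed x))))
     \<and> finite (set_pmf (fst (Ed x))) \<and> (\<forall>(s', r')\<in>set_pmf (fst (Ed x)). K s' r')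
     \<and> measure_pmf.expectation (fst (Ed x)) snd \<le> snd x" by metis
  define E where "E x = fst (Ed x)" for x
  define d2 where "d2 x = snd (Ed x)" for x
  \<comment> \<open>Finite support yields one amount of fuel that suffices for all
    continuations.\<close>
  define dd where "dd = max d0 (max d1 (Max (insert 0 (d2 ` set_pmf D))))"
  have d2: "d2 x \<le> dd" if "x \<in> set_pmf D" for x
  proof -
    have "d2 x \<le> Max (insert 0 (d2 ` set_pmf D))" using that D(2) by (intro Max_ge) auto
    then show ?thesis by (simp add: dd_def)
  qed
  have "exec M b t acc d c s = spmf_of_pmf (map_pmf fst (bind_pmf D E))" if "d \<ge> dd + k" for d
  proof -
    have dk: "d - k \<ge> d0" "d - k \<ge> d1" "d - k + k = d" "d - k \<ge> dd" using that by (auto simp: dd_def)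
    have "exec M b t acc d c s = bind_spmf (exec M b t acc (d - k) p s1) (exec M b t acc (d - k) q)"
      using ex[OF dk(1)] dk(3) by simp
    also have "\<dots> = bind_spmf (spmf_of_pmf (map_pmf fst D)) (exec M b t acc (d - k) q)"
      using D(1)[OF dk(2)] by simp
    also have "\<dots> = bind_pmf D (\<lambda>x. exec M b t acc (d - k) q (fst x))"
      by (simp add: bind_spmf_of_pmf bind_map_pmf)
    also have "\<dots> = bind_pmf D (\<lambda>x. spmf_of_pmf (map_pmf fst (E x)))"
    proof (intro bind_pmf_cong refl)
      fix x assume x: "x \<in> set_pmf D"
      have "d2 x \<le> d - k" using d2[OF x] dk(4) by linarith
      then show "exec M b t acc (d - k) q (fst x) = spmf_of_pmf (map_pmf fst (E x))"
        using Ed[OF x] by (simp add: E_def d2_def)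
    qed
    also have "\<dots> = spmf_of_pmf (map_pmf fst (bind_pmf D E))"
      by (simp add: spmf_of_pmf_def map_bind_pmf)
    finally show ?thesis .
  qed
  moreover have "finite (set_pmf (bind_pmf D E))" using D(2) Ed by (auto simp: E_def)
  moreover have "\<forall>(s', r')\<in>set_pmf (bind_pmf D E). K s' r'" using Ed by (fastforce simp: E_def)
  moreover have "measure_pmf.expectation (bind_pmf D E) snd \<le> r"
  proof -
    have "measure_pmf.expectation (bind_pmf D E) snd
      = (\<Sum>x\<in>set_pmf D. pmf D x * measure_pmf.expectation (E x) snd)"
      using D(2) Ed by (subst pmf_expectation_bind[of "set_pmf D"]) (auto simp: E_def)
    also have "\<dots> \<le> (\<Sum>x\<in>set_pmf D. pmf D x * snd x)"
      using Ed by (intro sum_mono mult_left_mono) (auto simp: E_def)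
    also have "\<dots> = measure_pmf.expectation D snd"
      using D(2) by (subst integral_measure_pmf[of "set_pmf D"]) auto
    finally show ?thesis using D(4) by linarith
  qed
  ultimately show ?thesis unfolding bounds_def by blast
qed

lemma bounds_mono:
  assumes "bounds c s K r" and "\<And>s' r'. K s' r' \<Longrightarrow> K' s' r'" and "r \<le> r'"
  shows "bounds c s K' r'"
proof -
  obtain D d0 where "\<forall>d\<ge>d0. exec M b t acc d c s = spmf_of_pmf (map_pmf fst D)"
    "finite (set_pmf D)" "\<forall>(s', r')\<in>set_pmf D. K s' r'" "measure_pmf.expectation D snd \<le> r"
    using assms(1) unfolding bounds_def by blast
  then show ?thesis
    using assms(2,3) unfolding bounds_def by (intro exI[of _ D] exI[of _ d0]) auto
qed

section \<open>Rules for the single constructs of the language\<close>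

lemma bounds_Seq:
  assumes "bounds p s (\<lambda>s' r'. bounds q s' K r') r"
  shows "bounds (Seq p q) s K r"
proof (rule bounds_bind[of 0 0 _ _ p s q])
qed (use assms in simp_all)

lemma bounds_NAssign: "K (tick 1 (set_n x (nval e s) s)) r \<Longrightarrow> bounds (NAssign x e) s K r"
  by (rule bounds_return) auto

lemma bounds_RAssign: "K (tick 1 (set_r x (rval e s) s)) r \<Longrightarrow> bounds (RAssign x e) s K r"
  by (rule bounds_return) auto

lemma bounds_NStore:
  "K (tick 1 (s\<lparr>na := (na s)(a := (na s a)(nval e s := nval f s))\<rparr>)) r \<Longrightarrow>
    bounds (NStore a e f) s K r"
  by (rule bounds_return) auto

lemma bounds_RStore:
  "K (tick 1 (s\<lparr>ra := (ra s)(a := (ra s a)(nval e s := rval f s))\<rparr>)) r \<Longrightarrow>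
    bounds (RStore a e f) s K r"
  by (rule bounds_return) auto

lemma bounds_Cond:
  assumes "bval c s \<Longrightarrow> bounds p (tick 1 s) K r" and "\<not> bval c s \<Longrightarrow> bounds q (tick 1 s) K r"
  shows "bounds (Cond c p q) s K r"
proof -
  have "exec M b t acc d (Cond c p q) s
    = exec M b t acc d (if bval c s then p else q) (tick 1 s)" for d by simp
  then show ?thesis using assms unfolding bounds_def by (simp split: if_splits)
qed

lemma bounds_GetDiag:
  "K (tick 1 (set_r x (if nval e s < dim_row M then M $$ (nval e s, nval e s) else 0) s)) r \<Longrightarrow>
    bounds (GetDiag x e) s K r"
  by (rule bounds_return) (auto simp: Let_def)

lemma bounds_GetT:
  "K (tick 1 (set_r x (if nval e s < dim_vec t then vec_index t (nval e s) else 0) s)) r \<Longrightarrow>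
    bounds (GetT x e) s K r"
  by (rule bounds_return) (auto simp: Let_def)

lemma bounds_ScanCol:
  "K (load ia va m (if nval e s < dim_col M then col_nz acc (nval e s) else [])
        (\<lambda>i. M $$ (i, nval e s)) s) r \<Longrightarrow> bounds (ScanCol ia va m e) s K r"
  by (rule bounds_return) (auto simp: Let_def)

lemma bounds_ScanB:
  "K (load ia va m (b_nz acc) (vec_index b) s) r \<Longrightarrow> bounds (ScanB ia va m) s K r"
  by (rule bounds_return) auto

lemma bounds_Uniform:
  assumes "\<And>i. i < nval e s \<Longrightarrow> K (tick 1 (set_n x i s)) (g i)"
    and "nval e s > 0" and "(\<Sum>i<nval e s. g i) / real (nval e s) \<le> r"
  shows "bounds (Uniform x e) s K r"
proof (rule bounds_sample)
  show "exec M b t acc d (Uniform x e) s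
    = map_spmf (\<lambda>i. tick 1 (set_n x i s)) (spmf_of_pmf (pmf_of_set {..<nval e s}))" for d
    using assms(2) by (simp add: max_def)
qed (use assms in \<open>auto simp: integral_pmf_of_set lessThan_empty_iff\<close>)

lemma bounds_While_unfold:
  assumes "bval c s \<Longrightarrow> bounds p (tick 1 s) (\<lambda>s' r'. bounds (While c p) s' K r') r"
    and "\<not> bval c s \<Longrightarrow> K (tick 1 s) r"
  shows "bounds (While c p) s K r"
proof (cases "bval c s")
  case True
  show ?thesis
    by (rule bounds_bind[of 0 1 _ _ p "tick 1 s" "While c p"]) (use True assms(1) in simp_all)
next
  case False
  \<comment> \<open>Even leaving a loop takes one unit of fuel, since with fuel 0 all mass is
    lost.\<close>
  have "exec M b t acc d (While c p) s = spmf_of_pmf (map_pmf fst (return_pmf (tick 1 s, r)))"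
    if "d \<ge> 1" for d
    using that False by (cases d) auto
  then show ?thesis using assms(2)[OF False] unfolding bounds_def
    by (intro exI[of _ "return_pmf (tick 1 s, r)"] exI[of _ 1]) simp
qed

text \<open>The invariant involves the label too: the current label bounds the mean of the next one,
  so the labels form a supermartingale along the loop. The variant decreases on every outcome, hence
  finite fuel suffices.\<close>

lemma bounds_While:
  fixes V :: "state \<Rightarrow> nat"
  assumes "I s r"
    and body: "\<And>s r. I s r \<Longrightarrow> bval c s \<Longrightarrow>
      bounds p (tick 1 s) (\<lambda>s' r'. I s' r' \<and> V s' < V s) r"
    and "\<And>s r. I s r \<Longrightarrow> \<not> bval c s \<Longrightarrow> K (tick 1 s) r"
  shows "bounds (While c p) s K r"
  using assms(1)
proof (induction "V s" arbitrary: s r rule: less_induct)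
  case less
  show ?case
  proof (rule bounds_While_unfold)
    assume "bval c s"
    from body[OF less.prems this] show "bounds p (tick 1 s) (\<lambda>s' r'. bounds (While c p) s' K r') r"
      by (rule bounds_mono) (use less.hyps in auto)
  qed (use assms(3) less.prems in auto)
qed

text \<open>Markov's inequality: the label is nonnegative and at least 1 on every bad outcome, so
  its mean bounds the failure probability.\<close>

lemma estimates_within_if_bounds:
  assumes "bounds c s (\<lambda>s' r'. real (time s') \<le> T \<and> (\<bar>rv s' ''out'' - y\<bar> > \<epsilon> \<longrightarrow> 1 \<le> r') \<and> 0 \<le> r') (1/4)"
  shows "estimates_within M b t acc c s \<epsilon> y T"
proof -
  obtain D :: "(state \<times> real) pmf" and d0 where D: "\<And>d. d \<ge> d0 \<Longrightarrow> exec M b t acc d c s = spmf_of_pmf (map_pmf fst D)"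
    "finite (set_pmf D)" "\<And>s' r'. (s', r') \<in> set_pmf D \<Longrightarrow>
       real (time s') \<le> T \<and> (\<bar>rv s' ''out'' - y\<bar> > \<epsilon> \<longrightarrow> 1 \<le> r') \<and> 0 \<le> r'"
    "measure_pmf.expectation D snd \<le> 1/4"
    using assms unfolding bounds_def by blast
  let ?e = "exec M b t acc d0 c s" and ?A = "{s. \<bar>rv s ''out'' - y\<bar> \<le> \<epsilon>}"
  have e: "?e = spmf_of_pmf (map_pmf fst D)" using D(1) by blast
  have "measure (measure_pmf D) (fst -` (- ?A)) = measure_pmf.expectation D (indicator (fst -` (- ?A)))"
    by simp
  also have "\<dots> \<le> measure_pmf.expectation D snd"
    using D(2,3) by (intro integral_mono_AE integrable_measure_pmf_finite)
      (auto simp: AE_measure_pmf_iff indicator_def not_le)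
  finally have "measure (measure_pmf D) (fst -` (- ?A)) \<le> 1/4" using D(4) by linarith
  moreover have "measure (measure_pmf D) (fst -` (- ?A)) = 1 - measure (measure_pmf D) (fst -` ?A)"
    using measure_pmf.prob_compl[of "fst -` ?A" D] by (simp add: vimage_Diff Compl_eq_Diff_UNIV)
  ultimately have "measure (measure_spmf ?e) ?A \<ge> 3/4" by (simp add: e measure_map_pmf)
  moreover have "\<forall>s\<in>set_spmf ?e. real (time s) \<le> T" using D(3) by (auto simp: e)
  moreover have "lossless_spmf ?e" by (simp add: e)
  ultimately show ?thesis unfolding estimates_within_def by blast
qed

end

section \<open>Iterated matrix actions\<close>

text \<open>Functions stand for vectors with coordinates below \<open>n\<close>; \<open>mv\<close>
  acts on columns and \<open>vm\<close> on rows.\<close>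

definition mv :: "nat \<Rightarrow> (nat \<Rightarrow> nat \<Rightarrow> real) \<Rightarrow> (nat \<Rightarrow> real) \<Rightarrow> nat \<Rightarrow> real" where
  "mv n A g u = (\<Sum>v<n. A u v * g v)"

definition vm :: "nat \<Rightarrow> (nat \<Rightarrow> nat \<Rightarrow> real) \<Rightarrow> (nat \<Rightarrow> real) \<Rightarrow> nat \<Rightarrow> real" where
  "vm n A g v = (\<Sum>u<n. g u * A u v)"

lemma dual_mv_vm: "(\<Sum>u<n. x u * mv n A g u) = (\<Sum>v<n. vm n A x v * g v)"
proof -
  have "(\<Sum>u<n. x u * mv n A g u) = (\<Sum>u<n. \<Sum>v<n. x u * A u v * g v)"
    by (simp add: mv_def sum_distrib_left mult.assoc)
  also have "\<dots> = (\<Sum>v<n. \<Sum>u<n. x u * A u v * g v)" by (rule sum.swap)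
  finally show ?thesis by (simp add: vm_def sum_distrib_right)
qed

lemma dual_mv_vm_pow:
  "(\<Sum>u<n. x u * (mv n A ^^ k) g u) = (\<Sum>u<n. (vm n A ^^ k) x u * g u)"
proof (induction k arbitrary: g)
  case (Suc k)
  have "(mv n A ^^ Suc k) g = (mv n A ^^ k) (mv n A g)" by (simp add: funpow_swap1)
  then show ?case using Suc[of "mv n A g"] by (simp add: dual_mv_vm)
qed simp

text \<open>For a nonnegative start vector \<open>x\<close> and substochastic \<open>A\<close>, this
  is the expected number of visits to \<open>v\<close> among the first \<open>m\<close> positions of
  the walk.\<close>

definition vm_sum :: "nat \<Rightarrow> (nat \<Rightarrow> nat \<Rightarrow> real) \<Rightarrow> (nat \<Rightarrow> real) \<Rightarrow> nat \<Rightarrow> nat \<Rightarrow> real" where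
  "vm_sum n A x m v = (\<Sum>i<m. (vm n A ^^ i) x v)"

text \<open>Split off the start of the walk. In terms of pushes: the weight of \<open>v\<close>
  exceeds the next-level weight of its column by exactly \<open>x v\<close>.\<close>

lemma vm_sum_Suc: "vm_sum n A x (Suc m) v = x v + (\<Sum>u<n. vm_sum n A x m u * A u v)"
proof -
  have "vm_sum n A x (Suc m) v = x v + (\<Sum>i<m. (vm n A ^^ Suc i) x v)"
    unfolding vm_sum_def by (subst sum.lessThan_Suc_shift) simp
  also have "(\<Sum>i<m. (vm n A ^^ Suc i) x v) = (\<Sum>i<m. \<Sum>u<n. (vm n A ^^ i) x u * A u v)"
    by (simp add: vm_def[of n A "(vm n A ^^ _) x"])
  also have "\<dots> = (\<Sum>u<n. vm_sum n A x m u * A u v)"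
    by (subst sum.swap) (simp add: vm_sum_def sum_distrib_right)
  finally show ?thesis .
qed

lemma vm_pow_nonneg:
  assumes "\<And>u. u < n \<Longrightarrow> x u \<ge> 0" and "\<And>u v. u < n \<Longrightarrow> v < n \<Longrightarrow> A u v \<ge> 0" and "v < n"
  shows "(vm n A ^^ k) x v \<ge> 0"
  using assms(3)
proof (induction k arbitrary: v)
  case (Suc k)
  then show ?case using assms(2)
    by (auto simp: vm_def[of n A "(vm n A ^^ k) x"] intro!: sum_nonneg mult_nonneg_nonneg)
qed (use assms(1) in simp)

lemma sum_vm_pow_le:
  assumes "\<And>u. u < n \<Longrightarrow> x u \<ge> 0" and "\<And>u v. u < n \<Longrightarrow> v < n \<Longrightarrow> A u v \<ge> 0"
    and "\<And>u. u < n \<Longrightarrow> (\<Sum>v<n. A u v) \<le> 1"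
  shows "(\<Sum>v<n. (vm n A ^^ k) x v) \<le> (\<Sum>v<n. x v)"
proof (induction k)
  case (Suc k)
  have "(\<Sum>v<n. (vm n A ^^ Suc k) x v) = (\<Sum>u<n. (vm n A ^^ k) x u * (\<Sum>v<n. A u v))"
    by (simp add: vm_def[of n A "(vm n A ^^ _) x"] sum_distrib_left) (rule sum.swap)
  also have "\<dots> \<le> (\<Sum>u<n. (vm n A ^^ k) x u * 1)"
    using assms vm_pow_nonneg[of n x A] by (intro sum_mono mult_left_mono) auto
  finally show ?case using Suc by simp
qed simp

lemma sum_vm_sum_le:
  assumes "\<And>u. u < n \<Longrightarrow> x u \<ge> 0" and "\<And>u v. u < n \<Longrightarrow> v < n \<Longrightarrow> A u v \<ge> 0"
    and "\<And>u. u < n \<Longrightarrow> (\<Sum>v<n. A u v) \<le> 1"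
  shows "(\<Sum>v<n. vm_sum n A x m v) \<le> real m * (\<Sum>v<n. x v)"
proof -
  have "(\<Sum>v<n. vm_sum n A x m v) = (\<Sum>i<m. \<Sum>v<n. (vm n A ^^ i) x v)"
    unfolding vm_sum_def by (rule sum.swap)
  also have "\<dots> \<le> (\<Sum>i<m. \<Sum>v<n. x v)" using assms by (intro sum_mono sum_vm_pow_le)
  finally show ?thesis by simp
qed

section \<open>Potentials of residual families\<close>

text \<open>The weight \<open>w m v\<close> applies to the residual of \<open>v\<close> with \<open>m\<close> levels to go.\<close>

definition pot :: "nat \<Rightarrow> nat \<Rightarrow> (nat \<Rightarrow> nat \<Rightarrow> real) \<Rightarrow> (nat \<Rightarrow> nat \<Rightarrow> real) \<Rightarrow> real" where
  "pot n \<Lambda> w r = (\<Sum>j\<le>\<Lambda>. \<Sum>v<n. w (\<Lambda> - j) v * r j v)"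

lemma pot_mono:
  assumes "\<And>m v. v < n \<Longrightarrow> w m v \<ge> 0" and "\<And>j v. j \<le> \<Lambda> \<Longrightarrow> v < n \<Longrightarrow> r j v \<le> r' j v"
  shows "pot n \<Lambda> w r \<le> pot n \<Lambda> w r'"
  unfolding pot_def using assms by (intro sum_mono mult_left_mono) auto

lemma pot_cong:
  assumes "\<And>j v. j \<le> \<Lambda> \<Longrightarrow> v < n \<Longrightarrow> r j v = r' j v"
  shows "pot n \<Lambda> w r = pot n \<Lambda> w r'"
  unfolding pot_def using assms by (intro sum.cong) auto

lemma pot_nonneg:
  assumes "\<And>m v. v < n \<Longrightarrow> w m v \<ge> 0" and "\<And>j v. v < n \<Longrightarrow> 0 \<le> r j v"
  shows "0 \<le> pot n \<Lambda> w r"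
  unfolding pot_def using assms by (intro sum_nonneg) auto

lemma pot_level0:
  assumes "\<And>v. v < n \<Longrightarrow> r 0 v = h v" and "\<And>j v. v < n \<Longrightarrow> j > 0 \<Longrightarrow> r j v = 0"
  shows "pot n \<Lambda> w r = (\<Sum>v<n. w \<Lambda> v * h v)"
proof -
  have "pot n \<Lambda> w r = (\<Sum>j\<le>\<Lambda>. if j = 0 then \<Sum>v<n. w \<Lambda> v * h v else 0)"
    unfolding pot_def using assms by (intro sum.cong) auto
  then show ?thesis by simp
qed

text \<open>The amount \<open>x\<close> is a separate parameter, so that the same linear map can
  also be applied to families of absolute values.\<close>

definition push :: "(nat \<Rightarrow> nat \<Rightarrow> real) \<Rightarrow> nat \<Rightarrow> nat \<Rightarrow> real \<Rightarrow> (nat \<Rightarrow> nat \<Rightarrow> real) \<Rightarrow> nat \<Rightarrow> nat \<Rightarrow> real" where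
  "push A j v x r = (\<lambda>i u. r i u - (if i = j \<and> u = v then x else 0)
     + (if i = Suc j then x * A u v else 0))"

text \<open>The potential is linear in the residuals. Level \<Lambda> is included in the sum, so
  that the level receiving a push from \<open>j < \<Lambda>\<close> is always counted.\<close>

lemma pot_push:
  assumes "j < \<Lambda>" "v < n"
  shows "pot n \<Lambda> w (push A j v x r)
    = pot n \<Lambda> w r - x * (w (\<Lambda> - j) v - (\<Sum>u<n. w (\<Lambda> - Suc j) u * A u v))"
proof -
  have "pot n \<Lambda> w (push A j v x r) = (\<Sum>i\<le>\<Lambda>. (\<Sum>u<n. w (\<Lambda> - i) u * r i u)
     - (\<Sum>u<n. if i = j then (if u = v then w (\<Lambda> - i) u * x else 0) else 0)
     + (\<Sum>u<n. if i = Suc j then w (\<Lambda> - i) u * (x * A u v) else 0))"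
    unfolding pot_def push_def sum_subtractf[symmetric] sum.distrib[symmetric]
    by (intro sum.cong refl) (auto simp: algebra_simps)
  also have "\<dots> = pot n \<Lambda> w r
      - (\<Sum>i\<le>\<Lambda>. if i = j then (\<Sum>u<n. if u = v then w (\<Lambda> - i) u * x else 0) else 0)
      + (\<Sum>i\<le>\<Lambda>. if i = Suc j then (\<Sum>u<n. w (\<Lambda> - i) u * (x * A u v)) else 0)"
    unfolding sum.distrib sum_subtractf pot_def
    by (intro arg_cong2[where f = "(+)"] arg_cong2[where f = "(-)"] refl sum.cong) auto
  also have "(\<Sum>i\<le>\<Lambda>. if i = j then (\<Sum>u<n. if u = v then w (\<Lambda> - i) u * x else 0) else 0)
      = w (\<Lambda> - j) v * x"
    using assms by simp
  also have "(\<Sum>i\<le>\<Lambda>. if i = Suc j then (\<Sum>u<n. w (\<Lambda> - i) u * (x * A u v)) else 0)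
      = x * (\<Sum>u<n. w (\<Lambda> - Suc j) u * A u v)"
    using assms by (simp add: sum_distrib_left mult_ac)
  finally show ?thesis by (simp add: algebra_simps)
qed

text \<open>By the triangle inequality the new absolute values are at most those obtained by pushing
  along \<open>\<bar>A\<bar>\<close>. This uses that the whole residual is pushed: the entry at
  \<open>(j, v)\<close> becomes 0 in both families. \<open>y\<close> is the guaranteed drop per unit
  of residual.\<close>

lemma pot_push_abs:
  assumes "j < \<Lambda>" "v < n" and w: "\<And>m u. u < n \<Longrightarrow> w m u \<ge> 0"
    and s: "\<And>m. w (Suc m) v \<ge> y + (\<Sum>u<n. w m u * \<bar>A u v\<bar>)"
  shows "pot n \<Lambda> w (\<lambda>i u. \<bar>push A j v (r j v) r i u\<bar>) + \<bar>r j v\<bar> * y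
    \<le> pot n \<Lambda> w (\<lambda>i u. \<bar>r i u\<bar>)"
proof -
  let ?x = "r j v"
  have "pot n \<Lambda> w (\<lambda>i u. \<bar>push A j v ?x r i u\<bar>)
     \<le> pot n \<Lambda> w (push (\<lambda>u v. \<bar>A u v\<bar>) j v \<bar>?x\<bar> (\<lambda>i u. \<bar>r i u\<bar>))"
  proof (rule pot_mono[OF w])
    fix i u
    have "\<bar>r i u + r j v * A u v\<bar> \<le> \<bar>r i u\<bar> + \<bar>r j v\<bar> * \<bar>A u v\<bar>"
      by (rule order_trans[OF abs_triangle_ineq]) (simp add: abs_mult)
    then show "\<bar>push A j v ?x r i u\<bar>
        \<le> push (\<lambda>u v. \<bar>A u v\<bar>) j v \<bar>?x\<bar> (\<lambda>i u. \<bar>r i u\<bar>) i u"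
      by (auto simp: push_def)
  qed
  also have "\<dots> = pot n \<Lambda> w (\<lambda>i u. \<bar>r i u\<bar>)
     - \<bar>?x\<bar> * (w (\<Lambda> - j) v - (\<Sum>u<n. w (\<Lambda> - Suc j) u * \<bar>A u v\<bar>))"
    using assms(1,2) by (rule pot_push)
  also have "\<dots> \<le> pot n \<Lambda> w (\<lambda>i u. \<bar>r i u\<bar>) - \<bar>?x\<bar> * y"
    using s[of "\<Lambda> - Suc j"] assms(1) by (intro diff_left_mono mult_left_mono) (auto simp: Suc_diff_Suc)
  finally show ?thesis by simp
qed

text \<open>Duality moves the powers from \<open>x\<close> to the residuals. The sum over a full
  square of pairs, cut off by a condition, is what uniform sampling of \<open>i\<close> and
  \<open>j\<close> averages.\<close>

lemma pot_vm_sum: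
  "pot n \<Lambda> (vm_sum n A x) r = (\<Sum>i<\<Lambda>. \<Sum>j<\<Lambda>. if i + j < \<Lambda> then \<Sum>u<n. x u * (mv n A ^^ i) (r j) u else 0)"
proof -
  \<comment> \<open>Level \<Lambda> drops out because its weight is an empty sum.\<close>
  have "pot n \<Lambda> (vm_sum n A x) r = (\<Sum>j<\<Lambda>. \<Sum>v<n. vm_sum n A x (\<Lambda> - j) v * r j v)"
    by (simp add: pot_def lessThan_Suc_atMost[symmetric] vm_sum_def)
  also have "\<dots> = (\<Sum>j<\<Lambda>. \<Sum>i<\<Lambda> - j. \<Sum>u<n. x u * (mv n A ^^ i) (r j) u)"
  proof (rule sum.cong[OF refl])
    fix j
    show "(\<Sum>v<n. vm_sum n A x (\<Lambda> - j) v * r j v) = (\<Sum>i<\<Lambda> - j. \<Sum>u<n. x u * (mv n A ^^ i) (r j) u)"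
      unfolding dual_mv_vm_pow vm_sum_def sum_distrib_right by (rule sum.swap)
  qed
  also have "\<dots> = (\<Sum>j<\<Lambda>. \<Sum>i<\<Lambda>. if i + j < \<Lambda> then \<Sum>u<n. x u * (mv n A ^^ i) (r j) u else 0)"
  proof (rule sum.cong[OF refl])
    fix j
    show "(\<Sum>i<\<Lambda> - j. \<Sum>u<n. x u * (mv n A ^^ i) (r j) u)
      = (\<Sum>i<\<Lambda>. if i + j < \<Lambda> then \<Sum>u<n. x u * (mv n A ^^ i) (r j) u else 0)"
      by (intro sum.mono_neutral_cong_left) auto
  qed
  also have "\<dots> = (\<Sum>i<\<Lambda>. \<Sum>j<\<Lambda>. if i + j < \<Lambda> then \<Sum>u<n. x u * (mv n A ^^ i) (r j) u else 0)"
    by (rule sum.swap)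
  finally show ?thesis .
qed

section \<open>The matrix and its lazy walk\<close>

locale rcdd_system = ram M b t acc for M :: "real mat" and b t :: "real vec" and acc :: access +
  fixes n :: nat
  assumes M: "M \<in> carrier_mat n n" and b: "b \<in> carrier_vec n" and t: "t \<in> carrier_vec n"
    and b_range: "b \<in> mat_range M" and b_nz: "b \<noteq> 0\<^sub>v n" and t_nz: "t \<noteq> 0\<^sub>v n"
    and rcdd: "rcdd M" and acc: "valid_access M b acc"
begin

abbreviation d :: "nat \<Rightarrow> real" where "d i \<equiv> M $$ (i, i)"

definition W :: "nat \<Rightarrow> nat \<Rightarrow> real" where
  "W i j = (if i = j then 1 else 0) - M $$ (i, j) / (2 * d i)"

abbreviation P :: "nat \<Rightarrow> nat \<Rightarrow> real" where "P i j \<equiv> \<bar>W i j\<bar>"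

definition h :: "nat \<Rightarrow> real" where "h i = vec_index b i / d i"

definition t1 :: real where "t1 = (\<Sum>i<n. \<bar>vec_index t i\<bar>)"
definition b1 :: real where "b1 = (\<Sum>i<n. \<bar>vec_index b i\<bar>)"

lemma dims [simp]: "dim_row M = n" "dim_col M = n" "dim_vec b = n" "dim_vec t = n"
  using M b t by auto

lemma d_pos: "i < n \<Longrightarrow> d i > 0"
  using rcdd by (auto simp: rcdd_def rdd_def)

lemma adj_T_index: "i < n \<Longrightarrow> j < n \<Longrightarrow> adj_T M $$ (i, j) = (if i = j then 0 else - M $$ (i, j))"
  using M by (auto simp: adj_T_def diag_part_def)

lemma P_eq: "i < n \<Longrightarrow> j < n \<Longrightarrow>
    P i j = (if i = j then 1/2 else \<bar>M $$ (i, j)\<bar> / (2 * d i))"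
  using d_pos[of i] by (auto simp: W_def abs_mult)

text \<open>The diagonal of \<open>W\<close> is 1/2, so the walk moves according to the absolute
  values of \<open>W\<close>, and only signs off the diagonal are lost.\<close>

lemma walk_prob_eq: "i < n \<Longrightarrow> j < n \<Longrightarrow> walk_prob M i j = P i j"
  using d_pos[of i] by (auto simp: P_eq walk_prob_def adj_T_index)

lemma P_row: assumes "i < n" shows "(\<Sum>j<n. P i j) \<le> 1"
proof -
  have "(\<Sum>j<n. P i j) = P i i + (\<Sum>j\<in>{..<n} - {i}. P i j)"
    using assms by (intro sum.remove) auto
  also have "(\<Sum>j\<in>{..<n} - {i}. P i j) = (\<Sum>j\<in>{..<n} - {i}. \<bar>M $$ (i, j)\<bar>) / (2 * d i)"
    unfolding sum_divide_distrib using assms by (intro sum.cong) (auto simp: P_eq)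
  also have "\<dots> \<le> d i / (2 * d i)"
    using rcdd assms d_pos[OF assms]
    by (intro divide_right_mono) (auto simp: rcdd_def rdd_def less_imp_le)
  finally show ?thesis using d_pos[OF assms] assms by (simp add: P_eq)
qed

lemma offdiag_col:
  assumes "j < n" shows "(\<Sum>i\<in>{..<n} - {j}. \<bar>M $$ (i, j)\<bar>) \<le> d j"
proof -
  have "(\<Sum>i\<in>{..<n} - {j}. \<bar>transpose_mat M $$ (j, i)\<bar>) \<le> transpose_mat M $$ (j, j)"
    using rcdd assms by (auto simp: rcdd_def rdd_def)
  moreover have "(\<Sum>i\<in>{..<n} - {j}. \<bar>transpose_mat M $$ (j, i)\<bar>) = (\<Sum>i\<in>{..<n} - {j}. \<bar>M $$ (i, j)\<bar>)"
    using assms by (intro sum.cong) auto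
  ultimately show ?thesis using assms by simp
qed

text \<open>Column dominance in the form needed for pushes: moving a residual along its column does
  not increase its total absolute value weighted by \<open>d\<close>.\<close>

lemma P_col: assumes "j < n" shows "(\<Sum>i<n. d i * P i j) \<le> d j"
proof -
  have "(\<Sum>i<n. d i * P i j) = d j * P j j + (\<Sum>i\<in>{..<n} - {j}. d i * P i j)"
    using assms by (intro sum.remove) auto
  also have "(\<Sum>i\<in>{..<n} - {j}. d i * P i j) = (\<Sum>i\<in>{..<n} - {j}. \<bar>M $$ (i, j)\<bar>) / 2"
    unfolding sum_divide_distrib using assms d_pos[THEN less_imp_neq] by (intro sum.cong) (auto simp: P_eq)
  finally show ?thesis using offdiag_col[OF assms] assms by (simp add: P_eq)
qed

lemma t1_pos: "t1 > 0"
proof -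
  obtain i where "i < n" "vec_index t i \<noteq> 0" using t t_nz by (metis carrier_vecD eq_vecI index_zero_vec)
  then show ?thesis unfolding t1_def by (intro sum_pos2[of _ i]) auto
qed

lemma b1_pos: "b1 > 0"
proof -
  obtain i where "i < n" "vec_index b i \<noteq> 0" using b b_nz by (metis carrier_vecD eq_vecI index_zero_vec)
  then show ?thesis unfolding b1_def by (intro sum_pos2[of _ i]) auto
qed

lemma lp_norm_1: "lp_norm 1 x = (\<Sum>i<dim_vec x. \<bar>vec_index x i\<bar>)"
  by (simp add: lp_norm_def sum_nonneg)

text \<open>The absolute column sum is at most twice the diagonal entry, and every nonzero entry
  contributes at least \<open>c\<close>. This lets the \<open>d\<close>-weighted potential pay for
  reading a column.\<close>

lemma col_nz_length:
  assumes "c > 0" and "\<And>i j. i < n \<Longrightarrow> j < n \<Longrightarrow> M $$ (i, j) \<noteq> 0 \<Longrightarrow> \<bar>M $$ (i, j)\<bar> \<ge> c" and "j < n"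
  shows "c * real (length (col_nz acc j)) \<le> 2 * d j"
proof -
  let ?S = "{i. i < n \<and> M $$ (i, j) \<noteq> 0}"
  have S: "length (col_nz acc j) = card ?S"
    using acc assms(3) by (auto simp: valid_access_def distinct_card[symmetric])
  have "c * real (card ?S) = (\<Sum>i\<in>?S. c)" by simp
  also have "\<dots> \<le> (\<Sum>i\<in>?S. \<bar>M $$ (i, j)\<bar>)" using assms by (intro sum_mono) auto
  also have "\<dots> \<le> (\<Sum>i<n. \<bar>M $$ (i, j)\<bar>)" by (intro sum_mono2) auto
  also have "\<dots> = \<bar>d j\<bar> + (\<Sum>i\<in>{..<n} - {j}. \<bar>M $$ (i, j)\<bar>)"
    using assms by (intro sum.remove) auto
  also have "\<dots> \<le> 2 * d j" using offdiag_col[OF assms(3)] d_pos[OF assms(3)] by simp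
  finally show ?thesis using S by simp
qed

end

section \<open>Truncation of the series\<close>

lemma mv_pow_cong:
  assumes "\<And>v. v < n \<Longrightarrow> g v = g' v" and "u < n"
  shows "(mv n A ^^ k) g u = (mv n A ^^ k) g' u"
  using assms(2)
proof (induction k arbitrary: u)
  case (Suc k)
  have "mv n A ((mv n A ^^ k) g) u = mv n A ((mv n A ^^ k) g') u"
    unfolding mv_def[of n A "(mv n A ^^ k) g"] mv_def[of n A "(mv n A ^^ k) g'"]
    using Suc.IH by (intro sum.cong) auto
  then show ?case by simp
qed (use assms(1) in simp)

section \<open>Norms and restricted operator norms\<close>

lemma lp_norm_smult:
  assumes "1 \<le> p"
  shows "lp_norm p (c \<cdot>\<^sub>v v) = \<bar>c\<bar> * lp_norm p v"
proof (cases p)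
  case (real x)
  then have x: "x \<ge> 1" using assms by (simp add: one_ereal_def)
  have "(\<Sum>i<dim_vec v. \<bar>c * vec_index v i\<bar> powr x) = \<bar>c\<bar> powr x * (\<Sum>i<dim_vec v. \<bar>vec_index v i\<bar> powr x)"
    by (simp add: abs_mult powr_mult sum_distrib_left)
  then show ?thesis using real x by (simp add: lp_norm_def powr_mult sum_nonneg powr_powr)
next
  case PInf
  have "Max (insert 0 ((\<lambda>i. \<bar>c\<bar> * \<bar>vec_index v i\<bar>) ` {..<dim_vec v}))
      = Max ((\<lambda>y. \<bar>c\<bar> * y) ` insert 0 ((\<lambda>i. \<bar>vec_index v i\<bar>) ` {..<dim_vec v}))"
    by (simp add: image_image)
  also have "\<dots> = \<bar>c\<bar> * Max (insert 0 ((\<lambda>i. \<bar>vec_index v i\<bar>) ` {..<dim_vec v}))"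
    by (intro mono_Max_commute[symmetric]) (auto simp: mono_def mult_left_mono)
  also have "(\<lambda>i. \<bar>c\<bar> * \<bar>vec_index v i\<bar>) ` {..<dim_vec v} = (\<lambda>i. \<bar>vec_index (c \<cdot>\<^sub>v v) i\<bar>) ` {..<dim_vec v}"
    by (intro image_cong) (auto simp: abs_mult)
  finally show ?thesis using PInf by (simp add: lp_norm_def)
qed (use assms in auto)

lemma abs_index_le_lp_norm:
  assumes "1 \<le> p" and "i < dim_vec v"
  shows "\<bar>vec_index v i\<bar> \<le> lp_norm p v"
proof (cases p)
  case (real x)
  then have x: "x \<ge> 1" using assms by (simp add: one_ereal_def)
  have "\<bar>vec_index v i\<bar> powr x \<le> (\<Sum>i<dim_vec v. \<bar>vec_index v i\<bar> powr x)"
    using assms(2) by (intro member_le_sum) auto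
  then have "(\<bar>vec_index v i\<bar> powr x) powr (1 / x) \<le> (\<Sum>i<dim_vec v. \<bar>vec_index v i\<bar> powr x) powr (1 / x)"
    using x by (intro powr_mono2) auto
  then show ?thesis using real x by (simp add: lp_norm_def powr_powr)
next
  case PInf
  have "\<bar>vec_index v i\<bar> \<le> Max (insert 0 ((\<lambda>i. \<bar>vec_index v i\<bar>) ` {..<dim_vec v}))"
    using assms by (intro Max_ge) auto
  then show ?thesis using PInf by (simp add: lp_norm_def)
qed (use assms in auto)

text \<open>For finite exponent \<open>x\<close>, each \<open>x\<close>-th power is at most the
  entry times the \<open>(x - 1)\<close>-th power of the \<open>1\<close>-norm.\<close>

lemma lp_norm_le_sum:
  assumes "1 \<le> p"
  shows "lp_norm p v \<le> (\<Sum>i<dim_vec v. \<bar>vec_index v i\<bar>)"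
proof (cases p)
  case (real x)
  then have x: "x \<ge> 1" using assms by (simp add: one_ereal_def)
  let ?s = "\<Sum>i<dim_vec v. \<bar>vec_index v i\<bar>"
  have "(\<Sum>i<dim_vec v. \<bar>vec_index v i\<bar> powr x) \<le> (\<Sum>i<dim_vec v. \<bar>vec_index v i\<bar> * ?s powr (x - 1))"
  proof (rule sum_mono)
    fix i assume i: "i \<in> {..<dim_vec v}"
    have "\<bar>vec_index v i\<bar> \<le> ?s" using i by (intro member_le_sum) auto
    then have "\<bar>vec_index v i\<bar> powr (x - 1) \<le> ?s powr (x - 1)" using x by (intro powr_mono2) auto
    then have "\<bar>vec_index v i\<bar> * \<bar>vec_index v i\<bar> powr (x - 1) \<le> \<bar>vec_index v i\<bar> * ?s powr (x - 1)"
      by (intro mult_left_mono) auto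
    moreover have "\<bar>vec_index v i\<bar> * \<bar>vec_index v i\<bar> powr (x - 1) = \<bar>vec_index v i\<bar> powr x"
      by (simp add: powr_mult_base)
    ultimately show "\<bar>vec_index v i\<bar> powr x \<le> \<bar>vec_index v i\<bar> * ?s powr (x - 1)" by simp
  qed
  also have "\<dots> = ?s * ?s powr (x - 1)" by (simp add: sum_distrib_right)
  also have "\<dots> = ?s powr x" by (subst powr_mult_base) (auto simp: sum_nonneg)
  finally have "(\<Sum>i<dim_vec v. \<bar>vec_index v i\<bar> powr x) powr (1 / x) \<le> (?s powr x) powr (1 / x)"
    using x by (intro powr_mono2) (auto simp: sum_nonneg)
  then show ?thesis using real x by (simp add: lp_norm_def powr_powr sum_nonneg)
next
  case PInf
  have "Max (insert 0 ((\<lambda>i. \<bar>vec_index v i\<bar>) ` {..<dim_vec v})) \<le> (\<Sum>i<dim_vec v. \<bar>vec_index v i\<bar>)"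
    by (subst Max_le_iff) (auto simp: sum_nonneg intro: member_le_sum)
  then show ?thesis using PInf by (simp add: lp_norm_def)
qed (use assms in auto)

lemma lp_norm_nonneg: "0 \<le> lp_norm p v"
  by (auto simp: lp_norm_def)

text \<open>The supremum says something only for a nonempty bounded set. It is bounded because
  vectors in the unit ball have entries of absolute value at most 1; closure of \<open>S\<close>
  under scaling extends the estimate from the unit ball to all of \<open>S\<close>.\<close>

lemma restricted_opnorm:
  assumes p: "1 \<le> p" and K: "K \<in> carrier_mat n n" and S: "S \<subseteq> carrier_vec n"
    and cone: "\<And>c v. v \<in> S \<Longrightarrow> c \<cdot>\<^sub>v v \<in> S" and "S \<noteq> {}"
  shows "0 \<le> restricted_opnorm p K S"
    and "v \<in> S \<Longrightarrow> lp_norm p (K *\<^sub>v v) \<le> restricted_opnorm p K S * lp_norm p v"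
proof -
  let ?X = "{lp_norm p (K *\<^sub>v v) | v. v \<in> S \<and> lp_norm p v \<le> 1}"
  have bdd: "bdd_above ?X"
  proof (rule bdd_aboveI)
    fix y assume "y \<in> ?X"
    then obtain v where v: "y = lp_norm p (K *\<^sub>v v)" "v \<in> S" "lp_norm p v \<le> 1" by auto
    have vn: "v \<in> carrier_vec n" using v S by auto
    have vi: "\<bar>vec_index v j\<bar> \<le> 1" if "j < n" for j
      using abs_index_le_lp_norm[OF p, of j v] v vn that by auto
    have "y \<le> (\<Sum>i<n. \<bar>vec_index (K *\<^sub>v v) i\<bar>)"
      unfolding v using lp_norm_le_sum[OF p, of "K *\<^sub>v v"] K by auto
    also have "\<dots> \<le> (\<Sum>i<n. \<Sum>j<n. \<bar>K $$ (i, j)\<bar>)"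
    proof (rule sum_mono)
      fix i assume i: "i \<in> {..<n}"
      have "vec_index (K *\<^sub>v v) i = (\<Sum>j<n. K $$ (i, j) * vec_index v j)"
        using i K vn by (auto simp: scalar_prod_def atLeast0LessThan)
      also have "\<bar>\<dots>\<bar> \<le> (\<Sum>j<n. \<bar>K $$ (i, j) * vec_index v j\<bar>)" by (rule sum_abs)
      also have "\<dots> \<le> (\<Sum>j<n. \<bar>K $$ (i, j)\<bar>)"
        using vi by (intro sum_mono) (auto simp: abs_mult mult_left_le)
      finally show "\<bar>vec_index (K *\<^sub>v v) i\<bar> \<le> (\<Sum>j<n. \<bar>K $$ (i, j)\<bar>)" .
    qed
    finally show "y \<le> (\<Sum>i<n. \<Sum>j<n. \<bar>K $$ (i, j)\<bar>)" .
  qed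
  have ub: "lp_norm p (K *\<^sub>v v) \<le> restricted_opnorm p K S" if "v \<in> S" "lp_norm p v \<le> 1" for v
    unfolding restricted_opnorm_def using that by (intro cSup_upper[OF _ bdd]) auto
  obtain v0 where v0: "v0 \<in> S" using \<open>S \<noteq> {}\<close> by auto
  \<comment> \<open>The zero vector, a multiple of any member of \<open>S\<close>, shows that the
    supremum is nonnegative.\<close>
  have "lp_norm p (0 \<cdot>\<^sub>v v0) = 0" using lp_norm_smult[OF p, of 0 v0] by simp
  then have "lp_norm p (K *\<^sub>v (0 \<cdot>\<^sub>v v0)) \<le> restricted_opnorm p K S" by (intro ub cone v0) simp
  then show "0 \<le> restricted_opnorm p K S"
    using lp_norm_nonneg[of p "K *\<^sub>v (0 \<cdot>\<^sub>v v0)"] by linarith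
  show "lp_norm p (K *\<^sub>v v) \<le> restricted_opnorm p K S * lp_norm p v" if v: "v \<in> S"
  proof (cases "lp_norm p v = 0")
    case True
    have vn: "v \<in> carrier_vec n" using v S by auto
    \<comment> \<open>A vector of norm 0 cannot be normalised, but it vanishes.\<close>
    have "v = 0\<^sub>v n"
    proof (rule eq_vecI)
      fix i assume "i < dim_vec (0\<^sub>v n :: real vec)"
      then show "vec_index v i = vec_index (0\<^sub>v n) i"
        using True abs_index_le_lp_norm[OF p, of i v] vn by simp
    qed (use vn in simp)
    then have "K *\<^sub>v v = 0\<^sub>v n" using K by auto
    then have "K *\<^sub>v v = 0 \<cdot>\<^sub>v (K *\<^sub>v v)" using K by (intro eq_vecI) auto
    then have "lp_norm p (K *\<^sub>v v) = 0" using lp_norm_smult[OF p, of 0 "K *\<^sub>v v"] by simp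
    then show ?thesis using True by simp
  next
    case False
    define m where "m = lp_norm p v"
    have m: "m > 0" using False lp_norm_nonneg[of p v] by (simp add: m_def)
    have "lp_norm p ((1 / m) \<cdot>\<^sub>v v) = 1" using m lp_norm_smult[OF p, of "1 / m" v] by (simp add: m_def)
    then have "lp_norm p (K *\<^sub>v ((1 / m) \<cdot>\<^sub>v v)) \<le> restricted_opnorm p K S"
      by (intro ub cone v) simp
    moreover have "K *\<^sub>v ((1 / m) \<cdot>\<^sub>v v) = (1 / m) \<cdot>\<^sub>v (K *\<^sub>v v)"
      using K v S by (intro mult_mat_vec) auto
    ultimately have "1 / m * lp_norm p (K *\<^sub>v v) \<le> restricted_opnorm p K S"
      using m lp_norm_smult[OF p, of "1 / m" "K *\<^sub>v v"] by simp
    then show ?thesis using m unfolding m_def[symmetric] by (simp add: field_simps)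
  qed
qed

text \<open>Both exponents enter the scaling only through their reciprocals, which are real even for
  infinite \<open>p\<close> or \<open>q\<close>; the single real \<open>a\<close> replaces the
  pair.\<close>

lemma conjugate_exponents:
  fixes p q :: ereal
  assumes "1 \<le> p" "1 \<le> q" "1 / p + 1 / q = 1"
  obtains a where "0 \<le> a" "a \<le> 1" "real_of_ereal (1 / p) = a" "real_of_ereal (1 / q) = 1 - a"
proof -
  have fin: "\<exists>x. 1 / r = ereal x \<and> 0 \<le> x" if "1 \<le> r" for r :: ereal
    using that by (cases r) (auto simp: one_ereal_def divide_ereal_def intro!: exI[of _ 0])
  obtain x y where xy: "1 / p = ereal x" "0 \<le> x" "1 / q = ereal y" "0 \<le> y"
    using fin[OF assms(1)] fin[OF assms(2)] by auto
  then have "x + y = 1" using assms(3) by (simp add: one_ereal_def)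
  then show ?thesis using xy by (intro that[of x]) auto
qed

context rcdd_system
begin

section \<open>Coordinates of the matrices and of the solution\<close>

lemma diag_powr_carrier [simp]: "diag_powr M a \<in> carrier_mat n n"
  by (simp add: diag_powr_def)

lemma adj_T_carrier [simp]: "adj_T M \<in> carrier_mat n n"
  using M by (auto simp: adj_T_def diag_part_def)

lemma mat_dims [simp]:
  "dim_row (diag_powr M a) = n" "dim_col (diag_powr M a) = n"
  "dim_row (adj_T M) = n" "dim_col (adj_T M) = n"
  using diag_powr_carrier adj_T_carrier by blast+

lemma diag_powr_mult:
  assumes "A \<in> carrier_mat n n" "i < n" "j < n"
  shows "(diag_powr M a * A) $$ (i, j) = d i powr a * A $$ (i, j)"
proof -
  have "(diag_powr M a * A) $$ (i, j) = (\<Sum>k<n. (if i = k then d i powr a else 0) * A $$ (k, j))"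
    using assms by (auto simp: scalar_prod_def diag_powr_def atLeast0LessThan intro!: sum.cong)
  also have "\<dots> = (\<Sum>k<n. if k = i then d i powr a * A $$ (i, j) else 0)"
    by (intro sum.cong) auto
  finally show ?thesis using assms by simp
qed

lemma mult_diag_powr:
  assumes "A \<in> carrier_mat n n" "i < n" "j < n"
  shows "(A * diag_powr M a) $$ (i, j) = A $$ (i, j) * d j powr a"
proof -
  have "(A * diag_powr M a) $$ (i, j) = (\<Sum>k<n. A $$ (i, k) * (if k = j then d j powr a else 0))"
    using assms by (auto simp: scalar_prod_def diag_powr_def atLeast0LessThan intro!: sum.cong)
  also have "\<dots> = (\<Sum>k<n. if k = j then A $$ (i, j) * d j powr a else 0)"
    by (intro sum.cong) auto
  finally show ?thesis using assms by simp
qed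

lemma diag_powr_mult_vec:
  assumes "x \<in> carrier_vec n" "i < n"
  shows "vec_index (diag_powr M a *\<^sub>v x) i = d i powr a * vec_index x i"
proof -
  have "vec_index (diag_powr M a *\<^sub>v x) i = (\<Sum>k<n. (if i = k then d i powr a else 0) * vec_index x k)"
    using assms by (auto simp: scalar_prod_def diag_powr_def atLeast0LessThan intro!: sum.cong)
  also have "\<dots> = (\<Sum>k<n. if k = i then d i powr a * vec_index x i else 0)"
    by (intro sum.cong) auto
  finally show ?thesis using assms by simp
qed

lemma mult_mat_vec_index:
  assumes "A \<in> carrier_mat n n" "x \<in> carrier_vec n" "i < n"
  shows "vec_index (A *\<^sub>v x) i = (\<Sum>j<n. A $$ (i, j) * vec_index x j)"
  using assms by (auto simp: scalar_prod_def atLeast0LessThan)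

lemma walk_mat_carrier [simp]: "walk_mat M \<in> carrier_mat n n"
  by (auto simp: walk_mat_def)

lemma walk_mat_index: "i < n \<Longrightarrow> j < n \<Longrightarrow> walk_mat M $$ (i, j) = W i j"
  using d_pos[of i] diag_powr_mult[OF adj_T_carrier, of i j "-1"]
  by (simp add: walk_mat_def adj_T_index W_def powr_minus field_simps del: index_mult_mat(1))

lemma D_inv_b_index: "i < n \<Longrightarrow> vec_index (diag_powr M (-1) *\<^sub>v b) i = h i"
  using d_pos[of i] b
  by (simp add: diag_powr_mult_vec h_def powr_minus field_simps del: index_mult_mat_vec)

lemma walk_mat_pow_index:
  assumes "x \<in> carrier_vec n" "i < n"
  shows "vec_index ((walk_mat M ^\<^sub>m l) *\<^sub>v x) i = (mv n W ^^ l) (vec_index x) i"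
  using assms(1)
proof (induction l arbitrary: x)
  case (Suc l)
  have "(walk_mat M ^\<^sub>m Suc l) *\<^sub>v x = (walk_mat M ^\<^sub>m l) *\<^sub>v (walk_mat M *\<^sub>v x)"
    using Suc.prems by (simp add: assoc_mult_mat_vec[of _ n n _ n])
  also have "vec_index \<dots> i = (mv n W ^^ l) (vec_index (walk_mat M *\<^sub>v x)) i"
    using Suc.prems by (intro Suc.IH) (auto intro: mult_mat_vec_carrier[of _ n n])
  also have "\<dots> = (mv n W ^^ l) (mv n W (vec_index x)) i"
    using Suc.prems assms(2)
    by (intro mv_pow_cong) (auto simp: mult_mat_vec_index walk_mat_index mv_def intro!: sum.cong)
  finally show ?case by (simp add: funpow_swap1)
next
  case 0
  then show ?case using assms carrier_matD[OF walk_mat_carrier] by simp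
qed

lemma x_star_index:
  "i < n \<Longrightarrow> vec_index (x_star M b) i = 1/2 * (\<Sum>l. (mv n W ^^ l) h i)"
proof -
  assume i: "i < n"
  have "vec_index ((walk_mat M ^\<^sub>m l) *\<^sub>v (diag_powr M (-1) *\<^sub>v b)) i = (mv n W ^^ l) h i" for l
    using i b by (subst walk_mat_pow_index)
      (auto intro!: mv_pow_cong simp: D_inv_b_index mult_mat_vec_carrier[of _ n n]
        simp del: index_mult_mat_vec)
  then show ?thesis using i by (simp add: x_star_def)
qed

lemma scaled_adj_index:
  assumes "i < n" "j < n" "real_of_ereal (1 / p) = a" "real_of_ereal (1 / q) = 1 - a"
  shows "scaled_adj M p q $$ (i, j) = d i powr (a - 1) * adj_T M $$ (i, j) * d j powr (- a)"
  using assms mult_diag_powr[of "diag_powr M (a - 1) * adj_T M" i j "- a"]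
    diag_powr_mult[OF adj_T_carrier, of i j "a - 1"]
  by (simp add: scaled_adj_def mult_carrier_mat[of _ n n _ n] del: index_mult_mat(1))

lemma scaled_adj_carrier [simp]: "scaled_adj M p q \<in> carrier_mat n n"
  by (auto simp: scaled_adj_def)

text \<open>Conjugation by \<open>D\<^sup>a\<close>, where \<open>a = 1 / p\<close>, turns \<open>W\<close> into the matrix of \<open>gamma_max\<close> and moves \<open>h\<close> into its
  invariant range. The supremum need not be attained, whence the loss of a factor 2.\<close>

lemma contraction:
  assumes "0 < \<gamma>" "\<gamma> \<le> gamma_max M"
  obtains a \<rho> where "0 \<le> a" "a \<le> 1" "0 \<le> \<rho>" "\<rho> = 1 - \<gamma> / 2"
    "\<forall>l. \<forall>i<n. \<bar>(mv n W ^^ l) h i\<bar>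
       \<le> d i powr (- a) * (\<rho> ^ l * (\<Sum>j<n. d j powr a * \<bar>h j\<bar>))"
proof -
  let ?K = "\<lambda>p q. (1/2) \<cdot>\<^sub>m (1\<^sub>m n + scaled_adj M p q)"
  let ?S = "\<lambda>p q. mat_range (1\<^sub>m n - scaled_adj M p q)"
  let ?X = "{1 - restricted_opnorm p (?K p q) (?S p q) | p q.
        1 \<le> p \<and> 1 \<le> q \<and> 1 / p + 1 / q = 1}"
  \<comment> \<open>The pair 1, \<infinity> shows that the supremum is over a nonempty set, so some
    pair exceeds \<gamma>/2.\<close>
  have "(1::ereal) \<le> 1 \<and> (1::ereal) \<le> \<infinity> \<and> 1 / 1 + 1 / (\<infinity>::ereal) = 1" by simp
  then have "1 - restricted_opnorm 1 (?K 1 \<infinity>) (?S 1 \<infinity>) \<in> ?X"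
    by (intro CollectI exI[of _ 1] exI[of _ \<infinity>] conjI refl) (elim conjE; assumption)+
  then have "?X \<noteq> {}" by (rule ex_in_conv[THEN iffD1, OF exI])
  moreover have "\<gamma> / 2 < Sup ?X" using assms by (simp add: gamma_max_def)
  ultimately have "\<exists>x\<in>?X. \<gamma> / 2 < x" by (rule less_cSupD)
  then obtain x where "x \<in> ?X" and x: "\<gamma> / 2 < x" by (rule bexE)
  from this(1) obtain p q where pq: "1 \<le> p" "1 \<le> q" "1 / p + 1 / q = 1"
    and "x = 1 - restricted_opnorm p (?K p q) (?S p q)" by (elim CollectE exE conjE)
  then have pq4: "\<gamma> / 2 < 1 - restricted_opnorm p (?K p q) (?S p q)" using x by simp
  obtain a where a: "0 \<le> a" "a \<le> 1" "real_of_ereal (1 / p) = a" "real_of_ereal (1 / q) = 1 - a"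
    using conjugate_exponents[OF pq] .
  define K where "K = ?K p q"
  define A where "A = 1\<^sub>m n - scaled_adj M p q"
  define S where "S = mat_range A"
  have K: "K \<in> carrier_mat n n" and A: "A \<in> carrier_mat n n"     using minus_carrier_mat[OF scaled_adj_carrier] by (auto simp: K_def A_def)
  have S_iff: "v \<in> S \<longleftrightarrow> (\<exists>x\<in>carrier_vec n. v = A *\<^sub>v x)" for v
    unfolding S_def mat_range_def carrier_matD(2)[OF A] by auto
  have S: "S \<subseteq> carrier_vec n" using mult_mat_vec_carrier[OF A] by (auto simp: S_iff)
  have cone: "c \<cdot>\<^sub>v v \<in> S" if vS: "v \<in> S" for c v
  proof -
    obtain x where x: "x \<in> carrier_vec n" "v = A *\<^sub>v x" using vS unfolding S_iff by auto
    have "c \<cdot>\<^sub>v v = A *\<^sub>v (c \<cdot>\<^sub>v x)" using x mult_mat_vec[OF A x(1)] by simp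
    then show ?thesis unfolding S_iff using x(1) by (intro bexI[of _ "c \<cdot>\<^sub>v x"]) auto
  qed
  have ne: "S \<noteq> {}" using S_iff[of "A *\<^sub>v 0\<^sub>v n"] by auto
  define op where "op = restricted_opnorm p K S"
  have op0: "0 \<le> op" unfolding op_def by (rule restricted_opnorm(1)[OF pq(1) K S cone ne])
  have op: "lp_norm p (K *\<^sub>v v) \<le> op * lp_norm p v" if "v \<in> S" for v
    unfolding op_def by (rule restricted_opnorm(2)[OF pq(1) K S cone ne that])
  define \<rho> where "\<rho> = 1 - \<gamma> / 2"
  have op\<rho>: "op \<le> \<rho>" using pq4 by (simp add: op_def K_def S_def A_def \<rho>_def)
  \<comment> \<open>\<open>y l\<close> is D^a W^l h. By \<open>KW\<close>, K D^a = D^a W, so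
    \<open>K\<close> advances \<open>l\<close> by one.\<close>
  define y where "y l = vec n (\<lambda>i. d i powr a * (mv n W ^^ l) h i)" for l
  have y: "y l \<in> carrier_vec n" for l by (simp add: y_def)
  have KA: "K $$ (i, j) = (if i = j then 1 else 0) - A $$ (i, j) / 2" if "i < n" "j < n" for i j
    using that carrier_matD[OF scaled_adj_carrier[of p q]] by (simp add: K_def A_def diff_divide_distrib)
  have KW: "K $$ (i, j) * d j powr a = d i powr a * W i j" if "i < n" "j < n" for i j
  proof -
    have 1: "d i powr (a - 1) = d i powr a / d i" using d_pos[OF that(1)] by (simp add: powr_diff)
    have 2: "d j powr (- a) * d j powr a = 1"
      using d_pos[OF that(2)] by (simp add: powr_minus)
    have "K $$ (i, j) * d j powr a
      = 1/2 * ((if i = j then 1 else 0) * d j powr a + d i powr (a - 1) * adj_T M $$ (i, j) * (d j powr (- a) * d j powr a))"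
      using that carrier_matD[OF scaled_adj_carrier[of p q]]
      by (simp add: K_def scaled_adj_index[OF that a(3,4)] algebra_simps)
    also have "\<dots> = d i powr a * W i j"
      using that d_pos[OF that(1)] unfolding 1 2 by (cases "i = j") (simp_all add: adj_T_index W_def)
    finally show ?thesis .
  qed
  have Ky: "K *\<^sub>v y l = y (Suc l)" for l
  proof (rule eq_vecI)
    fix i assume "i < dim_vec (y (Suc l))"
    then have i: "i < n" by (simp add: y_def)
    have "vec_index (K *\<^sub>v y l) i = (\<Sum>j<n. K $$ (i, j) * vec_index (y l) j)"
      by (rule mult_mat_vec_index[OF K y i])
    also have "\<dots> = (\<Sum>j<n. d i powr a * (W i j * (mv n W ^^ l) h j))"
      by (intro sum.cong refl) (use KW i in \<open>simp add: y_def mult.assoc[symmetric]\<close>)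
    also have "\<dots> = vec_index (y (Suc l)) i"
      using i by (simp add: y_def mv_def[of n W "(mv n W ^^ l) h"] sum_distrib_left)
    finally show "vec_index (K *\<^sub>v y l) i = vec_index (y (Suc l)) i" .
  qed (use K in \<open>simp add: y_def\<close>)
  have yS: "y l \<in> S" for l
  proof (induction l)
    case 0
    obtain x where x: "x \<in> carrier_vec n" "b = M *\<^sub>v x" using b_range by (auto simp: mat_range_def)
    \<comment> \<open>If b = M x, then z = D^a x is a preimage of \<open>y 0\<close>, because A D^a
      = 2 D^a (I - W) = D^a D^-1 M.\<close>
    define z where "z = vec n (\<lambda>j. d j powr a * vec_index x j)"
    have z: "z \<in> carrier_vec n" by (simp add: z_def)
    have "y 0 = A *\<^sub>v z"
    proof (rule eq_vecI)
      fix i assume "i < dim_vec (A *\<^sub>v z)"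
      then have i: "i < n" using A by simp
      have "vec_index (A *\<^sub>v z) i = (\<Sum>j<n. A $$ (i, j) * vec_index z j)"
        by (rule mult_mat_vec_index[OF A z i])
      also have "\<dots> = (\<Sum>j<n. d i powr a / d i * (M $$ (i, j) * vec_index x j))"
      proof (intro sum.cong refl)
        fix j assume "j \<in> {..<n}"
        then have j: "j < n" by simp
        have "A $$ (i, j) * d j powr a = 2 * (if i = j then d j powr a else 0) - 2 * (K $$ (i, j) * d j powr a)"
          unfolding KA[OF i j] by (simp add: algebra_simps)
        also have "\<dots> = d i powr a / d i * M $$ (i, j)"
          unfolding KW[OF i j] using d_pos[OF i] by (cases "i = j") (simp_all add: W_def)
        finally show "A $$ (i, j) * vec_index z j = d i powr a / d i * (M $$ (i, j) * vec_index x j)"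
          using j by (simp add: z_def mult.assoc[symmetric])
      qed
      also have "\<dots> = d i powr a * h i"
        unfolding sum_distrib_left[symmetric] mult_mat_vec_index[OF M x(1) i, symmetric] x(2)[symmetric]
        by (simp add: h_def)
      finally show "vec_index (y 0) i = vec_index (A *\<^sub>v z) i" using i by (simp add: y_def)
    qed (use A in \<open>simp add: y_def\<close>)
    then show ?case unfolding S_iff using z by (intro bexI[of _ z])
  next
    case (Suc l)
    then obtain x where x: "x \<in> carrier_vec n" "y l = A *\<^sub>v x" unfolding S_iff by auto
    \<comment> \<open>Since K = I - A/2 and \<open>y l\<close> is A x, the next iterate is A x - A
      (y l)/2, which lies in the range again.\<close>
    define z where "z = x - (1/2) \<cdot>\<^sub>v y l"
    have z: "z \<in> carrier_vec n" using x(1) y[of l] unfolding z_def by (intro minus_carrier_vec smult_carrier_vec[THEN iffD2])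
    have "y (Suc l) = A *\<^sub>v z"
    proof (rule eq_vecI)
      fix i assume "i < dim_vec (A *\<^sub>v z)"
      then have i: "i < n" using A by simp
      have "vec_index (K *\<^sub>v y l) i = (\<Sum>j<n. K $$ (i, j) * vec_index (y l) j)"
        by (rule mult_mat_vec_index[OF K y i])
      also have "\<dots> = (\<Sum>j<n. (if j = i then vec_index (y l) i else 0) - A $$ (i, j) * vec_index (y l) j / 2)"
        using i by (intro sum.cong refl) (auto simp: KA left_diff_distrib)
      also have "\<dots> = vec_index (A *\<^sub>v x) i - (\<Sum>j<n. A $$ (i, j) * vec_index (y l) j / 2)"
        using i by (simp add: sum_subtractf x(2)[symmetric])
      also have "\<dots> = (\<Sum>j<n. A $$ (i, j) * vec_index x j) - (\<Sum>j<n. A $$ (i, j) * vec_index (y l) j / 2)"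
        using mult_mat_vec_index[OF A x(1) i] by simp
      also have "\<dots> = (\<Sum>j<n. A $$ (i, j) * vec_index z j)"
        unfolding sum_subtractf[symmetric]
        by (intro sum.cong refl) (use carrier_vecD[OF y[of l]] in \<open>simp add: z_def algebra_simps\<close>)
      also have "\<dots> = vec_index (A *\<^sub>v z) i" using mult_mat_vec_index[OF A z i] by simp
      finally show "vec_index (y (Suc l)) i = vec_index (A *\<^sub>v z) i" using Ky by simp
    qed (use A in \<open>simp add: y_def\<close>)
    then show ?case unfolding S_iff using z by (intro bexI[of _ z])
  qed
  have ylp: "lp_norm p (y l) \<le> \<rho> ^ l * lp_norm p (y 0)" for l
  proof (induction l)
    case (Suc l)
    have "lp_norm p (y (Suc l)) \<le> op * lp_norm p (y l)" using op[OF yS] Ky by simp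
    also have "\<dots> \<le> \<rho> * (\<rho> ^ l * lp_norm p (y 0))"
      using Suc op0 op\<rho> lp_norm_nonneg[of p] by (intro mult_mono) auto
    finally show ?case by (simp add: mult.assoc)
  qed simp
  have y0: "lp_norm p (y 0) \<le> (\<Sum>j<n. d j powr a * \<bar>h j\<bar>)"
    using lp_norm_le_sum[OF pq(1), of "y 0"] by (simp add: y_def abs_mult)
  show thesis
  proof (rule that[of a \<rho>])
    show "0 \<le> \<rho>" using op0 op\<rho> by linarith
    show "\<forall>l. \<forall>i<n. \<bar>(mv n W ^^ l) h i\<bar>
       \<le> d i powr (- a) * (\<rho> ^ l * (\<Sum>j<n. d j powr a * \<bar>h j\<bar>))"
    proof (intro allI impI)
      fix l i assume i: "i < n"
      have "d i powr a * \<bar>(mv n W ^^ l) h i\<bar> = \<bar>vec_index (y l) i\<bar>" using i by (simp add: y_def abs_mult)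
      also have "\<dots> \<le> lp_norm p (y l)" using i by (intro abs_index_le_lp_norm pq) (simp add: y_def)
      also have "\<dots> \<le> \<rho> ^ l * (\<Sum>j<n. d j powr a * \<bar>h j\<bar>)"
        using op0 op\<rho> by (intro order_trans[OF ylp] mult_left_mono y0) auto
      finally show "\<bar>(mv n W ^^ l) h i\<bar> \<le> d i powr (- a) * (\<rho> ^ l * (\<Sum>j<n. d j powr a * \<bar>h j\<bar>))"
        using d_pos[OF i] by (simp add: powr_minus field_simps)
    qed
  qed (use a \<rho>_def in auto)
qed

text \<open>The contraction factor 1 - \<gamma>/2 is nonnegative.\<close>

lemma gamma_le_2: "0 < \<gamma> \<Longrightarrow> \<gamma> \<le> gamma_max M \<Longrightarrow> \<gamma> \<le> 2"
  by (rule contraction[of \<gamma>]) auto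

text \<open>Applied to \<open>b\<close> with exponent \<open>a\<close> and to \<open>t\<close> with
  \<open>1 - a\<close>: the two powers of the largest diagonal entry then multiply to the single
  factor in \<open>log_arg\<close>.\<close>

lemma weighted_sum_le:
  assumes x: "x \<in> carrier_vec n" and a: "0 \<le> a"
  shows "(\<Sum>i<n. d i powr a * (\<bar>vec_index x i\<bar> / d i))
    \<le> d_max M powr a * (real (l0_norm x) * lp_norm \<infinity> (diag_powr M (-1) *\<^sub>v x))"
proof -
  let ?N = "{i. i < n \<and> vec_index x i \<noteq> 0}" and ?b = "lp_norm \<infinity> (diag_powr M (-1) *\<^sub>v x)"
  have "(\<Sum>i<n. d i powr a * (\<bar>vec_index x i\<bar> / d i)) = (\<Sum>i\<in>?N. d i powr a * (\<bar>vec_index x i\<bar> / d i))"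
    by (intro sum.mono_neutral_right) auto
  also have "\<dots> \<le> (\<Sum>i\<in>?N. d_max M powr a * ?b)"
  proof (intro sum_mono mult_mono)
    fix i assume "i \<in> ?N"
    then have i: "i < n" by simp
    have "d i \<le> d_max M" unfolding d_max_def using i by (intro Max_ge) auto
    then show "d i powr a \<le> d_max M powr a" using a d_pos[OF i] by (intro powr_mono2) auto
    have "\<bar>vec_index (diag_powr M (-1) *\<^sub>v x) i\<bar> \<le> ?b"
      using i carrier_matD[OF diag_powr_carrier[of "-1"]] by (intro abs_index_le_lp_norm) auto
    then show "\<bar>vec_index x i\<bar> / d i \<le> ?b"
      using d_pos[OF i] i x by (simp add: diag_powr_mult_vec powr_minus abs_mult field_simps del: index_mult_mat_vec)
  qed (use d_pos in \<open>auto simp: less_imp_le\<close>)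
  also have "\<dots> = d_max M powr a * (real (l0_norm x) * ?b)"
    using x by (simp add: l0_norm_def carrier_vecD)
  finally show ?thesis .
qed

text \<open>The terms of the series decay geometrically with ratio 1 - \<gamma>/2 and a leading
  constant of at most \<open>B\<close>; the tail from \<Lambda> on is at most \<epsilon>, and the
  factor 1/2 of the solution halves it.\<close>

lemma truncation_error:
  assumes "0 < \<gamma>" "\<gamma> \<le> gamma_max M" "0 < \<epsilon>" "log_arg M b t \<le> B"
    and \<Lambda>: "real \<Lambda> \<ge> 4 * log1 (1 / (\<gamma> * \<epsilon>) * B) / \<gamma>"
  shows "\<bar>scalar_prod t (x_star M b) - 1/2 * (\<Sum>l<\<Lambda>. \<Sum>u<n. vec_index t u * (mv n W ^^ l) h u)\<bar> \<le> \<epsilon> / 2"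
proof -
  obtain a \<rho> where a: "0 \<le> a" "a \<le> 1" and \<rho>: "0 \<le> \<rho>" "\<rho> = 1 - \<gamma> / 2"
    and "\<forall>l. \<forall>i<n. \<bar>(mv n W ^^ l) h i\<bar>
       \<le> d i powr (- a) * (\<rho> ^ l * (\<Sum>j<n. d j powr a * \<bar>h j\<bar>))"
    by (rule contraction[OF assms(1,2)])
  then have bound: "\<And>l i. i < n \<Longrightarrow> \<bar>(mv n W ^^ l) h i\<bar>
       \<le> d i powr (- a) * (\<rho> ^ l * (\<Sum>j<n. d j powr a * \<bar>h j\<bar>))"
    by blast
  have \<rho>1: "\<rho> < 1" using \<rho>(2) assms(1) by simp
  define Y where "Y = (\<Sum>j<n. d j powr a * \<bar>h j\<bar>)"
  define f where "f l = (\<Sum>u<n. vec_index t u * (mv n W ^^ l) h u)" for l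
  \<comment> \<open>Leading constant of the geometric bound: the scalings D^a and D^-a are
    distributed over \<open>b\<close> and \<open>t\<close>.\<close>
  define A where "A = (\<Sum>i<n. d i powr (1 - a) * (\<bar>vec_index t i\<bar> / d i)) * Y"
  have Y0: "0 \<le> Y" by (simp add: Y_def sum_nonneg)
  have A0: "0 \<le> A" unfolding A_def using Y0 d_pos
    by (intro mult_nonneg_nonneg sum_nonneg) (auto simp: less_imp_le)
  have "0 < n" using b_nz b by (cases n) auto
  then have dm: "0 < d_max M" using d_pos[of 0] unfolding d_max_def by (subst Max_gr_iff) auto
  have "A \<le> log_arg M b t"
  proof -
    have "Y = (\<Sum>j<n. d j powr a * (\<bar>vec_index b j\<bar> / d j))"
      unfolding Y_def h_def using d_pos by (intro sum.cong) (auto simp: less_imp_le)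
    then have "Y \<le> d_max M powr a * (real (l0_norm b) * lp_norm \<infinity> (diag_powr M (-1) *\<^sub>v b))"
      using weighted_sum_le[OF b a(1)] by simp
    then have "A \<le> (d_max M powr (1 - a) * (real (l0_norm t) * lp_norm \<infinity> (diag_powr M (-1) *\<^sub>v t)))
       * (d_max M powr a * (real (l0_norm b) * lp_norm \<infinity> (diag_powr M (-1) *\<^sub>v b)))"
      unfolding A_def using weighted_sum_le[OF t, of "1 - a"] a Y0
      by (intro mult_mono) (auto intro!: mult_nonneg_nonneg lp_norm_nonneg)
    also have "\<dots> = (d_max M powr (1 - a) * d_max M powr a) * real (l0_norm t)
        * lp_norm \<infinity> (diag_powr M (-1) *\<^sub>v t) * real (l0_norm b) * lp_norm \<infinity> (diag_powr M (-1) *\<^sub>v b)"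
      by (simp add: mult_ac)
    also have "d_max M powr (1 - a) * d_max M powr a = d_max M"
      using dm by (simp add: powr_add[symmetric])
    finally show ?thesis by (simp add: log_arg_def)
  qed
  then have AB: "A \<le> B" using assms(4) by linarith
  have f: "\<bar>f l\<bar> \<le> A * \<rho> ^ l" for l
  proof -
    have "\<bar>f l\<bar> \<le> (\<Sum>u<n. \<bar>vec_index t u\<bar> * \<bar>(mv n W ^^ l) h u\<bar>)"
      unfolding f_def by (rule order_trans[OF sum_abs]) (simp add: abs_mult)
    also have "\<dots> \<le> (\<Sum>u<n. \<bar>vec_index t u\<bar> * (d u powr (- a) * (\<rho> ^ l * Y)))"
      unfolding Y_def by (intro sum_mono mult_left_mono bound) auto
    also have "\<dots> = (\<Sum>u<n. d u powr (1 - a) * (\<bar>vec_index t u\<bar> / d u) * (\<rho> ^ l * Y))"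
    proof (intro sum.cong refl)
      fix u assume "u \<in> {..<n}"
      then have u: "d u > 0" using d_pos by simp
      have e: "d u powr (- a) = d u powr (1 - a) / d u"
        using u by (simp add: powr_diff powr_minus field_simps)
      show "\<bar>vec_index t u\<bar> * (d u powr (- a) * (\<rho> ^ l * Y))
        = d u powr (1 - a) * (\<bar>vec_index t u\<bar> / d u) * (\<rho> ^ l * Y)"
        unfolding e by simp
    qed
    also have "\<dots> = A * \<rho> ^ l" unfolding sum_distrib_right[symmetric] A_def by (simp add: mult_ac)
    finally show ?thesis .
  qed
  have gs: "summable (\<lambda>l. A * \<rho> ^ l)" using \<rho>(1) \<rho>1 by (intro summable_mult summable_geometric) auto
  have sf: "summable f" using f by (intro summable_comparison_test'[OF gs, of 0]) auto
  \<comment> \<open>Coordinatewise convergence justifies exchanging the finite sum with the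
    series.\<close>
  have si: "summable (\<lambda>l. (mv n W ^^ l) h i)" if "i < n" for i
  proof (rule summable_comparison_test'[of "\<lambda>l. (d i powr (- a) * Y) * \<rho> ^ l" 0])
    show "summable (\<lambda>l. (d i powr (- a) * Y) * \<rho> ^ l)"
      using \<rho>(1) \<rho>1 by (intro summable_mult summable_geometric) auto
    show "norm ((mv n W ^^ l) h i) \<le> (d i powr (- a) * Y) * \<rho> ^ l" for l
      using bound[OF that, of l] by (simp add: Y_def mult_ac)
  qed
  have "scalar_prod t (x_star M b) = (\<Sum>i<n. vec_index t i * (1/2 * (\<Sum>l. (mv n W ^^ l) h i)))"
    using arg_cong[OF x_star_def[of M b], of dim_vec]
    by (simp add: scalar_prod_def x_star_index atLeast0LessThan)
  also have "\<dots> = 1/2 * (\<Sum>i<n. \<Sum>l. vec_index t i * (mv n W ^^ l) h i)"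
    using si by (simp add: suminf_mult[symmetric] sum_distrib_left sum_divide_distrib)
  also have "(\<Sum>i<n. \<Sum>l. vec_index t i * (mv n W ^^ l) h i) = (\<Sum>l. f l)"
    unfolding f_def by (rule suminf_sum[symmetric]) (use si in \<open>auto intro: summable_mult\<close>)
  also have "\<dots> = (\<Sum>l. f (l + \<Lambda>)) + (\<Sum>l<\<Lambda>. f l)" using sf by (rule suminf_split_initial_segment)
  finally have "scalar_prod t (x_star M b) - 1/2 * (\<Sum>l<\<Lambda>. f l) = 1/2 * (\<Sum>l. f (l + \<Lambda>))"
    by (simp add: algebra_simps)
  moreover have "\<bar>\<Sum>l. f (l + \<Lambda>)\<bar> \<le> (\<Sum>l. A * \<rho> ^ \<Lambda> * \<rho> ^ l)"
  proof -
    have gs': "summable (\<lambda>l. A * \<rho> ^ \<Lambda> * \<rho> ^ l)"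
      using \<rho>(1) \<rho>1 by (intro summable_mult summable_geometric) auto
    have "norm (f (l + \<Lambda>)) \<le> A * \<rho> ^ \<Lambda> * \<rho> ^ l" for l
      using f[of "l + \<Lambda>"] by (simp add: power_add mult_ac)
    from norm_suminf_le[OF this gs'] show ?thesis by simp
  qed
  moreover have "(\<Sum>l. A * \<rho> ^ \<Lambda> * \<rho> ^ l) = A * \<rho> ^ \<Lambda> * (2 / \<gamma>)"
    using \<rho> \<rho>1 assms(1) by (subst suminf_mult) (auto simp: suminf_geometric summable_geometric)
  moreover have "A * \<rho> ^ \<Lambda> * (2 / \<gamma>) \<le> \<epsilon>"
  \<comment> \<open>If \<open>A = 0\<close> the tail vanishes, and \<open>B\<close> may fail to be
    positive there, so that nothing can be said about its logarithm.\<close>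
  proof (cases "A = 0")
    case False
    then have B: "B > 0" using A0 AB by linarith
    define X where "X = 1 / (\<gamma> * \<epsilon>) * B"
    have X: "X > 0" using B assms by (simp add: X_def)
    have l1: "log1 X \<ge> 1" "log1 X \<ge> ln X" by (auto simp: log1_def)
    have "\<rho> \<le> exp (- \<gamma> / 2)" using exp_ge_add_one_self[of "- \<gamma> / 2"] \<rho>(2) by simp
    then have "\<rho> ^ \<Lambda> \<le> exp (- \<gamma> / 2) ^ \<Lambda>" using \<rho>(1) by (rule power_mono)
    also have "\<dots> = exp (real \<Lambda> * (- \<gamma> / 2))" by (rule exp_of_nat_mult[symmetric])
    also have "\<dots> \<le> exp (- 1 - ln X)"
    proof -
      \<comment> \<open>The exponent is at most -2 \<open>log1 X\<close>; one half yields the factor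
        1/e, the other cancels \<open>X\<close>.\<close>
      have "real \<Lambda> * \<gamma> \<ge> 4 * log1 X" using \<Lambda> assms(1) by (simp add: X_def field_simps)
      then show ?thesis using l1 by simp
    qed
    also have "\<dots> = exp (-1) / X" using X by (simp add: exp_diff)
    also have "\<dots> \<le> (1/2) / X"
      using exp_ge_add_one_self[of 1] X by (intro divide_right_mono) (auto simp: exp_minus field_simps)
    finally have "\<rho> ^ \<Lambda> \<le> \<gamma> * \<epsilon> / (2 * B)" using assms B by (simp add: X_def field_simps)
    then have "A * \<rho> ^ \<Lambda> \<le> B * (\<gamma> * \<epsilon> / (2 * B))" using A0 AB \<rho>(1) B by (intro mult_mono) auto
    also have "\<dots> = \<gamma> * \<epsilon> / 2" using B by simp
    finally show ?thesis using assms(1) by (simp add: field_simps)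
  qed (use assms in simp)
  ultimately show ?thesis unfolding f_def[symmetric] by linarith
qed

end

section \<open>Scanning the right-hand side and measuring the length\<close>

text \<open>Program variables: \<open>b\<close> and \<open>w\<close> hold the norms of \<open>b\<close> and \<open>D\<^sup>-\<^sup>1 b\<close>; \<open>L\<close> is \<open>\<Lambda>\<close> and \<open>O\<close> is \<open>\<Lambda> n\<close>; the array
  \<open>R\<close> holds the residual of \<open>u\<close> at level \<open>j\<close> in position \<open>j n + u\<close>; the arrays \<open>I\<close> and \<open>J\<close> form a stack of height \<open>m\<close>
  of vertices and level offsets \<open>j n\<close>; \<open>A\<close> tabulates these offsets, because naturals cannot be multiplied;
  \<open>p\<close> is the threshold \<open>\<rho>\<close>, \<open>N\<close> the required number of walks, \<open>a\<close> the pushed part of the answer.\<close>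

definition zero :: rexp where "zero = OfNat (NConst 0)"

definition scan_body :: com where
  "scan_body =
    Seq (GetDiag ''d'' (NArr ''I'' (NVar ''k'')))
   (Seq (RAssign ''x'' (RDiv (RArr ''V'' (NVar ''k'')) (RVar ''d'')))
   (Seq (RStore ''R'' (NArr ''I'' (NVar ''k'')) (RVar ''x''))
   (Seq (Cond (RLess (RVar ''x'') zero) (RAssign ''x'' (RMinus zero (RVar ''x''))) (RAssign ''x'' (RVar ''x'')))
   (Seq (RAssign ''b'' (RPlus (RVar ''b'') (RTimes (RVar ''x'') (RVar ''d''))))
   (Seq (Cond (RLess (RVar ''w'') (RVar ''x'')) (RAssign ''w'' (RVar ''x'')) (RAssign ''w'' (RVar ''w'')))
        (NAssign ''k'' (NPlus (NVar ''k'') (NConst 1))))))))"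

definition scan_prog :: com where
  "scan_prog = Seq (ScanB ''I'' ''V'' ''m'') (While (NLess (NVar ''k'') (NVar ''m'')) scan_body)"

definition log_prog :: com where
  "log_prog =
    Seq (RAssign ''g'' (RLn (RTimes (RDiv (OfNat (NConst 1)) (RTimes (RVar ''gamma'') (RVar ''eps''))) (RVar ''B''))))
   (Seq (Cond (RLess (RVar ''g'') (OfNat (NConst 1))) (RAssign ''g'' (OfNat (NConst 1))) (RAssign ''g'' (RVar ''g'')))
        (RAssign ''l'' (RDiv (RTimes (OfNat (NConst 4)) (RVar ''g'')) (RVar ''gamma''))))"

text \<open>Reals cannot be rounded, so the ceiling of \<open>l\<close> is found by counting; the
  same loop tabulates the level offsets by repeated addition.\<close>

definition len_prog :: com where
  "len_prog =
    Seq (NAssign ''L'' (NConst 0))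
   (Seq (NAssign ''O'' (NConst 0))
     (While (RLess (OfNat (NVar ''L'')) (RVar ''l''))
       (Seq (NStore ''A'' (NVar ''L'') (NVar ''O''))
       (Seq (NAssign ''O'' (NPlus (NVar ''O'') (NVar ''n'')))
            (NAssign ''L'' (NPlus (NVar ''L'') (NConst 1)))))))"

context ram
begin

text \<open>A choice between two assignments to the same variable, one of them possibly idle, takes
  two units either way. Treating it as one assignment of a conditional value avoids case
  splits.\<close>

lemma bounds_Cond_RAssign:
  assumes "K (tick 2 (set_r x (if bval c s then rval e s else rval e' s) s)) r"
  shows "bounds (Cond c (RAssign x e) (RAssign x e')) s K r"
proof -
  have "rval e (tick 1 s) = rval e s" for e
  proof (induction e)
    have "nval e (tick 1 s) = nval e s" for e by (induction e) (auto simp: tick_def)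
    then show "rval (OfNat x) (tick 1 s) = rval (OfNat x) s" for x by simp
    show "rval (RArr x y) (tick 1 s) = rval (RArr x y) s" for x y
      using \<open>\<And>e. nval e (tick 1 s) = nval e s\<close> by (simp add: tick_def)
  qed (auto simp: tick_def)
  then have "exec M b t acc d (Cond c (RAssign x e) (RAssign x e')) s
    = return_spmf (tick 2 (set_r x (if bval c s then rval e s else rval e' s) s))" for d
    by (auto simp: tick_def set_r_def)
  then show ?thesis by (rule bounds_return) (rule assms)
qed

lemmas bounds_rules = bounds_Seq bounds_NAssign bounds_RAssign bounds_NStore bounds_RStore
  bounds_GetDiag bounds_GetT bounds_ScanCol bounds_ScanB bounds_Cond_RAssign

end

lemma if_less_max: "(if x < y then y else x) = max x (y :: real)"
  by (simp add: max_def)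

lemmas upd_defs = set_n_def set_r_def tick_def

locale rcdd_instance = rcdd_system +
  fixes \<epsilon> \<gamma> B c :: real
  assumes \<epsilon>: "0 < \<epsilon>" and \<gamma>: "0 < \<gamma>" "\<gamma> \<le> gamma_max M" and B: "log_arg M b t \<le> B"
    and c: "0 < c" and entries: "\<And>i j. i < n \<Longrightarrow> j < n \<Longrightarrow> M $$ (i, j) \<noteq> 0 \<Longrightarrow> \<bar>M $$ (i, j)\<bar> \<ge> c"
begin

definition f :: nat where "f = f_row M acc"

definition beta :: real where "beta = lp_norm \<infinity> (diag_powr M (-1) *\<^sub>v b)"

definition params :: "state \<Rightarrow> bool" where
  "params s \<longleftrightarrow> nv s ''n'' = n \<and> rv s ''eps'' = \<epsilon> \<and> rv s ''gamma'' = \<gamma> \<and> rv s ''t1'' = t1 \<and>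
     rv s ''frow'' = real f \<and> rv s ''B'' = B"

lemma beta_eq: "beta = Max (insert 0 ((\<lambda>i. \<bar>h i\<bar>) ` {..<n}))"
proof -
  have "(\<lambda>i. \<bar>vec_index (diag_powr M (-1) *\<^sub>v b) i\<bar>) ` {..<n} = (\<lambda>i. \<bar>h i\<bar>) ` {..<n}"
    using D_inv_b_index by (intro image_cong) (auto simp del: index_mult_mat_vec)
  then show ?thesis by (simp add: beta_def lp_norm_def)
qed

lemma h_le_beta: "i < n \<Longrightarrow> \<bar>h i\<bar> \<le> beta"
  unfolding beta_eq by (intro Max_ge) auto

lemma b_nz_props:
  "distinct (b_nz acc)" "set (b_nz acc) = {i. i < n \<and> vec_index b i \<noteq> 0}" "length (b_nz acc) = l0_norm b"
  using acc by (auto simp: valid_access_def l0_norm_def distinct_card[symmetric])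

text \<open>The list of positions read by the scan already serves as the initial stack: it covers
  all nonzero residuals, at level offset 0. From position \<open>n\<close> on \<open>R\<close> is
  zero, that is, all higher levels are empty.\<close>

definition scanned :: "state \<Rightarrow> bool" where
  "scanned s \<longleftrightarrow> params s \<and> nv s ''m'' = l0_norm b \<and> rv s ''b'' = b1 \<and> rv s ''w'' = beta \<and>
     (\<forall>i<l0_norm b. na s ''I'' i < n \<and> na s ''J'' i = 0) \<and>
     (\<forall>u<n. h u \<noteq> 0 \<longrightarrow> (\<exists>i<l0_norm b. na s ''I'' i = u)) \<and>
     (\<forall>u<n. ra s ''R'' u = h u) \<and> (\<forall>u\<ge>n. ra s ''R'' u = 0)"

text \<open>An iteration takes ten units: nine for the body and one for the guard.\<close>

definition scan_inv :: "state \<Rightarrow> bool" where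
  "scan_inv s \<longleftrightarrow> params s \<and> nv s ''m'' = l0_norm b \<and> nv s ''k'' \<le> l0_norm b \<and>
     (\<forall>i<l0_norm b. na s ''I'' i = b_nz acc ! i \<and> ra s ''V'' i = vec_index b (b_nz acc ! i) \<and> na s ''J'' i = 0) \<and>
     rv s ''b'' = (\<Sum>i<nv s ''k''. \<bar>vec_index b (b_nz acc ! i)\<bar>) \<and> 0 \<le> rv s ''w'' \<and> rv s ''w'' \<le> beta \<and>
     (\<forall>i<nv s ''k''. \<bar>h (b_nz acc ! i)\<bar> \<le> rv s ''w'') \<and>
     (\<forall>u. ra s ''R'' u = (if u \<in> set (take (nv s ''k'') (b_nz acc)) then h u else 0)) \<and>
     time s \<le> 1 + l0_norm b + 10 * nv s ''k''"

lemma scan_body_bounds: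
  assumes "scan_inv s" "nv s ''k'' < l0_norm b"
  shows "bounds scan_body (tick 1 s) (\<lambda>s' r'. (scan_inv s' \<and> r' = r) \<and>
     l0_norm b - nv s' ''k'' < l0_norm b - nv s ''k'') r"
proof -
  define k u where "k = nv s ''k''" and "u = b_nz acc ! k"
  have k: "k < l0_norm b" using assms(2) by (simp add: k_def)
  have "u \<in> set (b_nz acc)" using k b_nz_props(3) by (simp add: u_def)
  then have u: "u < n" using b_nz_props(2) by auto
  have du: "d u > 0" using d_pos[OF u] .
  have tk: "set (take (Suc k) (b_nz acc)) = insert u (set (take k (b_nz acc)))"
    using k b_nz_props(3) by (simp add: u_def take_Suc_conv_app_nth)
  have I: "na s ''I'' k = u" "ra s ''V'' k = vec_index b u" using assms(1) k by (auto simp: scan_inv_def u_def)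
  have hb: "vec_index b u / d u = h u" by (simp add: h_def)
  have bb: "\<bar>vec_index b u\<bar> = \<bar>h u\<bar> * d u" using du by (simp add: h_def)
  note h_le_beta[OF u]
  note inv = assms(1)[unfolded scan_inv_def params_def k_def[symmetric]]
  show ?thesis
    unfolding scan_body_def zero_def
    apply ((rule bounds_rules; (simp add: upd_defs k_def[symmetric] I u hb if_less_max abs_if[symmetric] split del: if_split)?)+)
    using inv k \<open>\<bar>h u\<bar> \<le> beta\<close>
    apply (simp add: scan_inv_def params_def tk k_def[symmetric] u_def[symmetric] less_Suc_eq bb)
    apply auto
    done
qed

lemma scan_inv_done:
  assumes inv: "scan_inv s" and k: "nv s ''k'' = l0_norm b"
  shows "scanned (tick 1 s)"
proof -
  let ?xs = "b_nz acc"
  note i = inv[unfolded scan_inv_def]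
  have xs: "?xs ! i \<in> set ?xs" if "i < l0_norm b" for i using that b_nz_props(3) by simp
  have ex: "\<exists>i<l0_norm b. ?xs ! i = u" if "u < n" "h u \<noteq> 0" for u
  proof -
    have "u \<in> set ?xs" using that b_nz_props(2) by (auto simp: h_def)
    then show ?thesis using b_nz_props(3) by (auto simp: in_set_conv_nth)
  qed
  have "(\<Sum>i<l0_norm b. \<bar>vec_index b (?xs ! i)\<bar>) = (\<Sum>u\<in>set ?xs. \<bar>vec_index b u\<bar>)"
    using bij_betw_nth[OF b_nz_props(1), of "{..<l0_norm b}" "set ?xs"] b_nz_props(3)
    by (intro sum.reindex_bij_betw) auto
  also have "\<dots> = b1" unfolding b1_def b_nz_props(2) by (intro sum.mono_neutral_left) auto
  finally have b1: "rv s ''b'' = b1" using i k by simp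
  have "beta \<le> rv s ''w''"
    unfolding beta_eq
  proof (subst Max_le_iff, simp, simp, intro ballI)
    fix y assume "y \<in> insert 0 ((\<lambda>i. \<bar>h i\<bar>) ` {..<n})"
    then consider "y = 0" | u where "u < n" "y = \<bar>h u\<bar>" "h u \<noteq> 0" by fastforce
    then show "y \<le> rv s ''w''"
    proof cases
      case 2
      then show ?thesis using ex[OF 2(1,3)] i k by auto
    qed (use i in simp)
  qed
  then have w: "rv s ''w'' = beta" using i by linarith
  have R: "ra s ''R'' u = (if u \<in> set ?xs then h u else 0)" for u
    using i k b_nz_props(3) by simp
  have R1: "\<forall>u<n. ra s ''R'' u = h u" and R2: "\<forall>u\<ge>n. ra s ''R'' u = 0"
    unfolding R b_nz_props(2) by (auto simp: h_def)
  have I: "na s ''I'' i = ?xs ! i" "na s ''J'' i = 0" if "i < l0_norm b" for i using i that by auto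
  have I1: "\<forall>i<l0_norm b. na s ''I'' i < n \<and> na s ''J'' i = 0"
    using I xs unfolding b_nz_props(2) by simp
  have I2: "\<forall>u<n. h u \<noteq> 0 \<longrightarrow> (\<exists>i<l0_norm b. na s ''I'' i = u)"
    using ex I(1) by metis
  have "params s" "nv s ''m'' = l0_norm b" using i by auto
  then show ?thesis
    unfolding scanned_def using b1 w R1 R2 I1 I2 by (simp add: params_def tick_def)
qed

lemma scan_prog_bounds:
  assumes "\<And>s'. scanned s' \<Longrightarrow> time s' \<le> 2 + 11 * l0_norm b \<Longrightarrow> K s' r"
  shows "bounds scan_prog (init_state M t acc \<epsilon> \<gamma> B) K r"
  unfolding scan_prog_def
proof (intro bounds_Seq bounds_ScanB)
  let ?s = "load ''I'' ''V'' ''m'' (b_nz acc) (vec_index b) (init_state M t acc \<epsilon> \<gamma> B)"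
  show "bounds (While (NLess (NVar ''k'') (NVar ''m'')) scan_body) ?s K r"
  proof (rule bounds_While[where I = "\<lambda>s' r'. scan_inv s' \<and> r' = r" and V = "\<lambda>s. l0_norm b - nv s ''k''"])
    show "scan_inv ?s \<and> r = r"
      using b_nz_props(3)
      by (auto simp: scan_inv_def params_def load_def init_state_def tick_def set_n_def overwrite_def
          f_def t1_def lp_norm_1 lp_norm_nonneg beta_def)
  next
    fix s r' assume "scan_inv s \<and> r' = r" "bval (NLess (NVar ''k'') (NVar ''m'')) s"
    then show "bounds scan_body (tick 1 s) (\<lambda>s' r'. (scan_inv s' \<and> r' = r) \<and>
       l0_norm b - nv s' ''k'' < l0_norm b - nv s ''k'') r'"
      using scan_body_bounds[of s r] by (auto simp: scan_inv_def)
  next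
    fix s r' assume s: "scan_inv s \<and> r' = r" "\<not> bval (NLess (NVar ''k'') (NVar ''m'')) s"
    then have k: "nv s ''k'' = l0_norm b" by (auto simp: scan_inv_def)
    have "time s \<le> 1 + l0_norm b + 10 * l0_norm b" using s(1) k by (simp add: scan_inv_def)
    then have "K (tick 1 s) r" using scan_inv_done[OF _ k] s(1) by (intro assms) (auto simp: tick_def)
    then show "K (tick 1 s) r'" using s(1) by simp
  qed
qed

text \<open>\<open>B\<close> stands in for \<open>log_arg\<close>; the factor 4 is the one
  \<open>truncation_error\<close> asks for.\<close>

definition ell :: real where "ell = 4 * log1 (1 / (\<gamma> * \<epsilon>) * B) / \<gamma>"
definition Lam :: nat where "Lam = nat \<lceil>ell\<rceil>"

definition measured :: "state \<Rightarrow> bool" where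
  "measured s \<longleftrightarrow> scanned s \<and> nv s ''L'' = Lam \<and> nv s ''O'' = Lam * n \<and> (\<forall>j<Lam. na s ''A'' j = j * n)"

text \<open>Counting up while below a real bound stops exactly at its ceiling; used for the length
  and for the number of walks.\<close>

lemma real_less_iff_nat_ceiling: "real k < x \<longleftrightarrow> k < nat \<lceil>x\<rceil>"
  by (metis less_ceiling_iff of_int_of_nat_eq zless_nat_eq_int_zless)

lemma log_prog_bounds:
  assumes "scanned s" and "\<And>s'. scanned s' \<Longrightarrow> rv s' ''l'' = ell \<Longrightarrow> time s' = time s + 4 \<Longrightarrow> K s' r"
  shows "bounds log_prog s K r"
proof -
  note p = assms(1)[unfolded scanned_def params_def]
  show ?thesis unfolding log_prog_def
    apply ((rule bounds_rules; (simp add: upd_defs p if_less_max split del: if_split)?)+)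
    apply (rule assms(2))
    using assms(1)
    apply (auto simp: scanned_def params_def ell_def log1_def max.commute)
    done
qed

lemma len_prog_bounds:
  assumes "scanned s" "rv s ''l'' = ell"
    and post: "\<And>s'. measured s' \<Longrightarrow> time s' = time s + 3 + 4 * Lam \<Longrightarrow> K s' r"
  shows "bounds len_prog s K r"
  unfolding len_prog_def
proof (intro bounds_Seq bounds_NAssign)
  let ?s = "tick 1 (set_n ''O'' (nval (NConst 0) (tick 1 (set_n ''L'' (nval (NConst 0) s) s)))
     (tick 1 (set_n ''L'' (nval (NConst 0) s) s)))"
  let ?I = "\<lambda>s' r'. r' = r \<and> scanned s' \<and> rv s' ''l'' = ell \<and> nv s' ''L'' \<le> Lam \<and> nv s' ''O'' = nv s' ''L'' * n
    \<and> (\<forall>j<nv s' ''L''. na s' ''A'' j = j * n) \<and> time s' = time s + 2 + 4 * nv s' ''L''"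
  show "bounds (While (RLess (OfNat (NVar ''L'')) (RVar ''l'')) (Seq (NStore ''A'' (NVar ''L'') (NVar ''O''))
       (Seq (NAssign ''O'' (NPlus (NVar ''O'') (NVar ''n''))) (NAssign ''L'' (NPlus (NVar ''L'') (NConst 1)))))) ?s K r"
  proof (rule bounds_While[where I = ?I and V = "\<lambda>s. Lam - nv s ''L''"])
    show "?I ?s r" using assms(1,2) by (auto simp: scanned_def params_def upd_defs)
  next
    fix s1 r' assume I: "?I s1 r'" and g: "bval (RLess (OfNat (NVar ''L'')) (RVar ''l'')) s1"
    have g: "nv s1 ''L'' < Lam" using g I by (simp add: real_less_iff_nat_ceiling Lam_def)
    show "bounds (Seq (NStore ''A'' (NVar ''L'') (NVar ''O''))
       (Seq (NAssign ''O'' (NPlus (NVar ''O'') (NVar ''n''))) (NAssign ''L'' (NPlus (NVar ''L'') (NConst 1)))))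
       (tick 1 s1) (\<lambda>s' r'. ?I s' r' \<and> Lam - nv s' ''L'' < Lam - nv s1 ''L'') r'"
      apply ((rule bounds_rules; (simp add: upd_defs)?)+)
      using I g
      apply (simp add: scanned_def params_def less_Suc_eq)
      done
  next
    fix s1 r' assume I: "?I s1 r'" and g: "\<not> bval (RLess (OfNat (NVar ''L'')) (RVar ''l'')) s1"
    have "\<not> nv s1 ''L'' < Lam" using g I by (simp add: real_less_iff_nat_ceiling Lam_def)
    then have L: "nv s1 ''L'' = Lam" using I by simp
    have "K (tick 1 s1) r"
      using I L by (intro post) (auto simp: measured_def scanned_def params_def tick_def)
    then show "K (tick 1 s1) r'" using I by simp
  qed
qed

end

section \<open>Pushing residuals\<close>

definition Lr :: rexp where "Lr = OfNat (NVar ''L'')"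

text \<open>Roots are computed as \<open>exp (ln x / k)\<close>. The variables \<open>y\<close> and
  \<open>p\<close> receive \<open>r1\<close> and \<open>r2\<close>, and \<open>p\<close> then
  becomes their maximum.\<close>

definition param_prog :: com where
  "param_prog =
    Seq (RAssign ''q'' (RDiv (RTimes (RTimes (RVar ''t1'') (RVar ''b'')) (RTimes Lr (RTimes Lr Lr))) (RVar ''eps'')))
   (Cond (RLess (RTimes (RVar ''frow'') Lr) (RVar ''q''))
     (Seq (RAssign ''y'' (RExp (RDiv (RLn (RDiv (RTimes (RVar ''b'') (RTimes (RVar ''eps'') (RVar ''eps'')))
            (RTimes (RTimes (RVar ''t1'') (RVar ''t1'')) (RTimes (RVar ''frow'') (RTimes (RTimes Lr Lr) (RTimes Lr Lr))))))
            (OfNat (NConst 3)))))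
     (Seq (RAssign ''p'' (RExp (RDiv (RLn (RDiv (RTimes (RVar ''b'') (RTimes (RVar ''eps'') (RVar ''eps'')))
            (RTimes (RTimes (RVar ''t1'') (RVar ''t1'')) (RTimes (RTimes (RVar ''frow'') (RVar ''w'')) (RTimes Lr (RTimes Lr Lr))))))
            (OfNat (NConst 2)))))
     (Seq (Cond (RLess (RVar ''p'') (RVar ''y'')) (RAssign ''p'' (RVar ''y'')) (RAssign ''p'' (RVar ''p'')))
          (RAssign ''N'' (RDiv (RTimes (OfNat (NConst 4)) (RVar ''b'')) (RTimes (RVar ''frow'') (RVar ''p'')))))))
     (Seq (RAssign ''p'' (RDiv (RVar ''eps'') (RTimes (RVar ''t1'') (RTimes Lr Lr))))
          (RAssign ''N'' zero)))"

definition col_body :: com where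
  "col_body =
    Seq (NAssign ''u'' (NArr ''X'' (NVar ''k'')))
   (Seq (GetDiag ''d'' (NVar ''u''))
   (Seq (RStore ''R'' (NPlus (NVar ''o'') (NVar ''u''))
          (RMinus (RArr ''R'' (NPlus (NVar ''o'') (NVar ''u'')))
            (RDiv (RTimes (RVar ''h'') (RArr ''Y'' (NVar ''k''))) (RTimes (OfNat (NConst 2)) (RVar ''d'')))))
   (Seq (NStore ''I'' (NVar ''m'') (NVar ''u''))
   (Seq (NStore ''J'' (NVar ''m'') (NVar ''o''))
   (Seq (NAssign ''m'' (NPlus (NVar ''m'') (NConst 1)))
        (NAssign ''k'' (NPlus (NVar ''k'') (NConst 1))))))))"

text \<open>The column W e_v is e_v - D^-1 M e_v / 2. The first summand is added directly at the
  next level; the loop subtracts the second along the stored column, after the offset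
  \<open>o\<close> has moved on.\<close>

definition push_one :: com where
  "push_one =
    Seq (RStore ''R'' (NPlus (NVar ''o'') (NVar ''v'')) zero)
   (Seq (GetT ''x'' (NVar ''v''))
   (Seq (RAssign ''a'' (RPlus (RVar ''a'') (RTimes (RVar ''x'') (RVar ''h''))))
   (Seq (NAssign ''o'' (NPlus (NVar ''o'') (NVar ''n'')))
   (Seq (RStore ''R'' (NPlus (NVar ''o'') (NVar ''v''))
          (RPlus (RArr ''R'' (NPlus (NVar ''o'') (NVar ''v''))) (RVar ''h'')))
   (Seq (ScanCol ''X'' ''Y'' ''c'' (NVar ''v''))
   (Seq (NAssign ''k'' (NConst 0))
        (While (NLess (NVar ''k'') (NVar ''c'')) col_body)))))))"

text \<open>Comparing squares saves taking the absolute value. The first test excludes level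
  \<Lambda>, whose residuals are never pushed; the last assignment is idle.\<close>

definition push_body :: com where
  "push_body =
    Seq (NAssign ''m'' (NMinus (NVar ''m'') (NConst 1)))
   (Seq (NAssign ''v'' (NArr ''I'' (NVar ''m'')))
   (Seq (NAssign ''o'' (NArr ''J'' (NVar ''m'')))
   (Seq (RAssign ''h'' (RArr ''R'' (NPlus (NVar ''o'') (NVar ''v''))))
        (Cond (BAnd (NLess (NVar ''o'') (NVar ''O''))
                 (RLess (RTimes (RVar ''p'') (RVar ''p'')) (RTimes (RVar ''h'') (RVar ''h''))))
          push_one (NAssign ''k'' (NConst 0))))))"

definition push_prog :: com where
  "push_prog = Seq (RAssign ''a'' zero) (While (NLess (NConst 0) (NVar ''m'')) push_body)"

lemma index_inj:
  fixes n :: nat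
  assumes "u < n" "v < n" shows "i * n + u = j * n + v \<longleftrightarrow> i = j \<and> u = v"
proof
  assume e: "i * n + u = j * n + v"
  have "(i * n + u) div n = i" "(j * n + v) div n = j" using assms by auto
  then show "i = j \<and> u = v" using e by auto
qed simp

section \<open>Choice of the threshold and correctness of pushing\<close>

context rcdd_instance
begin

text \<open>Compares the cost of a single walk with that of pushing alone: at threshold
  \<epsilon>/(\<open>t1\<close> \<Lambda>^2) the quantity \<Lambda> \<open>b1\<close>/\<rho> becomes
  the right-hand side.\<close>

definition walks_pay :: bool where
  "walks_pay \<longleftrightarrow> real f * real Lam < t1 * b1 * (real Lam * (real Lam * real Lam)) / \<epsilon>"

text \<open>Solution of \<Lambda> \<open>b1\<close>/\<rho> = (\<open>f\<close> \<Lambda>) N, where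
  the number N of walks is the second moment \<open>t1\<close>^2 \<Lambda>^4 \<rho>^2 divided by
  \<epsilon>^2.\<close>

definition r1 :: real where
  "r1 = exp (ln (b1 * (\<epsilon> * \<epsilon>) / (t1 * t1 * (real f * ((real Lam * real Lam) * (real Lam * real Lam))))) / 3)"

text \<open>The same balance with the second moment \<open>t1\<close>^2 \<Lambda>^3 \<rho>
  \<beta>.\<close>

definition r2 :: real where
  "r2 = exp (ln (b1 * (\<epsilon> * \<epsilon>) / (t1 * t1 * (real f * beta * (real Lam * (real Lam * real Lam))))) / 2)"

text \<open>The maximum makes pushing at most as expensive as at either balance point, while the
  second-moment bound belonging to the larger root still holds.\<close>

definition rho :: real where
  "rho = (if walks_pay then max r1 r2 else \<epsilon> / (t1 * (real Lam * real Lam)))"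

text \<open>At the balance point N = \<open>b1\<close>/(\<open>f\<close> \<rho>); the factor 4 turns
  this into failure probability 1/4.\<close>

definition walks_needed :: real where "walks_needed = (if walks_pay then 4 * b1 / (real f * rho) else 0)"

text \<open>The part of memory that neither pushing nor sampling changes.\<close>

definition frame :: "state \<Rightarrow> bool" where
  "frame s \<longleftrightarrow> params s \<and> nv s ''L'' = Lam \<and> nv s ''O'' = Lam * n \<and> (\<forall>j<Lam. na s ''A'' j = j * n)
     \<and> rv s ''p'' = rho \<and> rv s ''N'' = walks_needed"

lemma param_prog_bounds:
  assumes "measured s" and post: "\<And>s'. measured s' \<Longrightarrow> frame s' \<Longrightarrow> time s' \<le> time s + 8 \<Longrightarrow> K s' r"
  shows "bounds param_prog s K r"
proof -
  note p = assms(1)[unfolded measured_def scanned_def params_def]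
  show ?thesis unfolding param_prog_def Lr_def zero_def
    apply (rule bounds_Seq, rule bounds_RAssign, rule bounds_Cond)
    subgoal
      apply ((rule bounds_rules; (simp add: upd_defs p if_less_max split del: if_split)?)+)
      apply (rule post)
      using p apply (simp_all add: frame_def measured_def scanned_def params_def rho_def walks_needed_def walks_pay_def r1_def r2_def max.commute)
      done
    subgoal
      apply ((rule bounds_rules; (simp add: upd_defs p if_less_max split del: if_split)?)+)
      apply (rule post)
      using p apply (simp_all add: frame_def measured_def scanned_def params_def rho_def walks_needed_def walks_pay_def)
      done
    done
qed

definition res :: "state \<Rightarrow> nat \<Rightarrow> nat \<Rightarrow> real" where
  "res s j u = ra s ''R'' (j * n + u)"

lemma col_nz_props:
  assumes "v < n"
  shows "distinct (col_nz acc v)" "set (col_nz acc v) = {i. i < n \<and> M $$ (i, v) \<noteq> 0}"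
  using acc assms by (auto simp: valid_access_def)

lemma col_loop_bounds:
  assumes "frame s" "v < n" "nv s ''k'' = 0" "nv s ''c'' = length (col_nz acc v)"
    and XY: "\<forall>i<length (col_nz acc v). na s ''X'' i = col_nz acc v ! i \<and> ra s ''Y'' i = M $$ (col_nz acc v ! i, v)"
    and post: "\<And>s'. frame s' \<Longrightarrow> rv s' ''a'' = rv s ''a'' \<Longrightarrow> nv s' ''m'' = nv s ''m'' + length (col_nz acc v) \<Longrightarrow>
       (\<forall>i<nv s ''m''. na s' ''I'' i = na s ''I'' i \<and> na s' ''J'' i = na s ''J'' i) \<Longrightarrow>
       (\<forall>i<length (col_nz acc v). na s' ''I'' (nv s ''m'' + i) = col_nz acc v ! i \<and> na s' ''J'' (nv s ''m'' + i) = nv s ''o'') \<Longrightarrow>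
       (\<forall>w. ra s' ''R'' w = ra s ''R'' w - (if nv s ''o'' \<le> w \<and> w - nv s ''o'' \<in> set (col_nz acc v)
          then rv s ''h'' * M $$ (w - nv s ''o'', v) / (2 * d (w - nv s ''o'')) else 0)) \<Longrightarrow>
       time s' = time s + 8 * length (col_nz acc v) + 1 \<Longrightarrow> K s' r"
  shows "bounds (While (NLess (NVar ''k'') (NVar ''c'')) col_body) s K r"
proof -
  define xs where "xs = col_nz acc v"
  define m0 where "m0 = nv s ''m''"
  define o' where "o' = nv s ''o''"
  define x where "x = rv s ''h''"
  let ?I = "\<lambda>s' r'. r' = r \<and> frame s' \<and> nv s' ''k'' \<le> length xs \<and> nv s' ''c'' = length xs \<and> nv s' ''o'' = o'
    \<and> rv s' ''h'' = x \<and> (\<forall>i<length xs. na s' ''X'' i = xs ! i \<and> ra s' ''Y'' i = M $$ (xs ! i, v))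
    \<and> rv s' ''a'' = rv s ''a'' \<and> nv s' ''m'' = m0 + nv s' ''k''
    \<and> (\<forall>i<m0. na s' ''I'' i = na s ''I'' i \<and> na s' ''J'' i = na s ''J'' i)
    \<and> (\<forall>i<nv s' ''k''. na s' ''I'' (m0 + i) = xs ! i \<and> na s' ''J'' (m0 + i) = o')
    \<and> (\<forall>w. ra s' ''R'' w = ra s ''R'' w - (if o' \<le> w \<and> w - o' \<in> set (take (nv s' ''k'') xs)
          then x * M $$ (w - o', v) / (2 * d (w - o')) else 0))
    \<and> time s' = time s + 8 * nv s' ''k''"
  show ?thesis
  proof (rule bounds_While[where I = ?I and V = "\<lambda>s. length xs - nv s ''k''"])
    show "?I s r" using assms by (simp add: xs_def m0_def o'_def x_def)
  next
    fix s1 r' assume I: "?I s1 r'" and g: "bval (NLess (NVar ''k'') (NVar ''c'')) s1"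
    define k u where "k = nv s1 ''k''" and "u = xs ! k"
    have k: "k < length xs" using I g by (simp add: k_def)
    have "u \<in> set xs" using k by (simp add: u_def)
    then have u: "u < n" using col_nz_props[OF assms(2)] by (simp add: xs_def)
    have tk: "set (take (Suc k) xs) = insert u (set (take k xs))"
      using k by (simp add: u_def take_Suc_conv_app_nth)
    \<comment> \<open>A column lists each row once, so position \<open>u\<close> still holds its old
      residual.\<close>
    have "distinct (take (Suc k) xs)" using col_nz_props[OF assms(2)] by (simp add: xs_def)
    then have fresh: "u \<notin> set (take k xs)" using k by (simp add: u_def take_Suc_conv_app_nth)
    have X: "na s1 ''X'' k = u" "ra s1 ''Y'' k = M $$ (u, v)" using I k by (auto simp: u_def)
    have e: "o' \<le> w \<Longrightarrow> w - o' = u \<longleftrightarrow> w = o' + u" for w by auto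
    note I' = I[folded k_def]
    show "bounds col_body (tick 1 s1) (\<lambda>s' r'. ?I s' r' \<and> length xs - nv s' ''k'' < length xs - nv s1 ''k'') r'"
      unfolding col_body_def
      apply ((rule bounds_rules; (simp add: upd_defs k_def[symmetric] X u I' split del: if_split)?)+)
      using I' k fresh
      apply (simp add: frame_def params_def k_def[symmetric] tk less_Suc_eq u_def[symmetric] e)
      apply auto
      done
  next
    fix s1 r' assume I: "?I s1 r'" and g: "\<not> bval (NLess (NVar ''k'') (NVar ''c'')) s1"
    have k: "nv s1 ''k'' = length xs" using I g by simp
    have "K (tick 1 s1) r"
      using I k by (intro post) (simp_all add: tick_def frame_def params_def xs_def m0_def o'_def x_def)
    then show "K (tick 1 s1) r'" using I by simp
  qed
qed

lemma push_one_bounds: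
  assumes fr: "frame s" and v: "v < n" "nv s ''v'' = v" and j: "j < Lam" "nv s ''o'' = j * n" "rv s ''h'' = res s j v"
    and post: "\<And>s'. frame s' \<Longrightarrow> rv s' ''a'' = rv s ''a'' + vec_index t v * res s j v \<Longrightarrow>
       nv s' ''m'' = nv s ''m'' + length (col_nz acc v) \<Longrightarrow>
       (\<forall>i<nv s ''m''. na s' ''I'' i = na s ''I'' i \<and> na s' ''J'' i = na s ''J'' i) \<Longrightarrow>
       (\<forall>i<length (col_nz acc v). na s' ''I'' (nv s ''m'' + i) = col_nz acc v ! i \<and> na s' ''J'' (nv s ''m'' + i) = Suc j * n) \<Longrightarrow>
       (\<forall>i. \<forall>u<n. res s' i u = push W j v (res s j v) (res s) i u) \<Longrightarrow>
       time s' = time s + 8 + 9 * length (col_nz acc v) \<Longrightarrow> K s' r"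
  shows "bounds push_one s K r"
proof -
  let ?xs = "col_nz acc v" and ?x = "res s j v"
  \<comment> \<open>Memory after clearing the pushed residual and adding the identity part of the
    column one level up.\<close>
  define R2 where "R2 = (ra s ''R'')(j * n + v := 0, Suc j * n + v := ra s ''R'' (Suc j * n + v) + ?x)"
  have ne: "n \<noteq> 0" "0 < n" using v by simp_all
  note p = fr[unfolded frame_def params_def]
  have R: "R2 (i * n + u) - (if Suc j * n \<le> i * n + u \<and> i * n + u - Suc j * n \<in> set ?xs
       then ?x * M $$ (i * n + u - Suc j * n, v) / (2 * d (i * n + u - Suc j * n)) else 0)
       = push W j v ?x (res s) i u" if u: "u < n" for i u
  proof -
    \<comment> \<open>An address that exceeds the offset of level \<open>Suc j\<close> by less than
      \<open>n\<close> belongs to that level; truncated subtraction thus cannot hit another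
      one.\<close>
    have c: "Suc j * n \<le> i * n + u \<and> i * n + u - Suc j * n \<in> set ?xs \<longleftrightarrow> i = Suc j \<and> u \<in> set ?xs"
    proof
      assume a: "Suc j * n \<le> i * n + u \<and> i * n + u - Suc j * n \<in> set ?xs"
      then obtain w where w: "i * n + u = Suc j * n + w" "w \<in> set ?xs"
        by (metis le_add_diff_inverse)
      have "w < n" using w(2) col_nz_props(2)[OF v(1)] by simp
      then show "i = Suc j \<and> u \<in> set ?xs" using index_inj[OF u, of w i "Suc j"] w by auto
    qed auto
    have z: "M $$ (u, v) = 0" if "u \<notin> set ?xs" using that u col_nz_props(2)[OF v(1)] by simp
    show ?thesis
      using index_inj[OF u v(1), of i j] index_inj[OF u v(1), of i "Suc j"] z
      unfolding c by (auto simp: R2_def push_def res_def W_def algebra_simps)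
  qed
  have load: "ram.bounds M b t acc (While (NLess (NVar ''k'') (NVar ''c'')) col_body) s1 K r"
    if s1: "frame s1" "nv s1 ''k'' = 0" "nv s1 ''c'' = length ?xs" "nv s1 ''o'' = Suc j * n" "rv s1 ''h'' = ?x"
      "nv s1 ''m'' = nv s ''m''" "na s1 ''I'' = na s ''I''" "na s1 ''J'' = na s ''J''"
      "ra s1 ''R'' = R2" "rv s1 ''a'' = rv s ''a'' + vec_index t v * ?x" "time s1 = time s + 7 + length ?xs"
      "\<forall>i<length ?xs. na s1 ''X'' i = ?xs ! i \<and> ra s1 ''Y'' i = M $$ (?xs ! i, v)" for s1
  proof (rule col_loop_bounds[OF s1(1) v(1) s1(2,3,12)])
    fix s' assume s': "frame s'" "rv s' ''a'' = rv s1 ''a''" "nv s' ''m'' = nv s1 ''m'' + length ?xs"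
       "\<forall>i<nv s1 ''m''. na s' ''I'' i = na s1 ''I'' i \<and> na s' ''J'' i = na s1 ''J'' i"
       "\<forall>i<length ?xs. na s' ''I'' (nv s1 ''m'' + i) = ?xs ! i \<and> na s' ''J'' (nv s1 ''m'' + i) = nv s1 ''o''"
       "\<forall>w. ra s' ''R'' w = ra s1 ''R'' w - (if nv s1 ''o'' \<le> w \<and> w - nv s1 ''o'' \<in> set ?xs
          then rv s1 ''h'' * M $$ (w - nv s1 ''o'', v) / (2 * d (w - nv s1 ''o'')) else 0)"
       "time s' = time s1 + 8 * length ?xs + 1"
    show "K s' r"
    proof (rule post)
      show "\<forall>i. \<forall>u<n. res s' i u = push W j v ?x (res s) i u"
      proof (intro allI impI)
        fix i u assume u: "u < n"
        show "res s' i u = push W j v ?x (res s) i u"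
          using s'(6)[unfolded s1(4,5,9)] R[OF u, of i] unfolding res_def[of s'] by (simp only:)
      qed
    qed (use s' s1 in simp_all)
  qed
  show ?thesis
    unfolding push_one_def zero_def
    apply ((rule bounds_rules; (simp add: upd_defs load_def v j ne p)?)+)
    apply (rule load)
    using p v j ne apply (simp_all add: frame_def params_def R2_def overwrite_def add.commute[of "j * n" n])
    done
qed

section \<open>Behaviour of the potentials under pushes\<close>

definition target :: real where
  "target = (\<Sum>l<Lam. \<Sum>u<n. vec_index t u * (mv n W ^^ l) h u)"

text \<open>By \<open>pot_vm_sum\<close>, this is what the residuals still contribute to
  \<open>target\<close>.\<close>

definition lin_pot :: "(nat \<Rightarrow> nat \<Rightarrow> real) \<Rightarrow> real" where
  "lin_pot r = pot n Lam (vm_sum n W (vec_index t)) r"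

text \<open>The unsigned version bounds the remaining contribution and, multiplied by the threshold,
  the second moment of a walk.\<close>

definition abs_pot :: "(nat \<Rightarrow> nat \<Rightarrow> real) \<Rightarrow> real" where
  "abs_pot r = pot n Lam (vm_sum n P (\<lambda>u. \<bar>vec_index t u\<bar>)) (\<lambda>j u. \<bar>r j u\<bar>)"

definition cost_pot :: "(nat \<Rightarrow> nat \<Rightarrow> real) \<Rightarrow> real" where
  "cost_pot r = pot n Lam (\<lambda>m u. real m * d u) (\<lambda>j u. \<bar>r j u\<bar>)"

lemma abs_weight_nonneg: "u < n \<Longrightarrow> 0 \<le> vm_sum n P (\<lambda>u. \<bar>vec_index t u\<bar>) m u"
  unfolding vm_sum_def by (intro sum_nonneg vm_pow_nonneg) auto

lemma cost_pot_nonneg: "0 \<le> cost_pot r"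
  unfolding cost_pot_def using d_pos by (intro pot_nonneg) (auto simp: less_imp_le)

text \<open>For the first two potentials the recursion \<open>vm_sum_Suc\<close> gives the drop at
  \<open>v\<close> exactly; for the third, one level less means one \<open>d v\<close> less, and
  column dominance handles the rest.\<close>

lemma push_pots:
  assumes "j < Lam" "v < n"
  shows "lin_pot (push W j v (r j v) r) = lin_pot r - vec_index t v * r j v"
    and "abs_pot (push W j v (r j v) r) \<le> abs_pot r"
    and "cost_pot (push W j v (r j v) r) + \<bar>r j v\<bar> * d v \<le> cost_pot r"
proof -
  obtain m where m: "Lam - j = Suc m" "Lam - Suc j = m" using assms(1) by (metis Suc_diff_Suc)
  show "lin_pot (push W j v (r j v) r) = lin_pot r - vec_index t v * r j v"
    unfolding lin_pot_def pot_push[OF assms] m vm_sum_Suc by simp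
  have "abs_pot (push W j v (r j v) r) + \<bar>r j v\<bar> * \<bar>vec_index t v\<bar> \<le> abs_pot r"
    unfolding abs_pot_def by (rule pot_push_abs[OF assms abs_weight_nonneg]) (auto simp: vm_sum_Suc)
  moreover have "0 \<le> \<bar>r j v\<bar> * \<bar>vec_index t v\<bar>" by simp
  ultimately show "abs_pot (push W j v (r j v) r) \<le> abs_pot r" by linarith
  show "cost_pot (push W j v (r j v) r) + \<bar>r j v\<bar> * d v \<le> cost_pot r"
    unfolding cost_pot_def
  proof (rule pot_push_abs[OF assms])
    fix m
    have "(\<Sum>u<n. real m * d u * P u v) = real m * (\<Sum>u<n. d u * P u v)"
      by (simp add: sum_distrib_left mult.assoc)
    also have "\<dots> \<le> real m * d v" using P_col[OF assms(2)] by (intro mult_left_mono) auto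
    finally show "d v + (\<Sum>u<n. real m * d u * P u v) \<le> real (Suc m) * d v"
      by (simp add: algebra_simps)
  qed (use d_pos in \<open>auto simp: less_imp_le\<close>)
qed

lemma pots_cong:
  assumes "\<And>j u. u < n \<Longrightarrow> r j u = r' j u"
  shows "lin_pot r = lin_pot r'" "abs_pot r = abs_pot r'" "cost_pot r = cost_pot r'"
  unfolding lin_pot_def abs_pot_def cost_pot_def using assms by (auto intro!: pot_cong)

lemma sum_t_abs: "(\<Sum>u<n. \<bar>vec_index t u\<bar>) = t1" by (simp add: t1_def)

text \<open>Only level 0 is occupied. For the second bound, the visits have total weight at most
  \<Lambda> \<open>t1\<close>, and each meets a residual of at most \<open>beta\<close>.\<close>

lemma initial_pots:
  assumes "\<And>u. u < n \<Longrightarrow> r 0 u = h u" "\<And>j u. u < n \<Longrightarrow> 0 < j \<Longrightarrow> r j u = 0"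
  shows "lin_pot r = target" "abs_pot r \<le> t1 * real Lam * beta" "cost_pot r = real Lam * b1"
proof -
  have "lin_pot r = (\<Sum>v<n. vm_sum n W (vec_index t) Lam v * h v)"
    unfolding lin_pot_def using assms by (rule pot_level0)
  also have "\<dots> = (\<Sum>l<Lam. \<Sum>v<n. (vm n W ^^ l) (vec_index t) v * h v)"
    unfolding vm_sum_def sum_distrib_right by (rule sum.swap)
  finally show "lin_pot r = target" by (simp add: target_def dual_mv_vm_pow)
  have "abs_pot r = (\<Sum>v<n. vm_sum n P (\<lambda>u. \<bar>vec_index t u\<bar>) Lam v * \<bar>h v\<bar>)"
    unfolding abs_pot_def using assms by (intro pot_level0) auto
  also have "\<dots> \<le> (\<Sum>v<n. vm_sum n P (\<lambda>u. \<bar>vec_index t u\<bar>) Lam v * beta)"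
    using abs_weight_nonneg h_le_beta by (intro sum_mono mult_left_mono) auto
  also have "\<dots> = (\<Sum>v<n. vm_sum n P (\<lambda>u. \<bar>vec_index t u\<bar>) Lam v) * beta"
    by (simp add: sum_distrib_right)
  also have "\<dots> \<le> (real Lam * (\<Sum>u<n. \<bar>vec_index t u\<bar>)) * beta"
    using P_row by (intro mult_right_mono sum_vm_sum_le) (auto simp: beta_def lp_norm_nonneg)
  finally show "abs_pot r \<le> t1 * real Lam * beta" by (simp add: sum_t_abs mult_ac)
  have "cost_pot r = (\<Sum>v<n. real Lam * d v * \<bar>h v\<bar>)"
    unfolding cost_pot_def using assms by (intro pot_level0) auto
  also have "\<dots> = (\<Sum>v<n. real Lam * \<bar>vec_index b v\<bar>)"
  proof (rule sum.cong[OF refl])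
    fix v assume "v \<in> {..<n}"
    then have "d v > 0" using d_pos by simp
    then show "real Lam * d v * \<bar>h v\<bar> = real Lam * \<bar>vec_index b v\<bar>" by (simp add: h_def)
  qed
  finally show "cost_pot r = real Lam * b1" by (simp add: b1_def sum_distrib_left)
qed

text \<open>Each stack entry prepays 20 units, which cover its removal and the fixed part of a push.
  A push further pays 29 per column entry, 9 for processing and 20 for the new stack entry; in total
  this is at most 58 \<open>d v\<close>/\<open>c\<close>, while \<open>cost_pot\<close> drops by at
  least \<open>rho * d v\<close>.\<close>

definition push_time :: "real \<Rightarrow> real" where
  "push_time T = T + 1 + 20 * real (l0_norm b) + 58 / (c * rho) * (real Lam * b1)"

text \<open>Time serves as the termination measure: the last conjunct bounds it while each iteration increases it.
  An entry may occur on the stack several times; once pushed its residual is 0, so further occurrences are skipped.\<close>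

definition push_inv :: "real \<Rightarrow> state \<Rightarrow> bool" where
  "push_inv T s \<longleftrightarrow> frame s \<and>
     (\<forall>i<nv s ''m''. na s ''I'' i < n \<and> (\<exists>j\<le>Lam. na s ''J'' i = j * n)) \<and>
     (\<forall>j<Lam. \<forall>u<n. rho < \<bar>res s j u\<bar> \<longrightarrow> (\<exists>i<nv s ''m''. na s ''I'' i = u \<and> na s ''J'' i = j * n)) \<and>
     rv s ''a'' + lin_pot (res s) = target \<and> abs_pot (res s) \<le> t1 * real Lam * beta \<and>
     real (time s) + 20 * real (nv s ''m'') + 58 / (c * rho) * cost_pot (res s) \<le> push_time T"

lemma push_body_bounds:
  assumes rho: "0 < rho" and inv: "push_inv T s" and m: "0 < nv s ''m''"
  shows "bounds push_body (tick 1 s) (\<lambda>s' r'. (r' = r \<and> push_inv T s') \<and> time s < time s') r"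
proof -
  define m0 where "m0 = nv s ''m'' - 1"
  define v where "v = na s ''I'' m0"
  have m0: "nv s ''m'' = Suc m0" using m by (simp add: m0_def)
  note i = inv[unfolded push_inv_def]
  have v: "v < n" using i m0 by (simp add: v_def)
  obtain j where j: "j \<le> Lam" "na s ''J'' m0 = j * n" using i m0 by auto
  have cov: "\<forall>j<Lam. \<forall>u<n. rho < \<bar>res s j u\<bar> \<longrightarrow>
      (\<exists>i<Suc m0. na s ''I'' i = u \<and> na s ''J'' i = j * n)"
    using i unfolding m0 by blast
  define x where "x = res s j v"
  have R: "ra s ''R'' (j * n + v) = x" by (simp add: x_def res_def)
  have n0: "0 < n" using v by simp
  let ?K = "\<lambda>s' r'. (r' = r \<and> push_inv T s') \<and> time s < time s'"
  define s1 where "s1 = s\<lparr>nv := (nv s)(''m'' := m0, ''v'' := v, ''o'' := j * n),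
    rv := (rv s)(''h'' := x), time := time s + 6\<rparr>"
  have fr: "frame s1" using i by (simp add: s1_def frame_def params_def)
  have res1: "res s1 = res s" by (simp add: s1_def res_def fun_eq_iff)
  have c0: "0 \<le> 58 / (c * rho)" using c rho by simp
  have sq: "rho * rho < x * x \<longleftrightarrow> rho < \<bar>x\<bar>"
    using rho abs_le_square_iff[of x rho] by (auto simp: power2_eq_square not_le[symmetric])
  have skip: "bounds (NAssign ''k'' (NConst 0)) s1 ?K r" if small: "\<not> (j < Lam \<and> rho < \<bar>x\<bar>)"
  proof (rule bounds_NAssign, intro conjI)
    let ?s = "tick 1 (set_n ''k'' (nval (NConst 0) s1) s1)"
    \<comment> \<open>The remaining stack still covers all large residuals, since the popped
      position is small or on the last level.\<close>
    have "\<exists>k<m0. na s ''I'' k = u \<and> na s ''J'' k = j' * n" if ju: "j' < Lam" "u < n" "rho < \<bar>res s j' u\<bar>" for j' u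
    proof -
      obtain k where k: "k < Suc m0" "na s ''I'' k = u" "na s ''J'' k = j' * n" using cov ju by blast
      have "k \<noteq> m0"
      proof
        assume "k = m0"
        then have "u = v" "j' = j" using k j n0 by (auto simp: v_def)
        then show False using small ju by (simp add: x_def)
      qed
      then show ?thesis using k by (intro exI[of _ k]) auto
    qed
    moreover have "res ?s = res s" by (simp add: s1_def res_def fun_eq_iff upd_defs)
    moreover have "frame ?s" using fr by (simp add: frame_def params_def upd_defs)
    ultimately show "push_inv T ?s" using i m0 by (auto simp: push_inv_def s1_def upd_defs)
  qed (simp_all add: s1_def upd_defs)
  have go: "bounds push_one s1 ?K r" if jx: "j < Lam" "rho < \<bar>x\<bar>"
  proof (rule push_one_bounds[OF fr v _ jx(1)])
    show "nv s1 ''v'' = v" "nv s1 ''o'' = j * n" "rv s1 ''h'' = res s1 j v"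
      by (simp_all add: s1_def res_def x_def)
    let ?xs = "col_nz acc v"
    fix s' assume s': "frame s'" "rv s' ''a'' = rv s1 ''a'' + vec_index t v * res s1 j v"
       "nv s' ''m'' = nv s1 ''m'' + length ?xs"
       "\<forall>i<nv s1 ''m''. na s' ''I'' i = na s1 ''I'' i \<and> na s' ''J'' i = na s1 ''J'' i"
       "\<forall>i<length ?xs. na s' ''I'' (nv s1 ''m'' + i) = ?xs ! i \<and> na s' ''J'' (nv s1 ''m'' + i) = Suc j * n"
       "\<forall>i. \<forall>u<n. res s' i u = push W j v (res s1 j v) (res s1) i u"
       "time s' = time s1 + 8 + 9 * length ?xs"
    have m1: "nv s1 ''m'' = m0" by (simp add: s1_def)
    have res': "res s' i u = push W j v (res s j v) (res s) i u" if "u < n" for i u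
      using s'(6) that by (simp add: res1)
    have eqs: "lin_pot (res s') = lin_pot (push W j v (res s j v) (res s))"
      "abs_pot (res s') = abs_pot (push W j v (res s j v) (res s))"
      "cost_pot (res s') = cost_pot (push W j v (res s j v) (res s))"
      by (rule pots_cong, erule res')+
    note pots = push_pots[OF jx(1) v, of "res s", folded eqs]
    have stack: "\<forall>i<nv s' ''m''. na s' ''I'' i < n \<and> (\<exists>j\<le>Lam. na s' ''J'' i = j * n)"
    proof (intro allI impI)
      fix k assume k: "k < nv s' ''m''"
      show "na s' ''I'' k < n \<and> (\<exists>j\<le>Lam. na s' ''J'' k = j * n)"
      proof (cases "k < m0")
        case True
        then show ?thesis using s'(4) i m0 m1 by (simp add: s1_def)
      next
        case False
        define l where "l = k - m0"
        have l: "k = m0 + l" "l < length ?xs" using False k s'(3) m1 by (auto simp: l_def)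
        have "na s' ''I'' k = ?xs ! l" "na s' ''J'' k = Suc j * n" using s'(5) m1 l by simp_all
        moreover have "?xs ! l < n" using l(2) col_nz_props(2)[OF v] nth_mem by blast
        ultimately show ?thesis using jx(1) Suc_leI by (intro conjI exI[of _ "Suc j"]) simp_all
      qed
    qed
    \<comment> \<open>A residual that is large after the push either lies in the column just stacked
      or was not changed and keeps its old stack entry.\<close>
    have cover: "\<exists>k<nv s' ''m''. na s' ''I'' k = u \<and> na s' ''J'' k = j' * n"
      if ju: "j' < Lam" "u < n" "rho < \<bar>res s' j' u\<bar>" for j' u
    proof (cases "j' = Suc j \<and> u \<in> set ?xs")
      case True
      then obtain l where "l < length ?xs" "?xs ! l = u" by (auto simp: in_set_conv_nth)
      then show ?thesis using True s'(3,5) m1 by (intro exI[of _ "m0 + l"]) auto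
    next
      case False
      \<comment> \<open>As the diagonal entry is nonzero, \<open>v\<close> is in its own column, so
        the position that receives the identity part is stacked too.\<close>
      have "d v \<noteq> 0" using d_pos[OF v] by simp
      then have "v \<in> set ?xs" using col_nz_props(2)[OF v] v by simp
      then have "W u v = 0" if "j' = Suc j" using that False ju(2) col_nz_props(2)[OF v] by (auto simp: W_def)
      moreover have "\<not> (j' = j \<and> u = v)" using ju(3) rho unfolding res'[OF ju(2)] by (auto simp: push_def)
      ultimately have "rho < \<bar>res s j' u\<bar>" using ju(3) unfolding res'[OF ju(2)] by (auto simp: push_def split: if_splits)
      then obtain k where k: "k < Suc m0" "na s ''I'' k = u" "na s ''J'' k = j' * n" using cov ju by blast
      have "k \<noteq> m0" using k j n0 \<open>\<not> (j' = j \<and> u = v)\<close> by (auto simp: v_def)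
      then show ?thesis using k s'(3,4) m1 by (intro exI[of _ k]) (auto simp: s1_def)
    qed
    have lin: "rv s' ''a'' + lin_pot (res s') = target"
      using pots(1) s'(2) i by (simp add: s1_def res1[unfolded s1_def])
    have ab: "abs_pot (res s') \<le> t1 * real Lam * beta" using pots(2) i by linarith
    have cs: "real (time s') + 20 * real (nv s' ''m'') + 58 / (c * rho) * cost_pot (res s') \<le> push_time T"
    proof -
      let ?D = "58 / (c * rho)"
      have "c * real (length ?xs) \<le> 2 * d v" using c entries v by (rule col_nz_length)
      then have 1: "29 * real (length ?xs) \<le> 58 * d v / c" using c by (simp add: field_simps)
      have "?D * (rho * d v) \<le> ?D * (\<bar>x\<bar> * d v)"
        using c0 jx(2) d_pos[OF v] by (intro mult_left_mono mult_right_mono) auto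
      also have "\<dots> \<le> ?D * (cost_pot (res s) - cost_pot (res s'))"
        using c0 pots(3) by (intro mult_left_mono) (auto simp: x_def)
      also have "?D * (rho * d v) = 58 * d v / c" using rho by simp
      finally have "29 * real (length ?xs) + ?D * cost_pot (res s') \<le> ?D * cost_pot (res s)"
        using 1 by (simp add: right_diff_distrib)
      moreover have "real (time s') = real (time s) + 14 + 9 * real (length ?xs)"
        using s'(7) by (simp add: s1_def)
      moreover have "real (nv s' ''m'') = real (nv s ''m'') - 1 + real (length ?xs)"
        using s'(3) m1 m0 by simp
      moreover have "real (time s) + 20 * real (nv s ''m'') + ?D * cost_pot (res s) \<le> push_time T" using i by simp
      ultimately show ?thesis by (simp add: algebra_simps)
    qed
    show "(r = r \<and> push_inv T s') \<and> time s < time s'"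
      using s'(1) stack cover lin ab cs s'(7) by (auto simp: push_inv_def s1_def)
  qed
  have s1_eq: "s\<lparr>nv := (nv s)(''m'' := m0, ''v'' := v, ''o'' := j * n), rv := (rv s)(''h'' := x),
    time := Suc (Suc (Suc (Suc (Suc (Suc (time s))))))\<rparr> = s1" by (simp add: s1_def)
  show ?thesis
    unfolding push_body_def
    apply ((rule bounds_rules; (simp add: upd_defs m0 v_def[symmetric] j(2) R)?)+)
    apply (rule bounds_Cond)
    subgoal
      using go sq i n0 by (simp add: tick_def s1_eq frame_def)
    subgoal
      using skip sq i n0 by (simp add: tick_def s1_eq frame_def)
    done
qed

lemma push_prog_bounds:
  assumes rho: "0 < rho" and s: "measured s" "frame s"
    and post: "\<And>s'. frame s' \<Longrightarrow> rv s' ''a'' + lin_pot (res s') = target \<Longrightarrow>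
       abs_pot (res s') \<le> t1 * real Lam * beta \<Longrightarrow> (\<forall>j<Lam. \<forall>u<n. \<bar>res s' j u\<bar> \<le> rho) \<Longrightarrow>
       real (time s') \<le> push_time (real (time s)) + 1 \<Longrightarrow> K s' r"
  shows "bounds push_prog s K r"
  unfolding push_prog_def zero_def
proof (intro bounds_Seq bounds_RAssign)
  let ?T = "real (time s)"
  let ?s = "tick 1 (set_r ''a'' (rval (OfNat (NConst 0)) s) s)"
  let ?V = "\<lambda>s. nat \<lceil>push_time ?T\<rceil> - time s"
  have le: "time s' \<le> nat \<lceil>push_time ?T\<rceil>" "real (time s') \<le> push_time ?T" if "push_inv ?T s'" for s'
  proof -
    have "0 \<le> 58 / (c * rho) * cost_pot (res s')" using c rho cost_pot_nonneg by simp
    then show 1: "real (time s') \<le> push_time ?T" using that by (simp add: push_inv_def)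
    then show "time s' \<le> nat \<lceil>push_time ?T\<rceil>" by linarith
  qed
  show "bounds (While (NLess (NConst 0) (NVar ''m'')) push_body) ?s K r"
  proof (rule bounds_While[where I = "\<lambda>s' r'. r' = r \<and> push_inv ?T s'" and V = ?V])
    have sc: "scanned s" using s(1) by (simp add: measured_def)
    note sc' = sc[unfolded scanned_def]
    have r0: "res ?s 0 u = h u" if "u < n" for u using sc' that by (simp add: res_def upd_defs)
    have r1: "res ?s j u = 0" if "u < n" "0 < j" for j u
    proof -
      have "n \<le> j * n + u" using that(2) by (cases j) auto
      then show ?thesis using sc' by (simp add: res_def upd_defs)
    qed
    note ini = initial_pots[of "res ?s", OF r0 r1]
    have "frame ?s" using s(2) by (simp add: frame_def params_def upd_defs)
    moreover have "\<forall>i<nv ?s ''m''. na ?s ''I'' i < n \<and> (\<exists>j\<le>Lam. na ?s ''J'' i = j * n)"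
      using sc' by (auto simp: upd_defs intro!: exI[of _ 0])
    moreover have "\<forall>j<Lam. \<forall>u<n. rho < \<bar>res ?s j u\<bar> \<longrightarrow> (\<exists>i<nv ?s ''m''. na ?s ''I'' i = u \<and> na ?s ''J'' i = j * n)"
    proof (intro allI impI)
      fix j u assume a: "j < Lam" "u < n" "rho < \<bar>res ?s j u\<bar>"
      have j: "j = 0" using a r1[of u j] rho by (cases j) auto
      then have "h u \<noteq> 0" using a r0[of u] rho by auto
      then obtain i where "i < l0_norm b" "na s ''I'' i = u" using sc' a(2) by blast
      then show "\<exists>i<nv ?s ''m''. na ?s ''I'' i = u \<and> na ?s ''J'' i = j * n"
        using sc' j by (intro exI[of _ i]) (auto simp: upd_defs)
    qed
    moreover have "rv ?s ''a'' = 0" "nv ?s ''m'' = l0_norm b" "time ?s = time s + 1"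
      using sc' by (auto simp: upd_defs)
    ultimately show "r = r \<and> push_inv ?T ?s"
      unfolding push_inv_def push_time_def using ini by simp
  next
    fix s1 r' assume I: "r' = r \<and> push_inv ?T s1" and g: "bval (NLess (NConst 0) (NVar ''m'')) s1"
    have "bounds push_body (tick 1 s1) (\<lambda>s' r'. (r' = r \<and> push_inv ?T s') \<and> time s1 < time s') r'"
      using push_body_bounds[OF rho, of ?T s1 r] I g by simp
    then show "bounds push_body (tick 1 s1) (\<lambda>s' r'. (r' = r \<and> push_inv ?T s') \<and> ?V s' < ?V s1) r'"
    proof (rule bounds_mono)
      fix s' ra assume a: "(ra = r \<and> push_inv ?T s') \<and> time s1 < time s'"
      then show "(ra = r \<and> push_inv ?T s') \<and> ?V s' < ?V s1" using le(1)[of s'] by auto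
    qed simp
  next
    fix s1 r' assume I: "r' = r \<and> push_inv ?T s1" and g: "\<not> bval (NLess (NConst 0) (NVar ''m'')) s1"
    have m: "nv s1 ''m'' = 0" using g by simp
    have e: "res (tick 1 s1) = res s1" by (simp add: res_def tick_def fun_eq_iff)
    have "K (tick 1 s1) r"
    proof (rule post)
      show "frame (tick 1 s1)" using I by (simp add: push_inv_def frame_def params_def tick_def)
      \<comment> \<open>On an empty stack, coverage means that no residual exceeds the
        threshold.\<close>
      show "\<forall>j<Lam. \<forall>u<n. \<bar>res (tick 1 s1) j u\<bar> \<le> rho"
        using I m unfolding e push_inv_def by (auto simp: not_less[symmetric])
      show "rv (tick 1 s1) ''a'' + lin_pot (res (tick 1 s1)) = target"
        "abs_pot (res (tick 1 s1)) \<le> t1 * real Lam * beta"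
        using I unfolding e by (simp_all add: push_inv_def tick_def)
      show "real (time (tick 1 s1)) \<le> push_time ?T + 1" using I le(2)[of s1] by (simp add: tick_def)
    qed
    then show "K (tick 1 s1) r'" using I by simp
  qed
qed

end

section \<open>Sampling signed walks\<close>

text \<open>The sign \<open>g\<close> of a terminated walk is set to 0. If no walk is made, the division of \<open>S\<close> by \<open>K = 0\<close> yields 0.\<close>

definition walk_body :: com where
  "walk_body =
    Seq (WalkStep ''v'' ''y'' ''z'' (NVar ''u''))
     (Cond (NLess (NConst 0) (NVar ''z''))
       (Seq (Cond (BAnd (BNot (BAnd (BNot (NLess (NVar ''u'') (NVar ''v''))) (BNot (NLess (NVar ''v'') (NVar ''u'')))))
                   (RLess zero (RVar ''y'')))
              (RAssign ''g'' (RMinus zero (RVar ''g''))) (RAssign ''g'' (RVar ''g'')))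
       (Seq (NAssign ''u'' (NVar ''v''))
            (NAssign ''k'' (NMinus (NVar ''k'') (NConst 1)))))
       (Seq (RAssign ''g'' zero) (NAssign ''k'' (NConst 0))))"

definition walk_prog :: com where
  "walk_prog = Cond (NLess (NPlus (NVar ''i'') (NVar ''j'')) (NVar ''L''))
     (Seq (NAssign ''k'' (NVar ''i'')) (While (NLess (NConst 0) (NVar ''k'')) walk_body))
     (RAssign ''g'' zero)"

definition sample_body :: com where
  "sample_body =
    Seq (SampleT ''u'')
   (Seq (GetT ''x'' (NVar ''u''))
   (Seq (Cond (RLess (RVar ''x'') zero) (RAssign ''g'' (RMinus zero (OfNat (NConst 1)))) (RAssign ''g'' (OfNat (NConst 1))))
   (Seq (Uniform ''i'' (NVar ''L''))
   (Seq (Uniform ''j'' (NVar ''L''))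
   (Seq walk_prog
   (Seq (RAssign ''S'' (RPlus (RVar ''S'') (RTimes (RTimes (RVar ''t1'') (RTimes Lr Lr))
          (RTimes (RVar ''g'') (RArr ''R'' (NPlus (NArr ''A'' (NVar ''j'')) (NVar ''u'')))))))
        (NAssign ''K'' (NPlus (NVar ''K'') (NConst 1)))))))))"

definition sample_prog :: com where
  "sample_prog =
    Seq (RAssign ''S'' zero)
   (Seq (NAssign ''K'' (NConst 0))
   (Seq (While (RLess (OfNat (NVar ''K'')) (RVar ''N'')) sample_body)
        (RAssign ''out'' (RDiv (RPlus (RVar ''a'') (RDiv (RVar ''S'') (OfNat (NVar ''K'')))) (OfNat (NConst 2))))))"

section \<open>Distributions of the start vertex and of a walk step\<close>

lemma pmf_embed_finite:
  assumes "finite A" "\<And>x. 0 \<le> f x" "\<And>x. x \<notin> A \<Longrightarrow> f x = 0" "sum f A = (1::real)"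
  shows "pmf (embed_pmf f) x = f x"
proof (rule pmf_embed_pmf)
  have "(\<integral>\<^sup>+x. ennreal (f x) \<partial>count_space UNIV) = (\<Sum>x\<in>A. ennreal (f x))"
    using assms(1,3) by (intro nn_integral_count_space') auto
  then show "(\<integral>\<^sup>+x. ennreal (f x) \<partial>count_space UNIV) = 1"
    using assms(2,4) by (simp add: sum_ennreal)
qed (rule assms(2))

context rcdd_system
begin

lemma pmf_abs_pmf: "pmf (abs_pmf t) i = (if i < n then \<bar>vec_index t i\<bar> / t1 else 0)"
proof -
  have l: "lp_norm 1 t = t1" by (simp add: lp_norm_1 t1_def)
  have "(\<Sum>i<n. if i < n then \<bar>vec_index t i\<bar> / t1 else 0) = (\<Sum>i<n. \<bar>vec_index t i\<bar>) / t1"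
    unfolding sum_divide_distrib by (intro sum.cong) auto
  then have "(\<Sum>i<n. if i < n then \<bar>vec_index t i\<bar> / t1 else 0) = 1"
    using t1_pos by (simp add: t1_def[symmetric])
  then show ?thesis unfolding abs_pmf_def l dims
    using t1_pos by (intro pmf_embed_finite[of "{..<n}"]) (auto simp: less_imp_le)
qed

lemma bounds_SampleT:
  assumes "\<And>i. i < n \<Longrightarrow> K (tick 1 (set_n x i s)) (g i)"
    and "(\<Sum>i<n. \<bar>vec_index t i\<bar> * g i) / t1 \<le> r"
  shows "bounds (SampleT x) s K r"
proof (rule bounds_sample[where f = "\<lambda>i. tick 1 (set_n x i s)" and p = "abs_pmf t" and g = g])
  have sub: "set_pmf (abs_pmf t) \<subseteq> {..<n}" by (auto simp: set_pmf_iff pmf_abs_pmf split: if_splits)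
  show "finite (set_pmf (abs_pmf t))" by (rule finite_subset[OF sub]) simp
  show "K (tick 1 (set_n x i s)) (g i)" if "i \<in> set_pmf (abs_pmf t)" for i
    using assms(1) sub that by auto
  have "measure_pmf.expectation (abs_pmf t) g = (\<Sum>i<n. pmf (abs_pmf t) i * g i)"
    using sub by (subst integral_measure_pmf[of "{..<n}"]) auto
  also have "\<dots> = (\<Sum>i<n. \<bar>vec_index t i\<bar> * g i) / t1"
    unfolding sum_divide_distrib by (intro sum.cong) (auto simp: pmf_abs_pmf)
  finally show "measure_pmf.expectation (abs_pmf t) g \<le> r" using assms(2) by simp
qed simp

lemma pmf_walk_pmf:
  assumes "u < n"
  shows "pmf (walk_pmf M u) w = (case w of Some v \<Rightarrow> if v < n then P u v else 0 | None \<Rightarrow> 1 - (\<Sum>v<n. P u v))"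
proof -
  let ?f = "\<lambda>w. case w of Some v \<Rightarrow> if v < n then P u v else 0 | None \<Rightarrow> 1 - (\<Sum>v<n. P u v)"
  have "walk_pmf M u = embed_pmf ?f"
    unfolding walk_pmf_def dims
    by (rule arg_cong[where f = embed_pmf]) (auto simp: fun_eq_iff walk_prob_eq[OF assms] split: option.splits)
  moreover have "pmf (embed_pmf ?f) w = ?f w"
  proof (rule pmf_embed_finite[of "insert None (Some ` {..<n})"])
    show "sum ?f (insert None (Some ` {..<n})) = 1"
      by (subst sum.insert) (auto simp: sum.reindex intro!: sum.cong)
  qed (use P_row[OF assms] in \<open>auto split: option.splits\<close>)
  ultimately show ?thesis by simp
qed

lemma bounds_WalkStep:
  assumes u: "nval e s < n"
    and step: "\<And>v. v < n \<Longrightarrow> K (tick (step_time acc (nval e s)) (set_n z 1 (set_n x v (set_r y (M $$ (nval e s, v)) s)))) (g v)"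
    and halt: "K (tick (step_time acc (nval e s)) (set_n z 0 s)) g0"
    and le: "(\<Sum>v<n. P (nval e s) v * g v) + (1 - (\<Sum>v<n. P (nval e s) v)) * g0 \<le> r"
  shows "bounds (WalkStep x y z e) s K r"
proof -
  define u where "u = nval e s"
  have u': "u < n" using u by (simp add: u_def)
  let ?h = "\<lambda>w. tick (step_time acc u) (case w of None \<Rightarrow> set_n z 0 s
          | Some v \<Rightarrow> set_n z 1 (set_n x v (set_r y (M $$ (u, v)) s)))"
  let ?g = "\<lambda>w. case w of None \<Rightarrow> g0 | Some v \<Rightarrow> g v"
  let ?A = "insert None (Some ` {..<n})"
  have sub: "set_pmf (walk_pmf M u) \<subseteq> ?A"
    using u' by (auto simp: set_pmf_iff pmf_walk_pmf split: option.splits if_splits)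
  show ?thesis
  proof (rule bounds_sample[where f = ?h and p = "walk_pmf M u" and g = ?g])
    show "exec M b t acc d (WalkStep x y z e) s = map_spmf ?h (spmf_of_pmf (walk_pmf M u))" for d
      unfolding u_def using u by (simp add: Let_def)
    show "finite (set_pmf (walk_pmf M u))" by (rule finite_subset[OF sub]) simp
    show "K (?h w) (?g w)" if "w \<in> set_pmf (walk_pmf M u)" for w
      using that sub step halt by (cases w) (auto simp: u_def)
    have "measure_pmf.expectation (walk_pmf M u) ?g = (\<Sum>w\<in>?A. pmf (walk_pmf M u) w * ?g w)"
      using sub by (subst integral_measure_pmf[of ?A]) auto
    also have "\<dots> = (1 - (\<Sum>v<n. P u v)) * g0 + (\<Sum>w\<in>Some ` {..<n}. pmf (walk_pmf M u) w * ?g w)"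
      using u' by (subst sum.insert) (auto simp: pmf_walk_pmf)
    also have "(\<Sum>w\<in>Some ` {..<n}. pmf (walk_pmf M u) w * ?g w) = (\<Sum>v<n. P u v * g v)"
      using u' by (auto simp: sum.reindex pmf_walk_pmf intro!: sum.cong)
    finally show "measure_pmf.expectation (walk_pmf M u) ?g \<le> r" using le by (simp add: u_def)
  qed
qed

end

context rcdd_instance
begin

lemma frame_cong:
  assumes "frame s" "nv s' ''n'' = nv s ''n''" "nv s' ''L'' = nv s ''L''" "nv s' ''O'' = nv s ''O''"
    "na s' ''A'' = na s ''A''" "rv s' ''eps'' = rv s ''eps''" "rv s' ''gamma'' = rv s ''gamma''"
    "rv s' ''t1'' = rv s ''t1''" "rv s' ''frow'' = rv s ''frow''" "rv s' ''B'' = rv s ''B''"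
    "rv s' ''p'' = rv s ''p''" "rv s' ''N'' = rv s ''N''"
  shows "frame s'"
  using assms by (simp add: frame_def params_def)

lemma step_time_le: "u < n \<Longrightarrow> step_time acc u \<le> f"
  unfolding f_def f_row_def by (intro Max_ge) auto

lemma f_pos: "1 \<le> f"
proof -
  have "0 < n" using b_nz b by (cases n) auto
  then have "1 \<le> step_time acc 0" using acc by (auto simp: valid_access_def)
  then show ?thesis using step_time_le[OF \<open>0 < n\<close>] by linarith
qed

text \<open>Off the diagonal \<open>W\<close> and \<open>M\<close> have opposite signs. Flipping the
  sign on positive entries therefore makes a step with probabilities \<open>P\<close> average to the
  action of \<open>W\<close>.\<close>

lemma P_sign:
  assumes "u < n" "v < n"
  shows "P u v * (if u \<noteq> v \<and> 0 < M $$ (u, v) then - g else g) = W u v * g"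
  using d_pos[OF assms(1)] by (auto simp: W_def abs_if not_less zero_less_divide_iff divide_less_0_iff)

text \<open>A quadratic polynomial in the outcome \<open>g q(u)\<close> covers mean and second moment at once.\<close>

lemma walk_loop_bounds:
  fixes A0 B0 C0 :: real and q :: "nat \<Rightarrow> real"
  assumes inv0: "Inv s0"
    and Inv: "\<And>s s'. Inv s \<Longrightarrow> frame s' \<Longrightarrow> ra s' = ra s \<Longrightarrow> rv s' ''a'' = rv s ''a'' \<Longrightarrow> rv s' ''S'' = rv s ''S'' \<Longrightarrow>
        nv s' ''K'' = nv s ''K'' \<Longrightarrow> nv s' ''j'' = nv s ''j'' \<Longrightarrow> Inv s'"
    and fr: "\<And>s. Inv s \<Longrightarrow> frame s"
    and u0: "nv s0 ''u'' < n"
    and r0: "A0 + B0 * (rv s0 ''g'' * (mv n W ^^ nv s0 ''k'') q (nv s0 ''u''))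
      + C0 * ((rv s0 ''g'')\<^sup>2 * (mv n P ^^ nv s0 ''k'') (\<lambda>w. (q w)\<^sup>2) (nv s0 ''u'')) \<le> r0"
    and post: "\<And>s r. Inv s \<Longrightarrow> nv s ''u'' < n \<Longrightarrow>
       A0 + B0 * (rv s ''g'' * q (nv s ''u'')) + C0 * (rv s ''g'' * q (nv s ''u''))\<^sup>2 \<le> r \<Longrightarrow>
       time s \<le> time s0 + nv s0 ''k'' * (f + 6) + 1 \<Longrightarrow> K s r"
  shows "bounds (While (NLess (NConst 0) (NVar ''k'')) walk_body) s0 K r0"
proof -
  \<comment> \<open>Expected final value of the polynomial for a walk at \<open>u\<close> with sign
    \<open>g\<close> and \<open>k\<close> steps to go. Squaring removes the signs, so the quadratic
    term evolves by \<open>P\<close> instead of \<open>W\<close>.\<close>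
  define val where "val g k u = A0 + B0 * (g * (mv n W ^^ k) q u) + C0 * (g\<^sup>2 * (mv n P ^^ k) (\<lambda>w. (q w)\<^sup>2) u)" for g k u
  define T where "T = time s0 + nv s0 ''k'' * (f + 6)"
  let ?I = "\<lambda>s r. Inv s \<and> nv s ''u'' < n \<and> val (rv s ''g'') (nv s ''k'') (nv s ''u'') \<le> r \<and>
     time s + nv s ''k'' * (f + 6) \<le> T"
  show ?thesis
  proof (rule bounds_While[where I = ?I and V = "\<lambda>s. nv s ''k''"])
    show "?I s0 r0" using inv0 u0 r0 by (simp add: val_def T_def)
  next
    fix s r assume I: "?I s r" and "bval (NLess (NConst 0) (NVar ''k'')) s"
    then obtain k where k: "nv s ''k'' = Suc k" by (cases "nv s ''k''") auto
    define u where "u = nv s ''u''"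
    have u: "u < n" using I by (simp add: u_def)
    define g where "g = rv s ''g''"
    define gg where "gg v = (if u \<noteq> v \<and> 0 < M $$ (u, v) then - g else g)" for v
    note p = fr[of s, unfolded frame_def params_def]
    have tm: "time s + step_time acc u + 6 + k * (f + 6) \<le> T"
      using I step_time_le[OF u] by (simp add: k)
    have gg2: "(gg v)\<^sup>2 = g\<^sup>2" for v by (simp add: gg_def)
    \<comment> \<open>Martingale identity for one step. Termination takes the mass missing in row
      \<open>u\<close>; its sign 0 leaves the value \<open>A0\<close>.\<close>
    have avg: "(\<Sum>v<n. P u v * val (gg v) k v) + (1 - (\<Sum>v<n. P u v)) * A0 = val g (Suc k) u"
    proof -
      have "(\<Sum>v<n. P u v * val (gg v) k v) = (\<Sum>v<n. P u v * A0 + B0 * g * (W u v * (mv n W ^^ k) q v)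
          + C0 * g\<^sup>2 * (P u v * (mv n P ^^ k) (\<lambda>w. (q w)\<^sup>2) v))"
      proof (rule sum.cong[OF refl])
        fix v assume "v \<in> {..<n}"
        then have v: "v < n" by simp
        have ps: "P u v * gg v = W u v * g" unfolding gg_def by (rule P_sign[OF u v])
        have "P u v * (B0 * (gg v * (mv n W ^^ k) q v)) = B0 * ((P u v * gg v) * (mv n W ^^ k) q v)"
          by (simp add: mult_ac)
        also have "\<dots> = B0 * g * (W u v * (mv n W ^^ k) q v)" unfolding ps by (simp add: mult_ac)
        finally have "P u v * (B0 * (gg v * (mv n W ^^ k) q v)) = B0 * g * (W u v * (mv n W ^^ k) q v)" .
        then show "P u v * val (gg v) k v = P u v * A0 + B0 * g * (W u v * (mv n W ^^ k) q v)
          + C0 * g\<^sup>2 * (P u v * (mv n P ^^ k) (\<lambda>w. (q w)\<^sup>2) v)"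
          unfolding val_def gg2 by (simp add: distrib_left mult_ac)
      qed
      also have "\<dots> = (\<Sum>v<n. P u v) * A0 + B0 * g * (mv n W ^^ Suc k) q u
         + C0 * g\<^sup>2 * (mv n P ^^ Suc k) (\<lambda>w. (q w)\<^sup>2) u"
        by (simp add: sum.distrib sum_distrib_left[symmetric] sum_distrib_right[symmetric]
            mv_def[of n W "(mv n W ^^ k) q"] mv_def[of n P "(mv n P ^^ k) (\<lambda>w. (q w)\<^sup>2)"])
      finally show ?thesis by (simp add: val_def algebra_simps)
    qed
    show "bounds walk_body (tick 1 s) (\<lambda>s' r'. ?I s' r' \<and> nv s' ''k'' < nv s ''k'') r"
      unfolding walk_body_def zero_def
    proof (rule bounds_Seq, rule bounds_WalkStep[where g = "\<lambda>v. val (gg v) k v" and ?g0.0 = A0])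
      show "nval (NVar ''u'') (tick 1 s) < n" using u by (simp add: tick_def u_def)
      show "(\<Sum>v<n. P (nval (NVar ''u'') (tick 1 s)) v * val (gg v) k v)
         + (1 - (\<Sum>v<n. P (nval (NVar ''u'') (tick 1 s)) v)) * A0 \<le> r"
        using avg I by (simp add: tick_def u_def[symmetric] k g_def)
      show "bounds (Cond (NLess (NConst 0) (NVar ''z''))
         (Seq (Cond (BAnd (BNot (BAnd (BNot (NLess (NVar ''u'') (NVar ''v''))) (BNot (NLess (NVar ''v'') (NVar ''u'')))))
                   (RLess (OfNat (NConst 0)) (RVar ''y'')))
              (RAssign ''g'' (RMinus (OfNat (NConst 0)) (RVar ''g''))) (RAssign ''g'' (RVar ''g'')))
         (Seq (NAssign ''u'' (NVar ''v'')) (NAssign ''k'' (NMinus (NVar ''k'') (NConst 1)))))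
         (Seq (RAssign ''g'' (OfNat (NConst 0))) (NAssign ''k'' (NConst 0))))
         (tick (step_time acc (nval (NVar ''u'') (tick 1 s))) (set_n ''z'' 1 (set_n ''v'' v
            (set_r ''y'' (M $$ (nval (NVar ''u'') (tick 1 s), v)) (tick 1 s)))))
         (\<lambda>s' r'. ?I s' r' \<and> nv s' ''k'' < nv s ''k'') (val (gg v) k v)" if v: "v < n" for v
      proof -
        have e: "(if (u < v \<or> v < u) \<and> 0 < M $$ (u, v) then - g else g) = gg v" by (auto simp: gg_def)
        show ?thesis
          apply (rule bounds_Cond)
           apply ((rule bounds_rules; (simp add: upd_defs u_def[symmetric] k g_def[symmetric] e cong: if_cong split del: if_split)?)+)
          subgoal
            using I v tm by (auto intro!: Inv[of s] frame_cong[OF fr[of s]])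
          subgoal by (simp add: upd_defs)
          done
      qed
      show "bounds (Cond (NLess (NConst 0) (NVar ''z''))
         (Seq (Cond (BAnd (BNot (BAnd (BNot (NLess (NVar ''u'') (NVar ''v''))) (BNot (NLess (NVar ''v'') (NVar ''u'')))))
                   (RLess (OfNat (NConst 0)) (RVar ''y'')))
              (RAssign ''g'' (RMinus (OfNat (NConst 0)) (RVar ''g''))) (RAssign ''g'' (RVar ''g'')))
         (Seq (NAssign ''u'' (NVar ''v'')) (NAssign ''k'' (NMinus (NVar ''k'') (NConst 1)))))
         (Seq (RAssign ''g'' (OfNat (NConst 0))) (NAssign ''k'' (NConst 0))))
         (tick (step_time acc (nval (NVar ''u'') (tick 1 s))) (set_n ''z'' 0 (tick 1 s)))
         (\<lambda>s' r'. ?I s' r' \<and> nv s' ''k'' < nv s ''k'') A0"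
          apply (rule bounds_Cond)
         apply (simp add: upd_defs)
        apply ((rule bounds_rules; (simp add: upd_defs u_def[symmetric] k g_def[symmetric] split del: if_split)?)+)
        using I tm u by (auto intro!: Inv[of s] frame_cong[OF fr[of s]] simp: val_def u_def)
    qed
  next
    fix s r assume I: "?I s r" and "\<not> bval (NLess (NConst 0) (NVar ''k'')) s"
    then have k: "nv s ''k'' = 0" by simp
    have "Inv (tick 1 s)" using I by (auto intro!: Inv[of s] frame_cong[OF fr[of s]] simp: tick_def)
    then show "K (tick 1 s) r"
      using I k by (intro post) (auto simp: tick_def val_def T_def power_mult_distrib)
  qed
qed

lemma walk_prog_bounds:
  fixes A0 B0 C0 :: real
  assumes fr: "frame s" and u: "nv s ''u'' < n" and i: "nv s ''i'' < Lam"
    and r: "A0 + (if nv s ''i'' + nv s ''j'' < Lam then B0 * (rv s ''g'' * (mv n W ^^ nv s ''i'') q (nv s ''u''))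
      + C0 * ((rv s ''g'')\<^sup>2 * (mv n P ^^ nv s ''i'') (\<lambda>w. (q w)\<^sup>2) (nv s ''u'')) else 0) \<le> r"
    and post: "\<And>s' r'. frame s' \<Longrightarrow> ra s' = ra s \<Longrightarrow> rv s' ''a'' = rv s ''a'' \<Longrightarrow> rv s' ''S'' = rv s ''S'' \<Longrightarrow>
       nv s' ''K'' = nv s ''K'' \<Longrightarrow> nv s' ''j'' = nv s ''j'' \<Longrightarrow> nv s' ''u'' < n \<Longrightarrow>
       A0 + B0 * (rv s' ''g'' * q (nv s' ''u'')) + C0 * (rv s' ''g'' * q (nv s' ''u''))\<^sup>2 \<le> r' \<Longrightarrow>
       time s' \<le> time s + 3 + Lam * (f + 6) \<Longrightarrow> K s' r'"
  shows "bounds walk_prog s K r"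
  unfolding walk_prog_def zero_def
proof (rule bounds_Cond)
  have L: "nv s ''L'' = Lam" using fr by (simp add: frame_def)
  let ?c = "NLess (NPlus (NVar ''i'') (NVar ''j'')) (NVar ''L'')"
  assume c: "bval ?c s"
  let ?Inv = "\<lambda>s'. frame s' \<and> ra s' = ra s \<and> rv s' ''a'' = rv s ''a'' \<and> rv s' ''S'' = rv s ''S'' \<and>
     nv s' ''K'' = nv s ''K'' \<and> nv s' ''j'' = nv s ''j''"
  let ?s = "tick 1 (set_n ''k'' (nval (NVar ''i'') (tick 1 s)) (tick 1 s))"
  show "bounds (Seq (NAssign ''k'' (NVar ''i'')) (While (NLess (NConst 0) (NVar ''k'')) walk_body)) (tick 1 s) K r"
  proof (rule bounds_Seq, rule bounds_NAssign, rule walk_loop_bounds[where Inv = ?Inv and q = q])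
    show "?Inv ?s" using fr by (auto intro!: frame_cong[OF fr] simp: upd_defs)
    show "nv ?s ''u'' < n" using u by (simp add: upd_defs)
    show "A0 + B0 * (rv ?s ''g'' * (mv n W ^^ nv ?s ''k'') q (nv ?s ''u''))
      + C0 * ((rv ?s ''g'')\<^sup>2 * (mv n P ^^ nv ?s ''k'') (\<lambda>w. (q w)\<^sup>2) (nv ?s ''u'')) \<le> r"
      using r c L by (simp add: upd_defs)
    fix s' r' assume s': "?Inv s'" "nv s' ''u'' < n"
      "A0 + B0 * (rv s' ''g'' * q (nv s' ''u'')) + C0 * (rv s' ''g'' * q (nv s' ''u''))\<^sup>2 \<le> r'"
      "time s' \<le> time ?s + nv ?s ''k'' * (f + 6) + 1"
    have "nv s ''i'' * (f + 6) \<le> Lam * (f + 6)" using i by (intro mult_right_mono) auto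
    moreover have "time s' \<le> time s + 3 + nv s ''i'' * (f + 6)" using s'(4) by (simp add: upd_defs)
    ultimately have "time s' \<le> time s + 3 + Lam * (f + 6)" by linarith
    then show "K s' r'" using s' by (intro post) auto
  qed auto
next
  have L: "nv s ''L'' = Lam" using fr by (simp add: frame_def)
  assume c: "\<not> bval (NLess (NPlus (NVar ''i'') (NVar ''j'')) (NVar ''L'')) s"
  show "bounds (RAssign ''g'' (OfNat (NConst 0))) (tick 1 s) K r"
    using r c L u by (intro bounds_RAssign post) (auto intro!: frame_cong[OF fr] simp: upd_defs)
qed

section \<open>Mean and second moment of the walk estimator\<close>

definition sq_pot :: "(nat \<Rightarrow> nat \<Rightarrow> real) \<Rightarrow> real" where
  "sq_pot r = pot n Lam (vm_sum n P (\<lambda>u. \<bar>vec_index t u\<bar>)) (\<lambda>j u. (r j u)\<^sup>2)"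

definition sg :: "nat \<Rightarrow> real" where "sg u = (if vec_index t u < 0 then -1 else 1)"

text \<open>The start vertex contributes 1/\<open>t1\<close>, and the uniform pair
  \<open>(i, j)\<close> contributes 1/\<Lambda>^2. The absolute value of \<open>t\<close> times its
  sign restores \<open>t\<close> in the linear term, so \<open>pot_vm_sum\<close> identifies both
  sums.\<close>

lemma sample_average:
  fixes A0 B0 C0 :: real and r :: "nat \<Rightarrow> nat \<Rightarrow> real"
  assumes L: "0 < Lam"
  defines "cc \<equiv> \<lambda>u i j. A0 + (if i + j < Lam then B0 * (sg u * (mv n W ^^ i) (r j) u)
      + C0 * ((sg u)\<^sup>2 * (mv n P ^^ i) (\<lambda>w. (r j w)\<^sup>2) u) else 0)"
  shows "(\<Sum>u<n. \<bar>vec_index t u\<bar> * ((\<Sum>i<Lam. (\<Sum>j<Lam. cc u i j) / real Lam) / real Lam)) / t1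
    = A0 + (B0 * lin_pot r + C0 * sq_pot r) / (t1 * (real Lam * real Lam))"
proof -
  let ?w = "\<lambda>i j u. (mv n W ^^ i) (r j) u" and ?p = "\<lambda>i j u. (mv n P ^^ i) (\<lambda>w. (r j w)\<^sup>2) u"
  have sg: "\<bar>vec_index t u\<bar> * sg u = vec_index t u" "(sg u)\<^sup>2 = 1" for u by (auto simp: sg_def)
  have one: "(\<Sum>u<n. \<bar>vec_index t u\<bar> * cc u i j) = t1 * A0 + (B0 * (if i + j < Lam then \<Sum>u<n. vec_index t u * ?w i j u else 0)
      + C0 * (if i + j < Lam then \<Sum>u<n. \<bar>vec_index t u\<bar> * ?p i j u else 0))" for i j
  proof -
    have "\<bar>vec_index t u\<bar> * cc u i j = \<bar>vec_index t u\<bar> * A0 + (if i + j < Lam then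
        B0 * ((\<bar>vec_index t u\<bar> * sg u) * ?w i j u) + C0 * (\<bar>vec_index t u\<bar> * ?p i j u) else 0)" for u
      unfolding cc_def sg(2) by (simp add: distrib_left mult_ac)
    then show ?thesis unfolding sg(1)
      by (simp add: sum.distrib sum_distrib_left[symmetric] sum_distrib_right[symmetric] t1_def)
  qed
  have "(\<Sum>u<n. \<bar>vec_index t u\<bar> * ((\<Sum>i<Lam. (\<Sum>j<Lam. cc u i j) / real Lam) / real Lam))
    = (\<Sum>u<n. \<Sum>i<Lam. \<Sum>j<Lam. \<bar>vec_index t u\<bar> * cc u i j) / (real Lam * real Lam)"
    by (simp add: sum_divide_distrib sum_distrib_left)
  also have "(\<Sum>u<n. \<Sum>i<Lam. \<Sum>j<Lam. \<bar>vec_index t u\<bar> * cc u i j)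
    = (\<Sum>i<Lam. \<Sum>j<Lam. \<Sum>u<n. \<bar>vec_index t u\<bar> * cc u i j)"
    by (subst sum.swap) (intro sum.cong refl sum.swap)
  also have "\<dots> = real Lam * real Lam * (t1 * A0) + (B0 * lin_pot r + C0 * sq_pot r)"
    unfolding one lin_pot_def sq_pot_def pot_vm_sum
    by (simp add: sum.distrib sum_distrib_left[symmetric])
  finally show ?thesis using L t1_pos by (simp add: field_simps)
qed

text \<open>\<open>Y\<close> is the centred sum so far, \<open>D\<close> the variance reserved for
  later walks, \<open>Z\<close> a normalisation. One more unbiased sample raises the mean square by
  at most its second moment.\<close>

lemma sample_body_bounds:
  fixes Y D Z :: real
  assumes fr: "frame s" and L: "0 < Lam" and Z: "0 < Z"
    and r: "(Y\<^sup>2 + t1 * (real Lam * real Lam) * sq_pot (res s) + D) / Z \<le> r"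
    and post: "\<And>s' r'. frame s' \<Longrightarrow> ra s' = ra s \<Longrightarrow> rv s' ''a'' = rv s ''a'' \<Longrightarrow>
       nv s' ''K'' = Suc (nv s ''K'') \<Longrightarrow> ((Y + (rv s' ''S'' - rv s ''S'') - lin_pot (res s))\<^sup>2 + D) / Z \<le> r' \<Longrightarrow>
       time s' \<le> time s + 11 + Lam * (f + 6) \<Longrightarrow> K s' r'"
  shows "bounds sample_body s K r"
proof -
  define \<mu> where "\<mu> = lin_pot (res s)"
  define \<tau> where "\<tau> = t1 * (real Lam * real Lam)"
  have \<tau>: "0 < \<tau>" using t1_pos L by (simp add: \<tau>_def)
  \<comment> \<open>Coefficients of the squared deviation as a polynomial in the signed residual met
    by the walk.\<close>
  define A0 where "A0 = ((Y - \<mu>)\<^sup>2 + D) / Z"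
  define B0 where "B0 = 2 * (Y - \<mu>) * \<tau> / Z"
  define C0 where "C0 = \<tau>\<^sup>2 / Z"
  define cc where "cc u i j = A0 + (if i + j < Lam then B0 * (sg u * (mv n W ^^ i) (res s j) u)
      + C0 * ((sg u)\<^sup>2 * (mv n P ^^ i) (\<lambda>w. (res s j w)\<^sup>2) u) else 0)" for u i j
  have quad: "A0 + B0 * x + C0 * x\<^sup>2 = ((Y + \<tau> * x - \<mu>)\<^sup>2 + D) / Z" for x
    using Z by (simp add: A0_def B0_def C0_def field_simps power2_eq_square)
  \<comment> \<open>Unbiasedness cancels the cross terms; only -\<mu>^2 remains besides the second
    moment and is dropped.\<close>
  have "A0 + (B0 * \<mu> + C0 * sq_pot (res s)) / \<tau> = (Y\<^sup>2 - \<mu>\<^sup>2 + \<tau> * sq_pot (res s) + D) / Z"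
    using Z \<tau> by (simp add: A0_def B0_def C0_def field_simps power2_eq_square)
  also have "\<dots> \<le> (Y\<^sup>2 + \<tau> * sq_pot (res s) + D) / Z" using Z by (intro divide_right_mono) auto
  finally have avg: "(\<Sum>u<n. \<bar>vec_index t u\<bar> * ((\<Sum>i<Lam. (\<Sum>j<Lam. cc u i j) / real Lam) / real Lam)) / t1 \<le> r"
    using sample_average[OF L, of A0 B0 "res s" C0] r unfolding cc_def \<tau>_def \<mu>_def by simp
  have p: "nv s ''L'' = Lam" "\<And>j. j < Lam \<Longrightarrow> na s ''A'' j = j * n" "rv s ''t1'' = t1"
    using fr by (auto simp: frame_def params_def)
  let ?tl = "Seq walk_prog
   (Seq (RAssign ''S'' (RPlus (RVar ''S'') (RTimes (RTimes (RVar ''t1'') (RTimes Lr Lr))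
          (RTimes (RVar ''g'') (RArr ''R'' (NPlus (NArr ''A'' (NVar ''j'')) (NVar ''u'')))))))
        (NAssign ''K'' (NPlus (NVar ''K'') (NConst 1))))"
  have tail: "bounds ?tl s1 K (cc u i j)"
    if s1: "frame s1" "nv s1 ''u'' = u" "nv s1 ''i'' = i" "nv s1 ''j'' = j" "rv s1 ''g'' = sg u" "ra s1 = ra s"
      "rv s1 ''a'' = rv s ''a''" "rv s1 ''S'' = rv s ''S''" "nv s1 ''K'' = nv s ''K''" "time s1 = time s + 6"
      and uij: "u < n" "i < Lam" "j < Lam" for s1 u i j
  proof (rule bounds_Seq, rule walk_prog_bounds[OF s1(1), where q = "res s j" and ?A0.0 = A0 and ?B0.0 = B0 and ?C0.0 = C0])
    show "nv s1 ''u'' < n" "nv s1 ''i'' < Lam" using s1 uij by auto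
    show "A0 + (if nv s1 ''i'' + nv s1 ''j'' < Lam then B0 * (rv s1 ''g'' * (mv n W ^^ nv s1 ''i'') (res s j) (nv s1 ''u''))
      + C0 * ((rv s1 ''g'')\<^sup>2 * (mv n P ^^ nv s1 ''i'') (\<lambda>w. (res s j w)\<^sup>2) (nv s1 ''u'')) else 0) \<le> cc u i j"
      unfolding s1 cc_def by simp
    fix s' r' assume s': "frame s'" "ra s' = ra s1" "rv s' ''a'' = rv s1 ''a''" "rv s' ''S'' = rv s1 ''S''"
       "nv s' ''K'' = nv s1 ''K''" "nv s' ''j'' = nv s1 ''j''" "nv s' ''u'' < n"
       "A0 + B0 * (rv s' ''g'' * res s j (nv s' ''u'')) + C0 * (rv s' ''g'' * res s j (nv s' ''u''))\<^sup>2 \<le> r'"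
       "time s' \<le> time s1 + 3 + Lam * (f + 6)"
    have p': "nv s' ''L'' = Lam" "na s' ''A'' j = j * n" "rv s' ''t1'' = t1"
      using s'(1) uij by (auto simp: frame_def params_def)
    have R: "ra s' ''R'' (j * n + nv s' ''u'') = res s j (nv s' ''u'')" using s'(2) s1 by (simp add: res_def)
    show "bounds (Seq (RAssign ''S'' (RPlus (RVar ''S'') (RTimes (RTimes (RVar ''t1'') (RTimes Lr Lr))
          (RTimes (RVar ''g'') (RArr ''R'' (NPlus (NArr ''A'' (NVar ''j'')) (NVar ''u'')))))))
        (NAssign ''K'' (NPlus (NVar ''K'') (NConst 1)))) s' K r'"
      unfolding Lr_def
      apply ((rule bounds_rules; (simp add: upd_defs p' s'(4,5,6) s1 R)?)+)
      apply (rule post)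
      using s' s1 apply (auto intro!: frame_cong[OF s'(1)] simp: quad \<tau>_def \<mu>_def)
      done
  qed
  show ?thesis
    unfolding sample_body_def zero_def
  proof (rule bounds_Seq, rule bounds_SampleT[where g = "\<lambda>u. (\<Sum>i<Lam. (\<Sum>j<Lam. cc u i j) / real Lam) / real Lam", OF _ avg])
    fix u assume u: "u < n"
    have e: "(if vec_index t u < 0 then - 1 else 1) = sg u" by (simp add: sg_def)
    show "bounds (Seq (GetT ''x'' (NVar ''u''))
   (Seq (Cond (RLess (RVar ''x'') (OfNat (NConst 0))) (RAssign ''g'' (RMinus (OfNat (NConst 0)) (OfNat (NConst 1)))) (RAssign ''g'' (OfNat (NConst 1))))
   (Seq (Uniform ''i'' (NVar ''L'')) (Seq (Uniform ''j'' (NVar ''L'')) ?tl))))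
      (tick 1 (set_n ''u'' u s)) K ((\<Sum>i<Lam. (\<Sum>j<Lam. cc u i j) / real Lam) / real Lam)"
      apply (rule bounds_Seq, rule bounds_GetT, rule bounds_Seq, rule bounds_Cond_RAssign)
      apply (simp add: upd_defs u e cong: if_cong split del: if_split del: One_nat_def)
      apply (rule bounds_Seq, rule bounds_Uniform[where g = "\<lambda>i. (\<Sum>j<Lam. cc u i j) / real Lam"])
      subgoal for i
        apply (rule bounds_Seq, rule bounds_Uniform[where g = "\<lambda>j. cc u i j"])
        subgoal for j
          apply (rule tail)
          using u p apply (auto intro!: frame_cong[OF fr] simp: upd_defs)
          done
        using L p apply (simp_all add: upd_defs)
        done
      using L p apply (simp_all add: upd_defs)
      done
  qed
qed

definition walk_count :: nat where "walk_count = nat \<lceil>walks_needed\<rceil>"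

text \<open>Chebyshev's estimate without separate independence: the label bounds the squared
  deviation so far plus one second moment per outstanding walk, and a walk trades one for the
  other.\<close>

lemma sample_prog_bounds:
  fixes Z :: real
  assumes fr: "frame s" and L: "0 < Lam" and Z: "0 < Z"
    and r: "real walk_count * (t1 * (real Lam * real Lam) * sq_pot (res s)) / Z \<le> r"
    and post: "\<And>s' r' S. (S - real walk_count * lin_pot (res s))\<^sup>2 / Z \<le> r' \<Longrightarrow>
       rv s' ''out'' = (rv s ''a'' + S / real walk_count) / 2 \<Longrightarrow>
       time s' \<le> time s + 4 + walk_count * (12 + Lam * (f + 6)) \<Longrightarrow> K s' r'"
  shows "bounds sample_prog s K r"
proof -
  define \<mu> where "\<mu> = lin_pot (res s)"
  define V where "V = t1 * (real Lam * real Lam) * sq_pot (res s)"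
  define T where "T = time s + 2 + walk_count * (12 + Lam * (f + 6))"
  let ?I = "\<lambda>s' r'. frame s' \<and> ra s' = ra s \<and> rv s' ''a'' = rv s ''a'' \<and> nv s' ''K'' \<le> walk_count \<and>
    ((rv s' ''S'' - real (nv s' ''K'') * \<mu>)\<^sup>2 + real (walk_count - nv s' ''K'') * V) / Z \<le> r' \<and>
    time s' + (walk_count - nv s' ''K'') * (12 + Lam * (f + 6)) \<le> T"
  have loop: "bounds (While (RLess (OfNat (NVar ''K'')) (RVar ''N'')) sample_body) s0
     (\<lambda>s' r'. bounds (RAssign ''out'' (RDiv (RPlus (RVar ''a'') (RDiv (RVar ''S'') (OfNat (NVar ''K'')))) (OfNat (NConst 2)))) s' K r') r"
    if I0: "?I s0 r" for s0
  proof (rule bounds_While[where I = ?I and V = "\<lambda>s. walk_count - nv s ''K''", OF I0])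
    fix s1 r1 assume I: "?I s1 r1" and g: "bval (RLess (OfNat (NVar ''K'')) (RVar ''N'')) s1"
    have "rv s1 ''N'' = walks_needed" using I by (simp add: frame_def)
    then have k: "nv s1 ''K'' < walk_count" using g by (simp add: real_less_iff_nat_ceiling walk_count_def)
    then obtain m where m: "walk_count - nv s1 ''K'' = Suc m" "walk_count - Suc (nv s1 ''K'') = m" by (metis Suc_diff_Suc)
    have e: "res (tick 1 s1) = res s" using I by (simp add: res_def tick_def fun_eq_iff)
    let ?Y = "rv s1 ''S'' - real (nv s1 ''K'') * \<mu>"
    show "bounds sample_body (tick 1 s1) (\<lambda>s' r'. ?I s' r' \<and> walk_count - nv s' ''K'' < walk_count - nv s1 ''K'') r1"
    proof (rule sample_body_bounds[where Y = ?Y and D = "real m * V", OF _ L Z])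
      show "frame (tick 1 s1)" using I by (auto intro!: frame_cong[of s1] simp: tick_def)
      show "(?Y\<^sup>2 + t1 * (real Lam * real Lam) * sq_pot (res (tick 1 s1)) + real m * V) / Z \<le> r1"
        using I unfolding e V_def[symmetric] m by (simp add: algebra_simps)
      fix s' r' assume s': "frame s'" "ra s' = ra (tick 1 s1)" "rv s' ''a'' = rv (tick 1 s1) ''a''"
         "nv s' ''K'' = Suc (nv (tick 1 s1) ''K'')"
         "((?Y + (rv s' ''S'' - rv (tick 1 s1) ''S'') - lin_pot (res (tick 1 s1)))\<^sup>2 + real m * V) / Z \<le> r'"
         "time s' \<le> time (tick 1 s1) + 11 + Lam * (f + 6)"
      have K: "nv s' ''K'' = Suc (nv s1 ''K'')" using s'(4) by (simp add: tick_def)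
      have eq: "?Y + (rv s' ''S'' - rv (tick 1 s1) ''S'') - \<mu> = rv s' ''S'' - real (nv s' ''K'') * \<mu>"
        unfolding K by (simp add: tick_def algebra_simps)
      have "((rv s' ''S'' - real (nv s' ''K'') * \<mu>)\<^sup>2 + real (walk_count - nv s' ''K'') * V) / Z \<le> r'"
        using s'(5)[unfolded e \<mu>_def[symmetric] eq] by (simp add: K m)
      moreover have "time s' + (walk_count - nv s' ''K'') * (12 + Lam * (f + 6)) \<le> T"
        using I s'(6) unfolding K m by (simp add: tick_def)
      ultimately show "?I s' r' \<and> walk_count - nv s' ''K'' < walk_count - nv s1 ''K''"
        using s' I k K by (simp add: tick_def)
    qed
  next
    fix s1 r1 assume I: "?I s1 r1" and g: "\<not> bval (RLess (OfNat (NVar ''K'')) (RVar ''N'')) s1"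
    have "rv s1 ''N'' = walks_needed" using I by (simp add: frame_def)
    then have k: "nv s1 ''K'' = walk_count" using g I by (simp add: real_less_iff_nat_ceiling walk_count_def)
    show "bounds (RAssign ''out'' (RDiv (RPlus (RVar ''a'') (RDiv (RVar ''S'') (OfNat (NVar ''K'')))) (OfNat (NConst 2)))) (tick 1 s1) K r1"
    proof (rule bounds_RAssign, rule post[where S = "rv s1 ''S''"])
      show "(rv s1 ''S'' - real walk_count * lin_pot (res s))\<^sup>2 / Z \<le> r1"
        using I k by (simp add: \<mu>_def)
    qed (use I k in \<open>simp_all add: upd_defs T_def\<close>)
  qed
  show ?thesis
    unfolding sample_prog_def zero_def
    apply (rule bounds_Seq, rule bounds_RAssign, rule bounds_Seq, rule bounds_NAssign, rule bounds_Seq, rule loop)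
    using r apply (auto intro!: frame_cong[OF fr] simp: upd_defs T_def V_def)
    done
qed

end

section \<open>Error and cost\<close>

lemma abs_vm_pow_le:
  assumes "v < n"
  shows "\<bar>(vm n A ^^ k) x v\<bar> \<le> (vm n (\<lambda>i j. \<bar>A i j\<bar>) ^^ k) (\<lambda>u. \<bar>x u\<bar>) v"
  using assms
proof (induction k arbitrary: v)
  case (Suc k)
  have "\<bar>(vm n A ^^ Suc k) x v\<bar> \<le> (\<Sum>u<n. \<bar>(vm n A ^^ k) x u\<bar> * \<bar>A u v\<bar>)"
    by (simp add: vm_def[of n A "(vm n A ^^ k) x"]) (rule order_trans[OF sum_abs], simp add: abs_mult)
  also have "\<dots> \<le> (\<Sum>u<n. (vm n (\<lambda>i j. \<bar>A i j\<bar>) ^^ k) (\<lambda>u. \<bar>x u\<bar>) u * \<bar>A u v\<bar>)"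
    using Suc.IH by (intro sum_mono mult_right_mono) auto
  finally show ?case by (simp add: vm_def[of n _ "(vm n (\<lambda>i j. \<bar>A i j\<bar>) ^^ k) (\<lambda>u. \<bar>x u\<bar>)"])
qed simp

text \<open>The test for a large \<epsilon> precedes the computation of \<Lambda>, because counting
  up to \<Lambda> is affordable only for smaller \<epsilon>; hence it uses the upper bound
  \<open>l + 1\<close>.\<close>

definition main_prog :: com where
  "main_prog = Seq scan_prog (Seq log_prog
     (Cond (RLess (RVar ''eps'') (RTimes (RTimes (RVar ''t1'') (RVar ''w'')) (RPlus (RVar ''l'') (OfNat (NConst 1)))))
       (Seq len_prog (Seq param_prog (Seq push_prog sample_prog)))
       (RAssign ''out'' zero)))"

context rcdd_instance
begin

section \<open>Bounds on the potentials, the length and the second moment\<close>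

lemma lin_pot_le: "\<bar>lin_pot r\<bar> \<le> abs_pot r"
proof -
  have w: "\<bar>vm_sum n W (vec_index t) m v\<bar> \<le> vm_sum n P (\<lambda>u. \<bar>vec_index t u\<bar>) m v" if "v < n" for m v
    unfolding vm_sum_def using that by (intro order_trans[OF sum_abs] sum_mono abs_vm_pow_le)
  have "\<bar>lin_pot r\<bar> \<le> (\<Sum>j\<le>Lam. \<Sum>v<n. \<bar>vm_sum n W (vec_index t) (Lam - j) v\<bar> * \<bar>r j v\<bar>)"
    unfolding lin_pot_def pot_def
    by (rule order_trans[OF sum_abs], rule sum_mono, rule order_trans[OF sum_abs]) (simp add: abs_mult)
  also have "\<dots> \<le> abs_pot r"
    unfolding abs_pot_def pot_def using w by (intro sum_mono mult_right_mono) auto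
  finally show ?thesis .
qed

text \<open>There are \<Lambda> contributing levels, each of total weight at most \<Lambda>
  \<open>t1\<close>.\<close>

lemma abs_pot_le:
  assumes "\<forall>j<Lam. \<forall>u<n. \<bar>r j u\<bar> \<le> \<rho>" "0 \<le> \<rho>"
  shows "abs_pot r \<le> \<rho> * (t1 * (real Lam * real Lam))"
proof -
  let ?w = "vm_sum n P (\<lambda>u. \<bar>vec_index t u\<bar>)"
  \<comment> \<open>Level \<Lambda>, where residuals may exceed the threshold, has weight 0.\<close>
  have "abs_pot r = (\<Sum>j<Lam. \<Sum>v<n. ?w (Lam - j) v * \<bar>r j v\<bar>)"
    by (simp add: abs_pot_def pot_def lessThan_Suc_atMost[symmetric] vm_sum_def)
  also have "\<dots> \<le> (\<Sum>j<Lam. \<Sum>v<n. ?w (Lam - j) v * \<rho>)"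
    using assms abs_weight_nonneg by (intro sum_mono mult_left_mono) auto
  also have "\<dots> \<le> (\<Sum>j<Lam. real Lam * t1 * \<rho>)"
  proof (rule sum_mono)
    fix j
    have "(\<Sum>v<n. ?w (Lam - j) v) \<le> real (Lam - j) * t1"
      unfolding t1_def using P_row by (intro sum_vm_sum_le) auto
    also have "\<dots> \<le> real Lam * t1" using t1_pos by (intro mult_right_mono) auto
    finally show "(\<Sum>v<n. ?w (Lam - j) v * \<rho>) \<le> real Lam * t1 * \<rho>"
      unfolding sum_distrib_right[symmetric] using assms(2) by (rule mult_right_mono)
  qed
  finally show ?thesis by (simp add: mult_ac)
qed

lemma sq_pot_le:
  assumes "\<forall>j<Lam. \<forall>u<n. \<bar>r j u\<bar> \<le> \<rho>"
  shows "sq_pot r \<le> \<rho> * abs_pot r"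
proof -
  let ?w = "vm_sum n P (\<lambda>u. \<bar>vec_index t u\<bar>)"
  have "sq_pot r = (\<Sum>j<Lam. \<Sum>v<n. ?w (Lam - j) v * (r j v)\<^sup>2)"
    by (simp add: sq_pot_def pot_def lessThan_Suc_atMost[symmetric] vm_sum_def)
  also have "\<dots> \<le> (\<Sum>j<Lam. \<Sum>v<n. ?w (Lam - j) v * (\<rho> * \<bar>r j v\<bar>))"
  proof (intro sum_mono mult_left_mono)
    fix j v assume "j \<in> {..<Lam}" "v \<in> {..<n}"
    then have "\<bar>r j v\<bar> * \<bar>r j v\<bar> \<le> \<rho> * \<bar>r j v\<bar>" using assms by (intro mult_right_mono) auto
    then show "(r j v)\<^sup>2 \<le> \<rho> * \<bar>r j v\<bar>" by (simp add: power2_eq_square)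
  qed (use abs_weight_nonneg in auto)
  also have "\<dots> = \<rho> * abs_pot r"
    by (simp add: abs_pot_def pot_def lessThan_Suc_atMost[symmetric] vm_sum_def sum_distrib_left mult_ac)
  finally show ?thesis .
qed

lemma log1_ge: "1 \<le> log1 x" by (simp add: log1_def)

lemma Lam_bounds: "ell \<le> real Lam" "real Lam \<le> ell + 1" "1 \<le> Lam"
proof -
  have "4 / \<gamma> \<le> ell" unfolding ell_def using \<gamma> log1_ge by (intro divide_right_mono) auto
  moreover have "2 \<le> 4 / \<gamma>" using \<gamma> gamma_le_2[OF \<gamma>] by (simp add: field_simps)
  ultimately have e: "2 \<le> ell" by linarith
  show "ell \<le> real Lam" "real Lam \<le> ell + 1" unfolding Lam_def using e by linarith+
  then show "1 \<le> Lam" using e by linarith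
qed

lemma beta_pos: "0 < beta"
proof -
  obtain i where i: "i < n" "vec_index b i \<noteq> 0" using b b_nz by (metis carrier_vecD eq_vecI index_zero_vec)
  then have "0 < \<bar>h i\<bar>" using d_pos[OF i(1)] by (simp add: h_def)
  then show ?thesis using h_le_beta[OF i(1)] by linarith
qed

text \<open>Diagonal entries are nonzero and hence at least \<open>c\<close>.\<close>

lemma beta_le: "c * beta \<le> b1"
proof -
  have "beta \<le> b1 / c"
    unfolding beta_eq
  proof (subst Max_le_iff, simp, simp, intro ballI)
    fix y assume "y \<in> insert 0 ((\<lambda>i. \<bar>h i\<bar>) ` {..<n})"
    then consider "y = 0" | i where "i < n" "y = \<bar>h i\<bar>" by auto
    then show "y \<le> b1 / c"
    proof cases
      case 2
      have "c \<le> d i" using entries[of i i] 2 d_pos[of i] by auto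
      moreover have "\<bar>vec_index b i\<bar> \<le> b1" unfolding b1_def using 2 by (intro member_le_sum) auto
      ultimately have "\<bar>vec_index b i\<bar> / d i \<le> b1 / c" using c by (intro frac_le) auto
      then show ?thesis using 2 d_pos[of i] by (simp add: h_def)
    qed (use c b1_pos in simp)
  qed
  then show ?thesis using c by (simp add: field_simps)
qed

lemma target_error: "\<bar>scalar_prod t (x_star M b) - target / 2\<bar> \<le> \<epsilon> / 2"
  using truncation_error[OF \<gamma> \<epsilon> B, of Lam] Lam_bounds(1) by (simp add: ell_def target_def)

lemma target_le: "\<bar>target\<bar> \<le> t1 * real Lam * beta"
proof -
  let ?r = "\<lambda>j u. if j = (0::nat) then h u else 0"
  have "lin_pot ?r = target" "abs_pot ?r \<le> t1 * real Lam * beta" by (rule initial_pots; simp)+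
  then show ?thesis using lin_pot_le[of ?r] by linarith
qed

lemma rho_pos: "0 < rho"
  using t1_pos \<epsilon> Lam_bounds(3) by (simp add: rho_def r1_def less_max_iff_disj)

lemma real_f_pos: "0 < real f" using f_pos by simp

lemma r1_cube: "t1\<^sup>2 * real f * real Lam ^ 4 * r1 ^ 3 = b1 * \<epsilon>\<^sup>2"
proof -
  let ?x = "b1 * (\<epsilon> * \<epsilon>) / (t1 * t1 * (real f * ((real Lam * real Lam) * (real Lam * real Lam))))"
  have L: "0 < real Lam" using Lam_bounds(3) by simp
  have x: "0 < ?x" using b1_pos \<epsilon> t1_pos real_f_pos L by simp
  have "r1 ^ 3 = exp (3 * (ln ?x / 3))" unfolding r1_def by (subst exp_of_nat_mult[of 3, simplified, symmetric]) simp
  also have "\<dots> = ?x" using x by simp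
  finally show ?thesis using t1_pos real_f_pos L by (simp add: field_simps power2_eq_square power4_eq_xxxx)
qed

lemma r2_square: "t1\<^sup>2 * real f * beta * real Lam ^ 3 * r2\<^sup>2 = b1 * \<epsilon>\<^sup>2"
proof -
  let ?x = "b1 * (\<epsilon> * \<epsilon>) / (t1 * t1 * (real f * beta * (real Lam * (real Lam * real Lam))))"
  have L: "0 < real Lam" using Lam_bounds(3) by simp
  have x: "0 < ?x" using b1_pos \<epsilon> t1_pos real_f_pos L beta_pos by simp
  have "r2\<^sup>2 = exp (2 * (ln ?x / 2))" unfolding r2_def by (subst exp_of_nat_mult[of 2, simplified, symmetric]) simp
  also have "\<dots> = ?x" using x by simp
  finally show ?thesis using t1_pos real_f_pos L beta_pos by (simp add: field_simps power2_eq_square power3_eq_cube)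
qed

text \<open>If \<open>r1\<close> attains the maximum, the potential is bounded through the
  threshold; if \<open>r2\<close> does, through its initial value. The defining equations of the
  roots then finish.\<close>

lemma variance_bound:
  assumes wp: walks_pay and ap: "abs_pot r \<le> t1 * real Lam * beta" and rr: "\<forall>j<Lam. \<forall>u<n. \<bar>r j u\<bar> \<le> rho"
  shows "t1 * (real Lam * real Lam) * sq_pot r * real f * rho \<le> b1 * \<epsilon>\<^sup>2"
proof -
  let ?l = "real Lam"
  have L: "0 < ?l" using Lam_bounds(3) by simp
  note pos = t1_pos L real_f_pos rho_pos beta_pos
  have sq: "sq_pot r \<le> rho * abs_pot r" using rr by (rule sq_pot_le)
  have main: "t1 * (?l * ?l) * sq_pot r * real f * rho \<le> t1 * (?l * ?l) * (rho * x) * real f * rho" if "abs_pot r \<le> x" for x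
  proof -
    have "sq_pot r \<le> rho * x" using sq that pos by (meson mult_left_mono less_imp_le order_trans)
    then show ?thesis using pos by (intro mult_right_mono mult_left_mono) auto
  qed
  have "rho = r1 \<or> rho = r2" using wp by (simp add: rho_def max_def)
  then consider "rho = r1" | "rho = r2" by blast
  then show ?thesis
  proof cases
    case 1
    have "abs_pot r \<le> rho * (t1 * (?l * ?l))" using rr pos by (intro abs_pot_le) auto
    from main[OF this] have "t1 * (?l * ?l) * sq_pot r * real f * rho \<le> t1\<^sup>2 * real f * ?l ^ 4 * r1 ^ 3"
      unfolding 1 by (simp add: power2_eq_square power3_eq_cube power4_eq_xxxx mult_ac)
    then show ?thesis unfolding r1_cube .
  next
    case 2
    from main[OF ap] have "t1 * (?l * ?l) * sq_pot r * real f * rho \<le> t1\<^sup>2 * real f * beta * ?l ^ 3 * r2\<^sup>2"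
      unfolding 2 by (simp add: power2_eq_square power3_eq_cube mult_ac)
    then show ?thesis unfolding r2_square .
  qed
qed

section \<open>Comparison of all running times with the two cost terms\<close>

definition cost1 :: real where
  "cost1 = real f powr (1/3) * t1 powr (2/3) * b1 powr (2/3) * real Lam powr (7/3) * \<epsilon> powr (-2/3)"

definition cost2 :: real where
  "cost2 = real f powr (1/2) * t1 * b1 powr (1/2) * beta powr (1/2) * real Lam powr (5/2) * \<epsilon> powr (-1)"

text \<open>Third powers clear the fractional exponents; comparisons with \<open>cost1\<close> are
  made in this form, those with \<open>cost2\<close> after squaring.\<close>

lemma cost1_cube: "cost1 ^ 3 * \<epsilon>\<^sup>2 = real f * t1\<^sup>2 * b1\<^sup>2 * real Lam ^ 7"
proof -
  have L: "0 < real Lam" using Lam_bounds(3) by simp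
  have p: "(x powr y) ^ 3 = x powr (3 * y)" if "0 < x" for x y :: real
    using that by (simp add: powr_realpow[symmetric] powr_powr mult.commute)
  have "cost1 ^ 3 = real f powr 1 * t1 powr 2 * b1 powr 2 * real Lam powr 7 * \<epsilon> powr (-2)"
    unfolding cost1_def power_mult_distrib using real_f_pos t1_pos b1_pos L \<epsilon> by (simp add: p)
  also have "\<dots> = real f * t1\<^sup>2 * b1\<^sup>2 * real Lam ^ 7 / \<epsilon>\<^sup>2"
    using real_f_pos t1_pos b1_pos L \<epsilon> by (simp add: powr_minus powr_numeral divide_inverse)
  finally show ?thesis using \<epsilon> by simp
qed

lemma cost2_square: "cost2\<^sup>2 * \<epsilon>\<^sup>2 = real f * t1\<^sup>2 * b1 * beta * real Lam ^ 5"
proof -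
  have L: "0 < real Lam" using Lam_bounds(3) by simp
  have p: "(x powr y)\<^sup>2 = x powr (2 * y)" if "0 < x" for x y :: real
    using that by (simp add: powr_realpow[symmetric] powr_powr mult.commute)
  have "cost2\<^sup>2 = real f powr 1 * t1\<^sup>2 * b1 powr 1 * beta powr 1 * real Lam powr 5 * (\<epsilon> powr (-1))\<^sup>2"
    unfolding cost2_def power_mult_distrib using real_f_pos b1_pos beta_pos L \<epsilon> by (simp add: p)
  also have "\<dots> = real f * t1\<^sup>2 * b1 * beta * real Lam ^ 5 / \<epsilon>\<^sup>2"
    using real_f_pos b1_pos beta_pos L \<epsilon> by (simp add: powr_minus power_inverse divide_inverse)
  finally show ?thesis using \<epsilon> by simp
qed

lemma cost1_pos: "0 < cost1" and cost2_pos: "0 < cost2"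
  unfolding cost1_def cost2_def using real_f_pos t1_pos b1_pos beta_pos \<epsilon> Lam_bounds(3) by simp_all

lemma le_cost1I: "0 \<le> x \<Longrightarrow> 0 \<le> k \<Longrightarrow> x ^ 3 \<le> k ^ 3 * cost1 ^ 3 \<Longrightarrow> x \<le> k * cost1"
  using cost1_pos power_mono_iff[of x "k * cost1" 3] by (simp add: power_mult_distrib)

lemma le_cost2I: "0 \<le> x \<Longrightarrow> 0 \<le> k \<Longrightarrow> x\<^sup>2 \<le> k\<^sup>2 * cost2\<^sup>2 \<Longrightarrow> x \<le> k * cost2"
  using cost2_pos power_mono_iff[of x "k * cost2" 2] by (simp add: power_mult_distrib)

definition len_const :: real where "len_const = 1 + 4 / c\<^sup>2 + 4 / c"

text \<open>Counting up to \<Lambda> must be paid for as well. The hypothesis together with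
  \<open>beta_le\<close> bounds \<epsilon> from above, and thereby the cost terms, which grow as
  \<epsilon> shrinks, from below.\<close>

lemma Lam_le_cost:
  assumes big: "\<epsilon> \<le> 2 * t1 * beta * real Lam"
  shows "real Lam \<le> len_const * cost1" "real Lam \<le> len_const * cost2"
proof -
  let ?l = "real Lam"
  have l: "1 \<le> ?l" using Lam_bounds(3) by simp
  note pos = t1_pos b1_pos beta_pos real_f_pos c \<epsilon>
  have k: "1 \<le> len_const" "4 / c\<^sup>2 \<le> len_const" "4 / c \<le> len_const" using c by (simp_all add: len_const_def)
  have k3: "4 / c\<^sup>2 \<le> len_const ^ 3" using k(2) self_le_power[of len_const 3] k(1) by linarith
  have k2: "4 / c \<le> len_const\<^sup>2" using k(3) self_le_power[of len_const 2] k(1) by linarith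
  have "c * \<epsilon> \<le> 2 * t1 * (c * beta) * ?l" using mult_left_mono[OF big, of c] c by (simp add: mult_ac)
  also have "\<dots> \<le> 2 * t1 * b1 * ?l" using beta_le pos l by (intro mult_right_mono mult_left_mono) auto
  finally have "(c * \<epsilon>)\<^sup>2 \<le> (2 * t1 * b1 * ?l)\<^sup>2" using pos by (intro power_mono) auto
  then have e: "\<epsilon>\<^sup>2 \<le> 4 / c\<^sup>2 * (t1\<^sup>2 * b1\<^sup>2 * ?l\<^sup>2)" using c by (simp add: power_mult_distrib field_simps)
  have "?l ^ 3 * \<epsilon>\<^sup>2 \<le> ?l ^ 3 * (4 / c\<^sup>2 * (t1\<^sup>2 * b1\<^sup>2 * ?l\<^sup>2))" using l by (intro mult_left_mono e) auto
  also have "\<dots> = 4 / c\<^sup>2 * (1 * t1\<^sup>2 * b1\<^sup>2 * ?l ^ 5)" by (simp add: power_add[symmetric])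
  also have "\<dots> \<le> len_const ^ 3 * (real f * t1\<^sup>2 * b1\<^sup>2 * ?l ^ 7)"
    using k3 pos l f_pos k(1) by (intro order_refl mult_mono power_increasing) auto
  finally have "?l ^ 3 * \<epsilon>\<^sup>2 \<le> len_const ^ 3 * cost1 ^ 3 * \<epsilon>\<^sup>2" unfolding cost1_cube[symmetric] by (simp add: mult.assoc)
  then have "?l ^ 3 \<le> len_const ^ 3 * cost1 ^ 3" using \<epsilon> by simp
  then show "?l \<le> len_const * cost1" using k l by (intro le_cost1I) auto
  have "\<epsilon>\<^sup>2 \<le> (2 * t1 * beta * ?l)\<^sup>2" using big \<epsilon> by (intro power_mono) auto
  then have "c * \<epsilon>\<^sup>2 \<le> 4 * t1\<^sup>2 * beta * ?l\<^sup>2 * (c * beta)"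
    using mult_left_mono[of "\<epsilon>\<^sup>2" "(2 * t1 * beta * ?l)\<^sup>2" c] c by (simp add: power2_eq_square mult_ac)
  also have "\<dots> \<le> 4 * t1\<^sup>2 * beta * ?l\<^sup>2 * b1" using pos l by (intro mult_left_mono beta_le) auto
  finally have e2: "\<epsilon>\<^sup>2 \<le> 4 / c * (t1\<^sup>2 * b1 * beta * ?l\<^sup>2)" using c by (simp add: field_simps)
  have "?l\<^sup>2 * \<epsilon>\<^sup>2 \<le> ?l\<^sup>2 * (4 / c * (t1\<^sup>2 * b1 * beta * ?l\<^sup>2))" using l by (intro mult_left_mono e2) auto
  also have "\<dots> = 4 / c * (1 * t1\<^sup>2 * b1 * beta * ?l ^ 4)" by (simp add: power_add[symmetric])
  also have "\<dots> \<le> len_const\<^sup>2 * (real f * t1\<^sup>2 * b1 * beta * ?l ^ 5)"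
    using k2 pos l f_pos k(1) by (intro order_refl mult_mono power_increasing) auto
  finally have "?l\<^sup>2 * \<epsilon>\<^sup>2 \<le> len_const\<^sup>2 * cost2\<^sup>2 * \<epsilon>\<^sup>2" unfolding cost2_square[symmetric] by (simp add: mult.assoc)
  then have "?l\<^sup>2 \<le> len_const\<^sup>2 * cost2\<^sup>2" using \<epsilon> by simp
  then show "?l \<le> len_const * cost2" using k l by (intro le_cost2I) auto
qed

text \<open>Both \<open>cost1\<close> and \<open>cost2\<close> dominate the smaller of the cost of one walk and that of a purely
  deterministic push.\<close>

lemma min_le_cost:
  assumes big: "\<epsilon> \<le> 2 * t1 * beta * real Lam" and x: "0 \<le> x" "x \<le> real f * real Lam"
    and xq: "x * \<epsilon> \<le> t1 * b1 * real Lam ^ 3"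
  shows "x \<le> 2 * cost1" "x \<le> 2 * cost2"
proof -
  let ?l = "real Lam"
  have l: "1 \<le> ?l" using Lam_bounds(3) by simp
  note pos = t1_pos b1_pos beta_pos real_f_pos \<epsilon>
  \<comment> \<open>Using the first bound on \<open>x\<close> once and the second twice reproduces
    the exponents of \<open>cost1\<close>.\<close>
  have "x ^ 3 * \<epsilon>\<^sup>2 = x * (x * \<epsilon>)\<^sup>2" by (simp add: power2_eq_square power3_eq_cube)
  also have "\<dots> \<le> (real f * ?l) * (t1 * b1 * ?l ^ 3)\<^sup>2"
    using x pos by (intro mult_mono[OF x(2) power_mono[OF xq]]) auto
  also have "\<dots> = cost1 ^ 3 * \<epsilon>\<^sup>2" unfolding cost1_cube by (simp add: power_mult_distrib power_mult[symmetric] eval_nat_numeral)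
  finally have "x ^ 3 \<le> cost1 ^ 3" using \<epsilon> by simp
  also have "\<dots> \<le> 2 ^ 3 * cost1 ^ 3" using cost1_pos by simp
  finally show "x \<le> 2 * cost1" using x by (intro le_cost1I) auto
  \<comment> \<open>Each bound on \<open>x\<close> is used once; the spare factor \<epsilon> is
    absorbed by \<open>big\<close>, which brings in \<open>beta\<close>.\<close>
  have "x\<^sup>2 * \<epsilon>\<^sup>2 = x * (x * \<epsilon>) * \<epsilon>" by (simp add: power2_eq_square)
  also have "\<dots> \<le> (real f * ?l) * (t1 * b1 * ?l ^ 3) * (2 * t1 * beta * ?l)"
    using x pos l by (intro mult_mono[OF mult_mono[OF x(2) xq] big]) auto
  also have "\<dots> = 2 * (cost2\<^sup>2 * \<epsilon>\<^sup>2)" unfolding cost2_square by (simp add: power2_eq_square eval_nat_numeral)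
  finally have "x\<^sup>2 \<le> 2 * cost2\<^sup>2" using \<epsilon> by simp
  also have "\<dots> \<le> 2\<^sup>2 * cost2\<^sup>2" by simp
  finally show "x \<le> 2 * cost2" using x by (intro le_cost2I) auto
qed

text \<open>With \<open>r1\<close> or \<open>r2\<close> in place of \<open>rho\<close> the left side
  is exactly \<open>cost1\<close> or \<open>cost2\<close>, and \<open>rho\<close> is at least both.
  If walks do not pay, it is the cost of pushing alone, to which \<open>min_le_cost\<close>
  applies.\<close>

lemma push_le_cost:
  assumes big: "\<epsilon> \<le> 2 * t1 * beta * real Lam"
  shows "real Lam * b1 / rho \<le> 2 * cost1" "real Lam * b1 / rho \<le> 2 * cost2"
proof -
  let ?l = "real Lam" and ?x = "real Lam * b1 / rho"
  have l: "1 \<le> ?l" using Lam_bounds(3) by simp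
  note pos = t1_pos b1_pos beta_pos real_f_pos \<epsilon> rho_pos
  have "?x \<le> 2 * cost1 \<and> ?x \<le> 2 * cost2"
  proof (cases walks_pay)
    case True
    then have r: "r1 \<le> rho" "r2 \<le> rho" by (simp_all add: rho_def)
    have r0: "0 < r1" "0 < r2" by (simp_all add: r1_def r2_def)
    have "(?l * b1 / r1) ^ 3 * \<epsilon>\<^sup>2 = ?l ^ 3 * b1\<^sup>2 * (b1 * \<epsilon>\<^sup>2) / r1 ^ 3"
      by (simp add: power_divide power_mult_distrib power2_eq_square power3_eq_cube)
    also have "\<dots> = cost1 ^ 3 * \<epsilon>\<^sup>2"
      unfolding r1_cube[symmetric] cost1_cube using r0 by (simp add: power_add[symmetric])
    finally have "(?l * b1 / r1) ^ 3 = cost1 ^ 3" using \<epsilon> by simp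
    then have "?l * b1 / r1 \<le> 1 * cost1" using l pos r0 by (intro le_cost1I) auto
    moreover have "?x \<le> ?l * b1 / r1" using r r0 l pos by (intro divide_left_mono) auto
    ultimately have "?x \<le> 2 * cost1" using cost1_pos by linarith
    have "(?l * b1 / r2)\<^sup>2 * \<epsilon>\<^sup>2 = ?l\<^sup>2 * b1 * (b1 * \<epsilon>\<^sup>2) / r2\<^sup>2"
      by (simp add: power_divide power_mult_distrib power2_eq_square)
    also have "\<dots> = cost2\<^sup>2 * \<epsilon>\<^sup>2"
      unfolding r2_square[symmetric] cost2_square using r0 by (simp add: power_add[symmetric])
    finally have "(?l * b1 / r2)\<^sup>2 = cost2\<^sup>2" using \<epsilon> by simp
    then have "?l * b1 / r2 \<le> 1 * cost2" using l pos r0 by (intro le_cost2I) auto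
    moreover have "?x \<le> ?l * b1 / r2" using r r0 l pos by (intro divide_left_mono) auto
    ultimately have "?x \<le> 2 * cost2" using cost2_pos by linarith
    with \<open>?x \<le> 2 * cost1\<close> show ?thesis by simp
  next
    case False
    have x: "?x = t1 * b1 * (?l * (?l * ?l)) / \<epsilon>" using False pos l by (simp add: rho_def)
    have "?x \<le> real f * ?l" using False unfolding x walks_pay_def by simp
    moreover have "?x * \<epsilon> \<le> t1 * b1 * ?l ^ 3" unfolding x using \<epsilon> by (simp add: power3_eq_cube mult_ac)
    moreover have "0 \<le> ?x" using pos l by simp
    ultimately show ?thesis using min_le_cost[OF big] by blast
  qed
  then show "?x \<le> 2 * cost1" "?x \<le> 2 * cost2" by auto
qed

text \<open>Contributions of computing the length, of pushing (twice 58/\<open>c\<close>) and of the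
  walks (38 + 152).\<close>

definition cost_const :: real where "cost_const = 4 * len_const + 116 / c + 190"

lemma total_le_cost:
  assumes big: "\<epsilon> \<le> 2 * t1 * beta * real Lam"
  shows "4 * real Lam + 58 / (c * rho) * (real Lam * b1) + real walk_count * real (12 + Lam * (f + 6))
     \<le> cost_const * min cost1 cost2"
proof -
  let ?l = "real Lam" and ?x = "real Lam * b1 / rho"
  have l: "1 \<le> ?l" and f: "1 \<le> real f" using Lam_bounds(3) f_pos by simp_all
  note pos = t1_pos b1_pos beta_pos real_f_pos \<epsilon> rho_pos c
  have x0: "0 \<le> ?x" using pos by simp
  have walk: "real walk_count * real (12 + Lam * (f + 6)) \<le> 38 * a + 152 * a"
    if a: "?x \<le> 2 * a" "walks_pay \<Longrightarrow> real f * ?l \<le> 2 * a" for a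
  proof (cases walks_pay)
    case True
    have "real (12 + Lam * (f + 6)) \<le> 19 * (real f * ?l)"
    proof -
      have "?l * 1 \<le> ?l * real f" using l f by (intro mult_left_mono) auto
      moreover have "1 * 1 \<le> ?l * real f" using l f by (intro mult_mono) auto
      ultimately show ?thesis by (simp add: algebra_simps)
    qed
    \<comment> \<open>Rounding up adds one walk, which is affordable because
      \<open>walks_pay\<close> holds.\<close>
    moreover have "real walk_count \<le> 1 + 4 * b1 / (real f * rho)"
    proof -
      have "walks_needed = 4 * b1 / (real f * rho)" using True by (simp add: walks_needed_def)
      moreover have "0 \<le> walks_needed" using pos by (simp add: walks_needed_def)
      ultimately show ?thesis unfolding walk_count_def by linarith
    qed
    ultimately have "real walk_count * real (12 + Lam * (f + 6)) \<le> (1 + 4 * b1 / (real f * rho)) * (19 * (real f * ?l))"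
      using pos l f by (intro mult_mono) auto
    also have "\<dots> = 19 * (real f * ?l) + 76 * ?x" using pos by (simp add: field_simps)
    also have "\<dots> \<le> 38 * a + 152 * a" using a True by simp
    finally show ?thesis .
  next
    case False
    then have "walk_count = 0" by (simp add: walk_count_def walks_needed_def)
    then show ?thesis using a(1) x0 by simp
  qed
  have one: "real f * ?l \<le> 2 * cost1" "real f * ?l \<le> 2 * cost2" if walks_pay
  proof -
    have "real f * ?l * \<epsilon> \<le> t1 * b1 * ?l ^ 3"
      using that \<epsilon> by (simp add: walks_pay_def field_simps power3_eq_cube)
    then show "real f * ?l \<le> 2 * cost1" "real f * ?l \<le> 2 * cost2" using min_le_cost[OF big, of "real f * ?l"] by auto
  qed
  have P: "58 / (c * rho) * (?l * b1) = 58 / c * ?x" using pos by simp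
  have all: "4 * ?l + 58 / (c * rho) * (?l * b1) + real walk_count * real (12 + Lam * (f + 6)) \<le> cost_const * a"
    if a: "?x \<le> 2 * a" "?l \<le> len_const * a" "walks_pay \<Longrightarrow> real f * ?l \<le> 2 * a" for a
  proof -
    have "58 / c * ?x \<le> 58 / c * (2 * a)" using c by (intro mult_left_mono a) auto
    then show ?thesis using walk[OF a(1,3)] a(2) unfolding P cost_const_def by (simp add: algebra_simps)
  qed
  show ?thesis
    using all[OF push_le_cost(1)[OF big] Lam_le_cost(1)[OF big] one(1)] all[OF push_le_cost(2)[OF big] Lam_le_cost(2)[OF big] one(2)]
    unfolding min_def by auto
qed

section \<open>Correctness and running time of the whole program\<close>

lemma l0_pos: "1 \<le> l0_norm b"
proof -
  obtain i where "i < n" "vec_index b i \<noteq> 0" using b b_nz by (metis carrier_vecD eq_vecI index_zero_vec)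
  then have "0 < card {i. i < n \<and> vec_index b i \<noteq> 0}" by (subst card_gt_0_iff) auto
  then show ?thesis unfolding l0_norm_def dims by linarith
qed

text \<open>Truncation uses up half of \<epsilon>. The other half remains for the estimate of
  \<open>target / 2\<close>, so the mean of the walks may deviate by \<epsilon>.\<close>

lemma main_prog_estimates:
  "estimates_within M b t acc main_prog (init_state M t acc \<epsilon> \<gamma> B) \<epsilon> (scalar_prod t (x_star M b))
     (55 * real (l0_norm b) + cost_const * min cost1 cost2)"
proof (rule estimates_within_if_bounds)
  let ?y = "scalar_prod t (x_star M b)"
  let ?T = "55 * real (l0_norm b) + cost_const * min cost1 cost2"
  let ?K = "\<lambda>s' r'. real (time s') \<le> ?T \<and> (\<epsilon> < \<bar>rv s' ''out'' - ?y\<bar> \<longrightarrow> 1 \<le> r') \<and> (0::real) \<le> r'"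
  let ?main = "Seq len_prog (Seq param_prog (Seq push_prog sample_prog))"
  have l0: "1 \<le> real (l0_norm b)" using l0_pos by simp
  have Lam0: "0 < Lam" using Lam_bounds(3) by simp
  have Kc0: "0 \<le> cost_const * min cost1 cost2" using cost1_pos cost2_pos c by (auto simp: cost_const_def len_const_def intro!: mult_nonneg_nonneg add_nonneg_nonneg)
  have stop: "bounds (RAssign ''out'' zero) s1 ?K (1/4)"
    if small: "t1 * beta * (ell + 1) \<le> \<epsilon>" and tm: "time s1 \<le> 7 + 11 * l0_norm b" for s1
  proof (rule bounds_RAssign)
    have "t1 * real Lam * beta \<le> t1 * (ell + 1) * beta"
      using t1_pos beta_pos Lam_bounds(2) by (intro mult_right_mono mult_left_mono) auto
    then have "\<bar>target\<bar> \<le> \<epsilon>" using target_le small by (simp add: mult_ac)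
    then have "\<bar>?y\<bar> \<le> \<epsilon>" using target_error by linarith
    then show "?K (tick 1 (set_r ''out'' (rval zero s1) s1)) (1/4)"
      using tm l0 Kc0 by (simp add: upd_defs zero_def)
  qed
  have go: "bounds ?main s1 ?K (1/4)"
    if sc: "scanned s1" "rv s1 ''l'' = ell" and big: "\<epsilon> < t1 * beta * (ell + 1)"
      and tm: "time s1 \<le> 7 + 11 * l0_norm b" for s1
  proof (rule bounds_Seq, rule len_prog_bounds[OF sc], rule bounds_Seq, erule param_prog_bounds, rule bounds_Seq,
      erule (1) push_prog_bounds[OF rho_pos])
    fix s2 s3 s4
    assume t2: "time s2 = time s1 + 3 + 4 * Lam" and t3: "time s3 \<le> time s2 + 8"
      and fr: "frame s4" and lin: "rv s4 ''a'' + lin_pot (res s4) = target"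
      and ab: "abs_pot (res s4) \<le> t1 * real Lam * beta" and rr: "\<forall>j<Lam. \<forall>u<n. \<bar>res s4 j u\<bar> \<le> rho"
      and t4: "real (time s4) \<le> push_time (real (time s3)) + 1"
    \<comment> \<open>With this normalisation a deviation of the mean by at least \<epsilon> makes
      the label at least 1; the value 1 only avoids a zero denominator.\<close>
    define Z where "Z = (if walk_count = 0 then 1 else (real walk_count * \<epsilon>)\<^sup>2)"
    have Z: "0 < Z" using \<epsilon> by (simp add: Z_def)
    have wp: walks_pay if "walk_count \<noteq> 0" using that by (auto simp: walk_count_def walks_needed_def split: if_splits)
    show "bounds sample_prog s4 ?K (1/4)"
    proof (rule sample_prog_bounds[OF fr Lam0 Z])
      let ?V = "t1 * (real Lam * real Lam) * sq_pot (res s4)"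
      show "real walk_count * ?V / Z \<le> 1/4"
      proof (cases "walk_count = 0")
        case False
        have "?V * real f * rho \<le> b1 * \<epsilon>\<^sup>2" using wp[OF False] ab rr by (rule variance_bound)
        then have "4 * ?V \<le> 4 * b1 / (real f * rho) * \<epsilon>\<^sup>2" using real_f_pos rho_pos by (simp add: field_simps)
        also have "\<dots> \<le> real walk_count * \<epsilon>\<^sup>2"
        proof (rule mult_right_mono)
          have "walks_needed = 4 * b1 / (real f * rho)" using wp[OF False] by (simp add: walks_needed_def)
          then show "4 * b1 / (real f * rho) \<le> real walk_count" unfolding walk_count_def by linarith
        qed simp
        finally have "4 * ?V \<le> real walk_count * \<epsilon>\<^sup>2" .
        then have "real walk_count * (4 * ?V) \<le> real walk_count * (real walk_count * \<epsilon>\<^sup>2)" by (intro mult_left_mono) auto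
        then have "4 * (real walk_count * ?V) \<le> Z" using False by (simp add: Z_def power2_eq_square mult_ac)
        then show ?thesis using Z by (simp add: field_simps)
      qed simp
      fix s' r' S
      assume S: "(S - real walk_count * lin_pot (res s4))\<^sup>2 / Z \<le> r'" and out: "rv s' ''out'' = (rv s4 ''a'' + S / real walk_count) / 2"
        and t5: "time s' \<le> time s4 + 4 + walk_count * (12 + Lam * (f + 6))"
      have "0 \<le> (S - real walk_count * lin_pot (res s4))\<^sup>2 / Z" using Z by simp
      then have r0: "0 \<le> r'" using S by linarith
      have bad: "1 \<le> r'" if far: "\<epsilon> < \<bar>rv s' ''out'' - ?y\<bar>"
      proof (cases "walk_count = 0")
        case True
        have nw: "\<not> walks_pay"
        proof
          assume walks_pay
          then have "0 < walks_needed" using b1_pos real_f_pos rho_pos by (simp add: walks_needed_def)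
          then show False using real_less_iff_nat_ceiling[of 0 walks_needed] True by (simp add: walk_count_def)
        qed
        \<comment> \<open>The small threshold makes the entire remaining contribution at most
          \<epsilon>, and division by 0 leaves just the pushed part in the output.\<close>
        have "abs_pot (res s4) \<le> rho * (t1 * (real Lam * real Lam))" using rr rho_pos by (intro abs_pot_le) auto
        also have "\<dots> = \<epsilon>" using nw t1_pos Lam0 by (simp add: rho_def)
        finally have "\<bar>lin_pot (res s4)\<bar> \<le> \<epsilon>" using lin_pot_le[of "res s4"] by linarith
        moreover have "2 * rv s' ''out'' = target - lin_pot (res s4)" using out True lin by simp
        ultimately have "\<bar>rv s' ''out'' - ?y\<bar> \<le> \<epsilon>" using target_error unfolding abs_le_iff by linarith
        then show ?thesis using far by simp
      next
        case False
        then have N: "0 < real walk_count" by simp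
        have o2: "2 * rv s' ''out'' = target + (S / real walk_count - lin_pot (res s4))" using out lin by simp
        have "\<epsilon> \<le> \<bar>S / real walk_count - lin_pot (res s4)\<bar>"
        proof (rule ccontr)
          assume "\<not> \<epsilon> \<le> \<bar>S / real walk_count - lin_pot (res s4)\<bar>"
          then have "\<bar>S / real walk_count - lin_pot (res s4)\<bar> \<le> \<epsilon>" by simp
          then have "\<bar>rv s' ''out'' - ?y\<bar> \<le> \<epsilon>" using o2 target_error unfolding abs_le_iff by linarith
          then show False using far by simp
        qed
        then have "real walk_count * \<epsilon> \<le> real walk_count * \<bar>S / real walk_count - lin_pot (res s4)\<bar>" using N by (intro mult_left_mono) auto
        also have "\<dots> = \<bar>S - real walk_count * lin_pot (res s4)\<bar>"
          using N abs_mult[of "real walk_count" "S / real walk_count - lin_pot (res s4)"] by (simp add: right_diff_distrib)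
        finally have "Z \<le> (S - real walk_count * lin_pot (res s4))\<^sup>2"
          using False \<epsilon> power_mono[of "real walk_count * \<epsilon>" "\<bar>S - real walk_count * lin_pot (res s4)\<bar>" 2] by (simp add: Z_def)
        then have "1 \<le> (S - real walk_count * lin_pot (res s4))\<^sup>2 / Z" using Z by simp
        then show ?thesis using S by linarith
      qed
      \<comment> \<open>The test of the program, stated with \<open>ell\<close>, implies the
        hypothesis \<open>big\<close> of the cost lemmas.\<close>
      have "ell + 1 \<le> 2 * real Lam" using Lam_bounds by linarith
      then have "t1 * beta * (ell + 1) \<le> t1 * beta * (2 * real Lam)" using t1_pos beta_pos by (intro mult_left_mono) auto
      then have "\<epsilon> \<le> 2 * t1 * beta * real Lam" using big by linarith
      note total = total_le_cost[OF this]
      have "real (time s') \<le> real (time s4) + 4 + real walk_count * real (12 + Lam * (f + 6))"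
        using of_nat_mono[OF t5, where 'a = real] by simp
      moreover have "real (time s3) \<le> 18 + 11 * real (l0_norm b) + 4 * real Lam" using t2 t3 tm by linarith
      \<comment> \<open>As \<open>b\<close> is nonzero, the additive constant 24 is absorbed into
        the scan term, whence 55.\<close>
      ultimately have "real (time s') \<le> 24 + 31 * real (l0_norm b) + (4 * real Lam
          + 58 / (c * rho) * (real Lam * b1) + real walk_count * real (12 + Lam * (f + 6)))"
        using t4 unfolding push_time_def by linarith
      then have "real (time s') \<le> ?T" using total l0 by linarith
      then show "?K s' r'" using bad r0 by simp
    qed
  qed
  show "bounds main_prog (init_state M t acc \<epsilon> \<gamma> B) ?K (1/4)"
    unfolding main_prog_def
  proof (rule bounds_Seq, rule scan_prog_bounds, rule bounds_Seq, erule log_prog_bounds, rule bounds_Cond)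
    fix s0 s1 assume s1: "time s0 \<le> 2 + 11 * l0_norm b" "scanned s1" "rv s1 ''l'' = ell" "time s1 = time s0 + 4"
    let ?c = "RLess (RVar ''eps'') (RTimes (RTimes (RVar ''t1'') (RVar ''w'')) (RPlus (RVar ''l'') (OfNat (NConst 1))))"
    have c: "bval ?c s1 \<longleftrightarrow> \<epsilon> < t1 * beta * (ell + 1)" using s1 by (simp add: scanned_def params_def)
    have sc: "scanned (tick 1 s1)" using s1(2) by (simp add: scanned_def params_def tick_def)
    show "bounds ?main (tick 1 s1) ?K (1/4)" if "bval ?c s1"
      using that s1 sc unfolding c by (intro go) (auto simp: tick_def)
    show "bounds (RAssign ''out'' zero) (tick 1 s1) ?K (1/4)" if "\<not> bval ?c s1"
      using that s1 unfolding c by (intro stop) (auto simp: tick_def)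
  qed
qed

text \<open>Since \<open>log1\<close> is at least 1 and \<gamma> at most 2, the length parameter is
  at least 1/2; hence rounding up turns the factor 4 into at most 6.\<close>

lemma Lam_le:
  assumes "1 \<le> \<kappa>" and "log1 (1 / (\<gamma> * \<epsilon>) * B) \<le> \<kappa> * log1 (1 / (\<gamma> * \<epsilon>) * log_arg M b t)"
  shows "real Lam \<le> 6 * \<kappa> * trunc_len \<epsilon> \<gamma> M b t" "0 < trunc_len \<epsilon> \<gamma> M b t"
proof -
  let ?L = "trunc_len \<epsilon> \<gamma> M b t" and ?x = "log1 (1 / (\<gamma> * \<epsilon>) * log_arg M b t)"
  have L: "1 / \<gamma> \<le> ?L" unfolding trunc_len_def using \<gamma> log1_ge by (simp add: field_simps)
  moreover have "1 / 2 \<le> 1 / \<gamma>" using gamma_le_2[OF \<gamma>] \<gamma> by (intro divide_left_mono) auto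
  ultimately have L2: "1 / 2 \<le> ?L" by linarith
  then show "0 < ?L" by linarith
  have "ell \<le> 4 * (\<kappa> * ?x) / \<gamma>" unfolding ell_def using assms(2) \<gamma> by (intro divide_right_mono mult_left_mono) auto
  also have "\<dots> = 4 * \<kappa> * ?L" by (simp add: trunc_len_def)
  finally have "real Lam \<le> 4 * \<kappa> * ?L + 2 * (1 * ?L)" using Lam_bounds(2) L2 by linarith
  also have "\<dots> \<le> 4 * \<kappa> * ?L + 2 * (\<kappa> * ?L)" using assms(1) L2 by (intro add_left_mono mult_left_mono mult_right_mono) auto
  finally show "real Lam \<le> 6 * \<kappa> * ?L" by (simp add: algebra_simps)
qed

text \<open>Both exponents 7/3 and 5/2 are below 3, so one constant serves both terms.\<close>

lemma Lam_powr_le: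
  assumes "1 \<le> \<kappa>" and "log1 (1 / (\<gamma> * \<epsilon>) * B) \<le> \<kappa> * log1 (1 / (\<gamma> * \<epsilon>) * log_arg M b t)"
    and "0 \<le> y" "y \<le> 3"
  shows "real Lam powr y \<le> (6 * \<kappa>) ^ 3 * trunc_len \<epsilon> \<gamma> M b t powr y"
proof -
  let ?L = "trunc_len \<epsilon> \<gamma> M b t"
  have "real Lam powr y \<le> (6 * \<kappa> * ?L) powr y" using Lam_le[OF assms(1,2)] assms(3) by (intro powr_mono2) auto
  also have "\<dots> = (6 * \<kappa>) powr y * ?L powr y" using assms(1) Lam_le(2)[OF assms(1,2)] by (intro powr_mult)
  also have "\<dots> \<le> (6 * \<kappa>) powr 3 * ?L powr y" using assms by (intro mult_right_mono powr_mono) auto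
  finally show ?thesis using assms(1) by simp
qed

lemma main_prog_estimates_within:
  assumes \<kappa>: "1 \<le> \<kappa>" "log1 (1 / (\<gamma> * \<epsilon>) * B) \<le> \<kappa> * log1 (1 / (\<gamma> * \<epsilon>) * log_arg M b t)"
    and C: "C = 55 + cost_const * (6 * \<kappa>) ^ 3"
  shows "estimates_within M b t acc main_prog (init_state M t acc \<epsilon> \<gamma> B) \<epsilon> (scalar_prod t (x_star M b))
    (C * real (l0_norm b) + C * min
       (real (f_row M acc) powr (1/3) * lp_norm 1 t powr (2/3) * lp_norm 1 b powr (2/3)
          * trunc_len \<epsilon> \<gamma> M b t powr (7/3) * \<epsilon> powr (-2/3))
       (real (f_row M acc) powr (1/2) * lp_norm 1 t * lp_norm 1 b powr (1/2)
          * lp_norm \<infinity> (diag_powr M (-1) *\<^sub>v b) powr (1/2)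
          * trunc_len \<epsilon> \<gamma> M b t powr (5/2) * \<epsilon> powr (-1)))" (is "estimates_within _ _ _ _ _ _ _ _ (_ + C * min ?T1 ?T2)")
proof -
  have n1: "lp_norm 1 t = t1" "lp_norm 1 b = b1" by (simp_all add: lp_norm_1 t1_def b1_def)
  let ?q = "(6 * \<kappa>) ^ 3"
  have cost_const: "0 \<le> cost_const" using c by (simp add: cost_const_def len_const_def)
  have "cost1 = real f powr (1/3) * t1 powr (2/3) * b1 powr (2/3) * \<epsilon> powr (-2/3) * real Lam powr (7/3)"
    by (simp add: cost1_def mult_ac)
  also have "\<dots> \<le> real f powr (1/3) * t1 powr (2/3) * b1 powr (2/3) * \<epsilon> powr (-2/3) * (?q * trunc_len \<epsilon> \<gamma> M b t powr (7/3))"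
    by (intro mult_left_mono Lam_powr_le[OF \<kappa>]) auto
  also have "\<dots> = ?q * ?T1" unfolding n1 f_def by (simp add: mult_ac)
  finally have 1: "cost1 \<le> ?q * ?T1" .
  have "cost2 = real f powr (1/2) * t1 * b1 powr (1/2) * beta powr (1/2) * \<epsilon> powr (-1) * real Lam powr (5/2)"
    by (simp add: cost2_def mult_ac)
  also have "\<dots> \<le> real f powr (1/2) * t1 * b1 powr (1/2) * beta powr (1/2) * \<epsilon> powr (-1) * (?q * trunc_len \<epsilon> \<gamma> M b t powr (5/2))"
    using t1_pos by (intro mult_left_mono Lam_powr_le[OF \<kappa>]) (auto intro!: mult_nonneg_nonneg)
  also have "\<dots> = ?q * ?T2" unfolding n1 f_def beta_def by (simp add: mult_ac)
  finally have 2: "cost2 \<le> ?q * ?T2" .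
  have q: "0 \<le> ?q" using \<kappa>(1) by simp
  have T: "0 \<le> min ?T1 ?T2" unfolding n1 using t1_pos by simp
  have "min cost1 cost2 \<le> ?q * min ?T1 ?T2" using 1 2 by (auto simp: min_def)
  then have "cost_const * min cost1 cost2 \<le> cost_const * (?q * min ?T1 ?T2)" using cost_const by (rule mult_left_mono)
  also have "\<dots> \<le> C * min ?T1 ?T2"
    using T unfolding C mult.assoc[symmetric] by (intro mult_right_mono) auto
  finally have 3: "cost_const * min cost1 cost2 \<le> C * min ?T1 ?T2" .
  have "55 * real (l0_norm b) \<le> C * real (l0_norm b)" using cost_const q unfolding C by (intro mult_right_mono) auto
  then have "55 * real (l0_norm b) + cost_const * min cost1 cost2 \<le> C * real (l0_norm b) + C * min ?T1 ?T2" using 3 by linarith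
  then show ?thesis
    using main_prog_estimates unfolding estimates_within_def by (meson order_trans)
qed

end

theorem theorem1p8:
  shows "\<exists>prog :: com. \<forall>(c :: real) (k :: nat) (\<kappa> :: real). c > 0 \<and> \<kappa> \<ge> 1 \<longrightarrow>
    (\<exists>C > 0. \<forall>(n :: nat) (M :: real mat) (b :: real vec) (t :: real vec) (acc :: access)
        (\<epsilon> :: real) (\<gamma> :: real) (B :: real).
      M \<in> carrier_mat n n \<longrightarrow> b \<in> carrier_vec n \<longrightarrow> t \<in> carrier_vec n \<longrightarrow>
      b \<in> mat_range M \<longrightarrow> b \<noteq> 0\<^sub>v n \<longrightarrow> t \<noteq> 0\<^sub>v n \<longrightarrow>
      (\<forall>i<n. \<forall>j<n. poly_bounded k n (M $$ (i, j))) \<longrightarrow>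
      (\<forall>i<n. poly_bounded k n (vec_index b i) \<and> poly_bounded k n (vec_index t i)) \<longrightarrow>
      rcdd M \<longrightarrow>
      (\<forall>i<n. \<forall>j<n. M $$ (i, j) \<noteq> 0 \<longrightarrow> \<bar>M $$ (i, j)\<bar> \<ge> c) \<longrightarrow>
      valid_access M b acc \<longrightarrow>
      \<epsilon> > 0 \<longrightarrow> 0 < \<gamma> \<longrightarrow> \<gamma> \<le> gamma_max M \<longrightarrow>
      log_arg M b t \<le> B \<longrightarrow>
      log1 (1 / (\<gamma> * \<epsilon>) * B) \<le> \<kappa> * log1 (1 / (\<gamma> * \<epsilon>) * log_arg M b t) \<longrightarrow>
      (let L = trunc_len \<epsilon> \<gamma> M b t; f = real (f_row M acc) in
       estimates_within M b t acc prog (init_state M t acc \<epsilon> \<gamma> B) \<epsilon> (scalar_prod t (x_star M b))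
         (C * real (l0_norm b) +
          C * min
            (f powr (1/3) * lp_norm 1 t powr (2/3) * lp_norm 1 b powr (2/3)
               * L powr (7/3) * \<epsilon> powr (-2/3))
            (f powr (1/2) * lp_norm 1 t * lp_norm 1 b powr (1/2)
               * lp_norm \<infinity> (diag_powr M (-1) *\<^sub>v b) powr (1/2)
               * L powr (5/2) * \<epsilon> powr (-1)))))"
proof (intro exI[of _ main_prog] allI impI, elim conjE)
  fix c :: real and k :: nat and \<kappa> :: real
  assume c: "0 < c" and \<kappa>: "1 \<le> \<kappa>"
  \<comment> \<open>This is \<open>cost_const\<close> spelled out, because the constant must be
    fixed from \<open>c\<close> and \<kappa> before an instance is given.\<close>
  define C where "C = 55 + (4 * (1 + 4 / c\<^sup>2 + 4 / c) + 116 / c + 190) * (6 * \<kappa>) ^ 3"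
  have "0 < C" using c \<kappa> unfolding C_def by (intro add_pos_nonneg mult_nonneg_nonneg) auto
  moreover have "let L = trunc_len \<epsilon> \<gamma> M b t; f = real (f_row M acc) in
       estimates_within M b t acc main_prog (init_state M t acc \<epsilon> \<gamma> B) \<epsilon> (scalar_prod t (x_star M b))
         (C * real (l0_norm b) +
          C * min
            (f powr (1/3) * lp_norm 1 t powr (2/3) * lp_norm 1 b powr (2/3)
               * L powr (7/3) * \<epsilon> powr (-2/3))
            (f powr (1/2) * lp_norm 1 t * lp_norm 1 b powr (1/2)
               * lp_norm \<infinity> (diag_powr M (-1) *\<^sub>v b) powr (1/2)
               * L powr (5/2) * \<epsilon> powr (-1)))"
    if "M \<in> carrier_mat n n" "b \<in> carrier_vec n" "t \<in> carrier_vec n" "b \<in> mat_range M" "b \<noteq> 0\<^sub>v n" "t \<noteq> 0\<^sub>v n"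
      "rcdd M" "\<forall>i<n. \<forall>j<n. M $$ (i, j) \<noteq> 0 \<longrightarrow> c \<le> \<bar>M $$ (i, j)\<bar>" "valid_access M b acc"
      "0 < \<epsilon>" "0 < \<gamma>" "\<gamma> \<le> gamma_max M" "log_arg M b t \<le> B"
      and log: "log1 (1 / (\<gamma> * \<epsilon>) * B) \<le> \<kappa> * log1 (1 / (\<gamma> * \<epsilon>) * log_arg M b t)"
    for n M b t acc \<epsilon> \<gamma> B
  proof -
    interpret rcdd_instance M b t acc n \<epsilon> \<gamma> B c
      using that c by unfold_locales auto
    show ?thesis unfolding Let_def
      by (rule main_prog_estimates_within[OF \<kappa> log]) (simp add: C_def cost_const_def len_const_def)
  qed
  ultimately show "\<exists>C > 0. \<forall>(n :: nat) (M :: real mat) (b :: real vec) (t :: real vec) (acc :: access)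
        (\<epsilon> :: real) (\<gamma> :: real) (B :: real).
      M \<in> carrier_mat n n \<longrightarrow> b \<in> carrier_vec n \<longrightarrow> t \<in> carrier_vec n \<longrightarrow>
      b \<in> mat_range M \<longrightarrow> b \<noteq> 0\<^sub>v n \<longrightarrow> t \<noteq> 0\<^sub>v n \<longrightarrow>
      (\<forall>i<n. \<forall>j<n. poly_bounded k n (M $$ (i, j))) \<longrightarrow>
      (\<forall>i<n. poly_bounded k n (vec_index b i) \<and> poly_bounded k n (vec_index t i)) \<longrightarrow>
      rcdd M \<longrightarrow>
      (\<forall>i<n. \<forall>j<n. M $$ (i, j) \<noteq> 0 \<longrightarrow> \<bar>M $$ (i, j)\<bar> \<ge> c) \<longrightarrow>
      valid_access M b acc \<longrightarrow>
      \<epsilon> > 0 \<longrightarrow> 0 < \<gamma> \<longrightarrow> \<gamma> \<le> gamma_max M \<longrightarrow>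
      log_arg M b t \<le> B \<longrightarrow>
      log1 (1 / (\<gamma> * \<epsilon>) * B) \<le> \<kappa> * log1 (1 / (\<gamma> * \<epsilon>) * log_arg M b t) \<longrightarrow>
      (let L = trunc_len \<epsilon> \<gamma> M b t; f = real (f_row M acc) in
       estimates_within M b t acc main_prog (init_state M t acc \<epsilon> \<gamma> B) \<epsilon> (scalar_prod t (x_star M b))
         (C * real (l0_norm b) +
          C * min
            (f powr (1/3) * lp_norm 1 t powr (2/3) * lp_norm 1 b powr (2/3)
               * L powr (7/3) * \<epsilon> powr (-2/3))
            (f powr (1/2) * lp_norm 1 t * lp_norm 1 b powr (1/2)
               * lp_norm \<infinity> (diag_powr M (-1) *\<^sub>v b) powr (1/2)
               * L powr (5/2) * \<epsilon> powr (-1))))"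
    by (intro exI[of _ C] conjI allI impI)
qed

end
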